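(* Let $g,p$ be non-negative integers, let $F_{g,p}=\langle t_1,\dots,t_p,x_1,\dots,x_g,y_1,\dots,y_g\mid\ \rangle$, let $V,W\in F_{g,p}$, let $H$ be a free group, let $\phi$ be an endomorphism of the free product $H*F_{g,p}$, and suppose that the following hold. (a) $V$ is a Zieschang element of $F_{g,p}$. (b) $|W|\le 4g+p$. (c) $V^\phi=W$. (d) There exists a permutation $\pi$ of $\{1,\dots,p\}$ such that, for each $j\in\{1,\dots,p\}$, $t_j^\phi$ is $(H*F_{g,p})$-conjugate to $t_{j^\pi}$. (e) The image $F_{g,p}^{\phi}$ of $F_{g,p}$ under $\phi$ is isomorphic to $F_{g,p}$. Then $W$ is a Zieschang element of $F_{g,p}$, and there exists an edge $V\xrightarrow{\phi'}W$ in the subgroupoid of the Zieschang groupoid $\mathcal{Z}_{g,p}$ generated by the Nielsen subgraph $\mathcal{N}_{g,p}$ such that $\phi$ acts as $\phi'$ on the free factor $F_{g,p}$ (that is, $u^\phi=u^{\phi'}$ for all $u\in F_{g,p}$).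
   Context: Maps act on the right, written as exponents. $[u]$ denotes the conjugacy class of $u$ in $F_{g,p}$; $\overline u=u^{-1}$. For $W\in F_{g,p}$, $|W|$ is the length of $W$ as a reduced word in the basis $\{t_j\}\cup\{x_i\}\cup\{y_i\}$ and inverses. Letters: the $t$-letters are $t_1,\dots,t_p$; the $x$-letters are $x_i^{\pm1},y_i^{\pm1}$ $(1\le i\le g)$; letters are the elements $t_j^{\pm1},x_i^{\pm1},y_i^{\pm1}$. Zieschang elements. Let $k\mapsto v_k$ be a bijection from $\{1,\dots,4g+p\}$ onto $\{t_j:1\le j\le p\}\cup\{x_i^{\pm1},y_i^{\pm1}:1\le i\le g\}$, and let $V=v_1v_2\cdots v_{4g+p}$. Let $\Gamma$ be the graph (loops and multiple edges allowed) with vertex set all letters $t_j^{\pm1},x_i^{\pm1},y_i^{\pm1}$ and with one edge from $\overline t_j$ to $t_j$ for each $1\le j\le p$ and one edge from $v_k$ to $\overline v_{k+1}$ for each $1\le k\le 4g+p-1$. If $\Gamma$ has no cycles (is a forest), $V$ is called a Zieschang element of $F_{g,p}$; then $v_1\cdots v_{4g+p}$ is the reduced expression of $V$. Zieschang groupoid $\mathcal{Z}_{g,p}$. Its objects (vertices) are the Zieschang elements of $F_{g,p}$. Its morphisms (edges) from $V$ to $W$ are the triples $(V,W,\phi)$, written $V\xrightarrow{\phi}W$, with $\phi\in\mathrm{Aut}\,F_{g,p}$ permuting the set of conjugacy classes $\{[t_1],\dots,[t_p]\}$ and $V^\phi=W$. Composition is induced by composition of automorphisms. Nielsen subgraph $\mathcal{N}_{g,p}$.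 It has all Zieschang elements as vertices, and its edges are the following edges $V\xrightarrow{\phi}W$ of $\mathcal{Z}_{g,p}$, where $V=v_1\cdots v_{4g+p}$ is the reduced expression of the Zieschang element $V$ and $W=V^\phi$ (in each case $W$ is again a Zieschang element): - Nielsen$_1$ edges: $\phi\in\mathrm{Aut}\,F_{g,p}$ permutes the $t$-letters and permutes the $x$-letters. - Nielsen$_2$ edges: for some $k$ with $1\le k\le 4g+p-1$ such that $v_k$ is an $x$-letter, $\phi$ sends $v_k\mapsto v_k\overline v_{k+1}$ (right type); or for some $k$ with $2\le k\le 4g+p$ such that $v_k$ is an $x$-letter, $\phi$ sends $v_k\mapsto\overline v_{k-1}v_k$ (left type); in both cases $\phi$ fixes every letter other than $v_k^{\pm1}$. - Nielsen$_3$ edges: for some $k$ with $1\le k\le 4g+p-1$ such that $v_k$ is a $t$-letter, $\phi$ sends $v_k\mapsto v_{k+1}v_k\overline v_{k+1}$ (right type); or for some $k$ with $2\le k\le 4g+p$ such that $v_k$ is a $t$-letter, $\phi$ sends $v_k\mapsto\overline v_{k-1}v_kv_{k-1}$ (left type); in both cases $\phi$ fixes every letter other than $v_k^{\pm1}$. *)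

theory Defs
  imports "HOL-Algebra.Bij" "HOL-Combinatorics.Permutations"
begin

section \<open>Free groups\<close>

text \<open>
  A letter over \<open>'a\<close> is a pair \<open>(a, b)\<close>: \<open>(a, True)\<close> is the generator \<open>a\<close> and
  \<open>(a, False)\<close> is its inverse.
\<close>

type_synonym 'a letter = "'a \<times> bool"

definition inv_letter :: "'a letter \<Rightarrow> 'a letter" where
  "inv_letter l = (fst l, \<not> snd l)"

definition reduced :: "'a letter list \<Rightarrow> bool" where
  "reduced w \<longleftrightarrow> successively (\<lambda>l m. m \<noteq> inv_letter l) w"

fun red_cons :: "'a letter \<Rightarrow> 'a letter list \<Rightarrow> 'a letter list" where
  "red_cons l [] = [l]"
| "red_cons l (m # w) = (if m = inv_letter l then w else l # m # w)"

definition reduce :: "'a letter list \<Rightarrow> 'a letter list" where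
  "reduce w = foldr red_cons w []"

text \<open>
  The free group on \<open>S\<close>, its elements being the reduced words over \<open>S\<close>. In particular the
  reduced length of an element is its length as a list.
\<close>

definition free_group :: "'a set \<Rightarrow> 'a letter list monoid" where
  "free_group S =
     \<lparr>carrier = {w. reduced w \<and> fst ` set w \<subseteq> S},
      monoid.mult = (\<lambda>u v. reduce (u @ v)),
      one = []\<rparr>"

definition word_value :: "('a, 'm) monoid_scheme \<Rightarrow> 'a letter list \<Rightarrow> 'a" where
  "word_value G w =
     foldr (\<lambda>(a, b) x. (if b then a else inv\<^bsub>G\<^esub> a) \<otimes>\<^bsub>G\<^esub> x) w \<one>\<^bsub>G\<^esub>"

text \<open>\<open>G\<close> is free if it has a basis: a subset \<open>B\<close> whose inclusion induces
  an isomorphism from the free group on \<open>B\<close> onto \<open>G\<close>.\<close>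

definition is_free_group :: "('a, 'm) monoid_scheme \<Rightarrow> bool" where
  "is_free_group G \<longleftrightarrow>
     group G \<and> (\<exists>B. B \<subseteq> carrier G \<and> word_value G \<in> iso (free_group B) G)"


section \<open>Free products\<close>

text \<open>
  The free product of two groups, realized on normal forms: lists of non-trivial elements
  of the two factors in which no two neighbours come from the same factor.
\<close>

definition fp_factor ::
  "('a, 'm) monoid_scheme \<Rightarrow> ('b, 'n) monoid_scheme \<Rightarrow> ('a + 'b) set" where
  "fp_factor G K = (carrier G - {\<one>\<^bsub>G\<^esub>}) <+> (carrier K - {\<one>\<^bsub>K\<^esub>})"

text \<open>Left multiplication of a normal form by a non-trivial element of one factor.\<close>

fun fp_cons ::
  "('a, 'm) monoid_scheme \<Rightarrow> ('b, 'n) monoid_scheme \<Rightarrow> 'a + 'b \<Rightarrow> ('a + 'b) list \<Rightarrow> ('a + 'b) list"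
where
  "fp_cons G K (Inl a) (Inl b # w) =
     (if a \<otimes>\<^bsub>G\<^esub> b = \<one>\<^bsub>G\<^esub> then w else Inl (a \<otimes>\<^bsub>G\<^esub> b) # w)"
| "fp_cons G K (Inr a) (Inr b # w) =
     (if a \<otimes>\<^bsub>K\<^esub> b = \<one>\<^bsub>K\<^esub> then w else Inr (a \<otimes>\<^bsub>K\<^esub> b) # w)"
| "fp_cons G K s w = s # w"

definition free_product ::
  "('a, 'm) monoid_scheme \<Rightarrow> ('b, 'n) monoid_scheme \<Rightarrow> ('a + 'b) list monoid" where
  "free_product G K =
     \<lparr>carrier = {w. set w \<subseteq> fp_factor G K \<and> successively (\<lambda>s t. isl s \<noteq> isl t) w},
      monoid.mult = (\<lambda>u v. foldr (fp_cons G K) u v),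
      one = []\<rparr>"

definition fp_inr :: "('b, 'n) monoid_scheme \<Rightarrow> 'b \<Rightarrow> ('a + 'b) list" where
  "fp_inr K x = (if x = \<one>\<^bsub>K\<^esub> then [] else [Inr x])"


section \<open>Conjugacy classes\<close>

definition conj_class :: "('a, 'm) monoid_scheme \<Rightarrow> 'a \<Rightarrow> 'a set" where
  "conj_class G u = {inv\<^bsub>G\<^esub> h \<otimes>\<^bsub>G\<^esub> u \<otimes>\<^bsub>G\<^esub> h | h. h \<in> carrier G}"


section \<open>Cycles in multigraphs\<close>

text \<open>
  A multigraph is given by a set \<open>E\<close> of edges and the set \<open>ends e\<close> of end points of each edge,
  a singleton if \<open>e\<close> is a loop. A loop is a cycle of length 1, and two parallel edges
  form a cycle of length 2.
\<close>

definition is_cycle :: "'e set \<Rightarrow> ('e \<Rightarrow> 'v set) \<Rightarrow> 'v list \<Rightarrow> 'e list \<Rightarrow> bool" where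
  "is_cycle E ends vs es \<longleftrightarrow>
     vs \<noteq> [] \<and> length es = length vs \<and> distinct vs \<and> distinct es \<and> set es \<subseteq> E \<and>
     (\<forall>i < length vs. ends (es ! i) = {vs ! i, vs ! (Suc i mod length vs)})"

definition is_forest :: "'e set \<Rightarrow> ('e \<Rightarrow> 'v set) \<Rightarrow> bool" where
  "is_forest E ends \<longleftrightarrow> (\<nexists>vs es. is_cycle E ends vs es)"


section \<open>The group \<open>F\<^sub>g\<^sub>,\<^sub>p\<close> and Zieschang elements\<close>

datatype gen = Tgen nat | Xgen nat | Ygen nat

definition gens :: "nat \<Rightarrow> nat \<Rightarrow> gen set" where
  "gens g p = Tgen ` {1..p} \<union> Xgen ` {1..g} \<union> Ygen ` {1..g}"

definition Fgp :: "nat \<Rightarrow> nat \<Rightarrow> gen letter list monoid" where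
  "Fgp g p = free_group (gens g p)"

definition letters :: "nat \<Rightarrow> nat \<Rightarrow> gen letter set" where
  "letters g p = gens g p \<times> UNIV"

text \<open>The \<open>t\<close>-letters carry exponent \<open>1\<close> only; the \<open>x\<close>-letters carry both exponents.\<close>

definition t_letters :: "nat \<Rightarrow> gen letter set" where
  "t_letters p = Tgen ` {1..p} \<times> {True}"

definition x_letters :: "nat \<Rightarrow> gen letter set" where
  "x_letters g = (Xgen ` {1..g} \<union> Ygen ` {1..g}) \<times> UNIV"

text \<open>Edge \<open>Inl j\<close> joins the inverse of \<open>t\<^sub>j\<close> to \<open>t\<^sub>j\<close>;
  edge \<open>Inr k\<close> joins \<open>v\<^sub>k\<close> to the inverse of \<open>v\<^sub>k\<^sub>+\<^sub>1\<close>.\<close>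

definition zgraph_edges :: "nat \<Rightarrow> nat \<Rightarrow> (nat + nat) set" where
  "zgraph_edges g p = {1..p} <+> {1..4 * g + p - 1}"

fun zgraph_ends :: "(nat \<Rightarrow> gen letter) \<Rightarrow> nat + nat \<Rightarrow> gen letter set" where
  "zgraph_ends v (Inl j) = {(Tgen j, False), (Tgen j, True)}"
| "zgraph_ends v (Inr k) = {v k, inv_letter (v (k + 1))}"

text \<open>\<open>V\<close> is a Zieschang element, witnessed by the enumeration
  \<open>v 1, \<dots>, v (4 * g + p)\<close> of the letters.\<close>

definition zieschang_enum ::
  "nat \<Rightarrow> nat \<Rightarrow> (nat \<Rightarrow> gen letter) \<Rightarrow> gen letter list \<Rightarrow> bool" where
  "zieschang_enum g p v V \<longleftrightarrow>
     bij_betw v {1..4 * g + p} (t_letters p \<union> x_letters g) \<and>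
     V = reduce (map v [1..<4 * g + p + 1]) \<and>
     is_forest (zgraph_edges g p) (zgraph_ends v)"

definition zieschang_elements :: "nat \<Rightarrow> nat \<Rightarrow> gen letter list set" where
  "zieschang_elements g p = {V. \<exists>v. zieschang_enum g p v V}"


section \<open>The Zieschang groupoid and the Nielsen subgraph\<close>

type_synonym zedge =
  "gen letter list \<times> gen letter list \<times> (gen letter list \<Rightarrow> gen letter list)"

definition t_classes :: "nat \<Rightarrow> nat \<Rightarrow> gen letter list set set" where
  "t_classes g p = (\<lambda>j. conj_class (Fgp g p) [(Tgen j, True)]) ` {1..p}"

definition zieschang_edges :: "nat \<Rightarrow> nat \<Rightarrow> zedge set" where
  "zieschang_edges g p =
     {(V, W, \<phi>). V \<in> zieschang_elements g p \<and> W \<in> zieschang_elements g p \<and>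
        \<phi> \<in> auto (Fgp g p) \<and>
        bij_betw (\<lambda>C. \<phi> ` C) (t_classes g p) (t_classes g p) \<and> \<phi> V = W}"

definition nielsen1 :: "nat \<Rightarrow> nat \<Rightarrow> (gen letter list \<Rightarrow> gen letter list) \<Rightarrow> bool" where
  "nielsen1 g p \<phi> \<longleftrightarrow>
     bij_betw \<phi> ((\<lambda>l. [l]) ` t_letters p) ((\<lambda>l. [l]) ` t_letters p) \<and>
     bij_betw \<phi> ((\<lambda>l. [l]) ` x_letters g) ((\<lambda>l. [l]) ` x_letters g)"

definition fixes_other_letters ::
  "nat \<Rightarrow> nat \<Rightarrow> gen letter \<Rightarrow> (gen letter list \<Rightarrow> gen letter list) \<Rightarrow> bool" where
  "fixes_other_letters g p l \<phi> \<longleftrightarrow>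
     (\<forall>m \<in> letters g p. m \<noteq> l \<longrightarrow> m \<noteq> inv_letter l \<longrightarrow> \<phi> [m] = [m])"

definition nielsen2 ::
  "nat \<Rightarrow> nat \<Rightarrow> (nat \<Rightarrow> gen letter) \<Rightarrow> (gen letter list \<Rightarrow> gen letter list) \<Rightarrow> bool" where
  "nielsen2 g p v \<phi> \<longleftrightarrow>
     (\<exists>k \<in> {1..4 * g + p - 1}. v k \<in> x_letters g \<and>
        \<phi> [v k] = [v k] \<otimes>\<^bsub>Fgp g p\<^esub> inv\<^bsub>Fgp g p\<^esub> [v (k + 1)] \<and>
        fixes_other_letters g p (v k) \<phi>) \<or>
     (\<exists>k \<in> {2..4 * g + p}. v k \<in> x_letters g \<and>
        \<phi> [v k] = inv\<^bsub>Fgp g p\<^esub> [v (k - 1)] \<otimes>\<^bsub>Fgp g p\<^esub> [v k] \<and>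
        fixes_other_letters g p (v k) \<phi>)"

definition nielsen3 ::
  "nat \<Rightarrow> nat \<Rightarrow> (nat \<Rightarrow> gen letter) \<Rightarrow> (gen letter list \<Rightarrow> gen letter list) \<Rightarrow> bool" where
  "nielsen3 g p v \<phi> \<longleftrightarrow>
     (\<exists>k \<in> {1..4 * g + p - 1}. v k \<in> t_letters p \<and>
        \<phi> [v k] = [v (k + 1)] \<otimes>\<^bsub>Fgp g p\<^esub> [v k] \<otimes>\<^bsub>Fgp g p\<^esub> inv\<^bsub>Fgp g p\<^esub> [v (k + 1)] \<and>
        fixes_other_letters g p (v k) \<phi>) \<or>
     (\<exists>k \<in> {2..4 * g + p}. v k \<in> t_letters p \<and>
        \<phi> [v k] = inv\<^bsub>Fgp g p\<^esub> [v (k - 1)] \<otimes>\<^bsub>Fgp g p\<^esub> [v k] \<otimes>\<^bsub>Fgp g p\<^esub> [v (k - 1)] \<and>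
        fixes_other_letters g p (v k) \<phi>)"

definition nielsen_edges :: "nat \<Rightarrow> nat \<Rightarrow> zedge set" where
  "nielsen_edges g p =
     {(V, W, \<phi>) \<in> zieschang_edges g p.
        \<exists>v. zieschang_enum g p v V \<and> (nielsen1 g p \<phi> \<or> nielsen2 g p v \<phi> \<or> nielsen3 g p v \<phi>)}"

text \<open>
  The edges of the subgroupoid generated by the Nielsen subgraph. Maps of the groupoid act on
  the right, whereas the product of the library's \<open>AutoGroup\<close> is composition of maps acting on
  the left; this is why the factors are swapped in \<open>comp\<close>. The Nielsen subgraph contains all
  vertices, so all identities are present.
\<close>

inductive_set nielsen_subgroupoid :: "nat \<Rightarrow> nat \<Rightarrow> zedge set" for g p where
  edge: "e \<in> nielsen_edges g p \<Longrightarrow> e \<in> nielsen_subgroupoid g p"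
| ident: "V \<in> zieschang_elements g p \<Longrightarrow>
    (V, V, \<one>\<^bsub>AutoGroup (Fgp g p)\<^esub>) \<in> nielsen_subgroupoid g p"
| comp: "(U, V, \<phi>) \<in> nielsen_subgroupoid g p \<Longrightarrow> (V, W, \<psi>) \<in> nielsen_subgroupoid g p \<Longrightarrow>
    (U, W, \<psi> \<otimes>\<^bsub>AutoGroup (Fgp g p)\<^esub> \<phi>) \<in> nielsen_subgroupoid g p"
| inverse: "(U, V, \<phi>) \<in> nielsen_subgroupoid g p \<Longrightarrow>
    (V, U, inv\<^bsub>AutoGroup (Fgp g p)\<^esub> \<phi>) \<in> nielsen_subgroupoid g p"

end

theory Submission
  imports Defs Complex_Main "HOL-Library.Sublist"
begin

text \<open>
  Write \<open>\<Phi>\<close> for the restriction of \<open>\<phi>\<close> to \<open>F\<close>. The free product of \<open>H\<close> and \<open>F\<close> is free on the union of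
  bases of the two factors (\<open>fp_word\<close>), so \<open>\<Phi>\<close> is a homomorphism from \<open>F\<close> to a free group which sends
  each \<open>t\<^sub>j\<close> to a conjugate of a generator and sends \<open>V\<close> to a word whose length is at most the number
  \<open>n\<close> of letters of \<open>V\<close>. The proof is Nielsen's cancellation argument, carried out with the Nielsen
  moves that the groupoid provides.

  In the graph of \<open>V\<close> every vertex has at most one incoming and one outgoing edge. It is
  a forest iff there is a real function that increases along every edge, and this is how Zieschang
  elements are described here (\<open>zieschang_elements_iff\<close>). A Nielsen move takes a vertex out of its path
  and inserts it elsewhere, so only its rank has to be changed (\<open>ranked_word_twist\<close>).

  All moves have the same form. If \<open>u\<close> and \<open>w\<close> are the end points of an edge between neighbours
  in \<open>V\<close>, then the image of \<open>u\<close> is multiplied on the right by the inverse of the image of \<open>w\<close>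
  if \<open>u\<close> is an \<open>x\<close>-letter, and is conjugated otherwise. What cancels between two neighbours in
  \<open>V\<close> is a common suffix of the images of \<open>u\<close> and \<open>w\<close>. Choose an edge of the Nielsen subgroupoid
  ending in \<open>V\<close> such that the images of the letters after composition with \<open>\<Phi>\<close> are as short
  as possible and, for this length, have lexicographically least first halves. By minimality at most half of an
  image cancels on either side (\<open>overlap\<close>), and not exactly half on both sides (\<open>not_both_halves\<close>). So
  every factor keeps a letter in the product of the images along the source of the edge. This product
  is the image of \<open>V\<close> and has length at most \<open>n\<close>, so every factor keeps exactly one letter.
  Nothing cancels at the start of the path formed by the graph, and this spreads along the path
  (\<open>no_cancellation\<close>). Hence letters are sent to letters.

  Finally, the image of \<open>F\<close> is isomorphic to \<open>F\<close>. Counting modulo squares and commutators shows that no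
  generator dies and that distinct generators stay distinct up to inversion
  (\<open>surj_endo_basis_independent\<close>). So \<open>\<Phi>\<close> after the chosen edge is a permutation of the letters
  preserving the \<open>t\<close>-letters, which is the last edge required (\<open>permutation_nielsen_edge\<close>).
\<close>

section \<open>Words and free groups\<close>

definition word_inv :: "'a letter list \<Rightarrow> 'a letter list" where
  "word_inv w = rev (map inv_letter w)"

lemma inv_letter_inv_letter [simp]: "inv_letter (inv_letter l) = l"
  by (simp add: inv_letter_def)

lemma inv_letter_neq [simp]: "inv_letter l \<noteq> l" "l \<noteq> inv_letter l"
  by (cases l; simp add: inv_letter_def)+

lemma inv_letter_eq_iff [simp]: "inv_letter l = inv_letter m \<longleftrightarrow> l = m"
  by (cases l; cases m; simp add: inv_letter_def)

lemma fst_inv_letter [simp]: "fst (inv_letter l) = fst l"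
  by (simp add: inv_letter_def)

lemma word_inv_simps [simp]:
  "word_inv [] = []" "word_inv (l # w) = word_inv w @ [inv_letter l]"
  "word_inv (u @ w) = word_inv w @ word_inv u" "word_inv (word_inv w) = w"
  "length (word_inv w) = length w" "word_inv w = [] \<longleftrightarrow> w = []"
  by (auto simp: word_inv_def rev_map o_def)

lemma set_word_inv: "set (word_inv w) = inv_letter ` set w"
  by (simp add: word_inv_def)

lemma reduced_Nil [simp]: "reduced []"
  and reduced_single [simp]: "reduced [l]"
  by (simp_all add: reduced_def)

lemma reduced_Cons: "reduced (l # w) \<longleftrightarrow> w = [] \<or> hd w \<noteq> inv_letter l \<and> reduced w"
  by (simp add: reduced_def successively_Cons)

lemma reduced_Cons2 [simp]: "reduced (l # m # w) \<longleftrightarrow> m \<noteq> inv_letter l \<and> reduced (m # w)"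
  by (simp add: reduced_def)

lemma reduced_append:
  "reduced (u @ w) \<longleftrightarrow> reduced u \<and> reduced w \<and> (u = [] \<or> w = [] \<or> hd w \<noteq> inv_letter (last u))"
  by (simp add: reduced_def successively_append_iff)

lemma reduced_ConsD: "reduced (l # w) \<Longrightarrow> reduced w"
  by (auto simp: reduced_Cons)

lemma reduced_word_inv [simp]: "reduced (word_inv w) \<longleftrightarrow> reduced w"
proof -
  show ?thesis
    unfolding reduced_def word_inv_def successively_rev successively_map
    by (intro successively_cong) (metis inv_letter_inv_letter, simp)
qed

lemma red_cons_reduced: "reduced w \<Longrightarrow> reduced (red_cons l w)"
  by (cases w) (auto dest: reduced_ConsD)

lemma red_cons_cancel: "reduced w \<Longrightarrow> red_cons l (red_cons (inv_letter l) w) = w"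
proof (cases w)
  case (Cons m v)
  then show "reduced w \<Longrightarrow> ?thesis"
    by (cases v) auto
qed simp

lemma reduce_Nil [simp]: "reduce [] = []"
  and reduce_Cons: "reduce (l # w) = red_cons l (reduce w)"
  by (simp_all add: reduce_def)

lemma reduced_reduce [simp]: "reduced (reduce w)"
  by (induction w) (auto simp: reduce_Cons red_cons_reduced)

lemma reduce_reduced: "reduced w \<Longrightarrow> reduce w = w"
proof (induction w)
  case (Cons l w)
  then have "reduce w = w"
    by (auto dest: reduced_ConsD)
  then show ?case
    using Cons.prems by (cases w) (auto simp: reduce_Cons)
qed simp

lemma foldr_red_cons_reduced: "reduced w \<Longrightarrow> reduced (foldr red_cons u w)"
  by (induction u) (auto simp: red_cons_reduced)

lemma reduce_append: "reduce (u @ w) = foldr red_cons u (reduce w)"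
  by (simp add: reduce_def)

lemma foldr_red_cons_red_cons:
  "reduced w \<Longrightarrow> foldr red_cons (red_cons l u) w = red_cons l (foldr red_cons u w)"
  by (cases u) (auto simp: red_cons_cancel foldr_red_cons_reduced)

lemma foldr_red_cons_reduce:
  "reduced w \<Longrightarrow> foldr red_cons (reduce u) w = foldr red_cons u w"
  by (induction u) (auto simp: reduce_Cons foldr_red_cons_red_cons)

lemma reduce_append_reduce1 [simp]: "reduce (reduce u @ w) = reduce (u @ w)"
  by (simp add: reduce_append foldr_red_cons_reduce)

lemma reduce_append_reduce2 [simp]: "reduce (u @ reduce w) = reduce (u @ w)"
  by (simp add: reduce_append reduce_reduced)

lemma reduce_reduce [simp]: "reduce (reduce w) = reduce w"
  by (simp add: reduce_reduced)

text \<open>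
  Equations between group elements are proved as equations between reduced forms of
  concatenations; the factors can then be treated one at a time.
\<close>

lemma reduce_cong:
  assumes "reduce u = reduce u'" "reduce w = reduce w'"
  shows "reduce (u @ w) = reduce (u' @ w')"
  by (metis assms reduce_append_reduce1 reduce_append_reduce2)

lemma reduce_inverse_right [simp]: "reduce (w @ word_inv w @ v) = reduce v"
proof (induction w arbitrary: v)
  case (Cons l w)
  then show ?case
    using red_cons_cancel[of "reduce v" l] by (simp add: reduce_Cons)
qed simp

lemma reduce_inverse_left [simp]: "reduce (word_inv w @ w @ v) = reduce v"
  using reduce_inverse_right[of "word_inv w" v] by simp

lemma reduce_inverse_right' [simp]: "reduce (w @ word_inv w) = []"
  using reduce_inverse_right[of w "[]"] by simp

lemma reduce_inverse_left' [simp]: "reduce (word_inv w @ w) = []"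
  using reduce_inverse_right[of "word_inv w" "[]"] by simp

lemma reduce_letter_cancel [simp]: "reduce (l # inv_letter l # v) = reduce v"
  "reduce (inv_letter l # l # v) = reduce v"
  using reduce_inverse_right[of "[l]" v] reduce_inverse_left[of "[l]" v] by simp_all

lemma reduce_eq_cancel_left: "reduce (u @ v) = reduce (u @ w) \<longleftrightarrow> reduce v = reduce w"
proof
  assume "reduce (u @ v) = reduce (u @ w)"
  then have "reduce (word_inv u @ u @ v) = reduce (word_inv u @ u @ w)"
    using reduce_cong[OF refl] by blast
  then show "reduce v = reduce w"
    by simp
qed (auto intro: reduce_cong)

lemma reduce_word_inv: "reduce (word_inv w) = word_inv (reduce w)"
proof -
  have "reduce (w @ word_inv w) = reduce (w @ word_inv (reduce w))"
    using reduce_inverse_right'[of "reduce w"] reduce_append_reduce1[of w "word_inv (reduce w)"]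
    by simp
  then have "reduce (word_inv w) = reduce (word_inv (reduce w))"
    by (subst (asm) reduce_eq_cancel_left)
  then show ?thesis
    by (simp add: reduce_reduced)
qed

lemma set_red_cons: "set (red_cons l w) \<subseteq> insert l (set w)"
  by (cases w) auto

lemma set_reduce: "set (reduce w) \<subseteq> set w"
  by (induction w) (use set_red_cons in \<open>fastforce simp: reduce_Cons\<close>)+

lemma length_red_cons: "length (red_cons l w) \<le> Suc (length w)"
  by (cases w) auto

lemma length_reduce: "length (reduce w) \<le> length w"
  by (induction w) (auto simp: reduce_Cons intro: order_trans[OF length_red_cons])

lemma length_reduce_less: "\<not> reduced w \<Longrightarrow> length (reduce w) < length w"
proof (induction w)
  case (Cons l w)
  show ?case
  proof (cases "reduced w")
    case True
    with Cons.prems obtain v where "w = inv_letter l # v"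
      by (cases w) auto
    then show ?thesis
      using length_reduce[of v] by simp
  next
    case False
    then show ?thesis
      using Cons.IH length_red_cons[of l "reduce w"] by (simp add: reduce_Cons)
  qed
qed simp

lemma reduce_map_inv_letter: "reduce (map inv_letter w) = map inv_letter (reduce w)"
proof (induction w)
  case (Cons l w)
  have "red_cons (inv_letter l) (map inv_letter v) = map inv_letter (red_cons l v)" for v
    by (cases v) auto
  then show ?case
    using Cons by (simp add: reduce_Cons)
qed simp

lemma reduce_rev: "reduce (rev w) = rev (reduce w)"
proof -
  have "rev w = word_inv (map inv_letter w)"
    by (simp add: word_inv_def o_def)
  then have "reduce (rev w) = word_inv (map inv_letter (reduce w))"
    by (simp add: reduce_word_inv reduce_map_inv_letter)
  then show ?thesis
    by (simp add: word_inv_def o_def)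
qed

lemma carrier_free_group: "w \<in> carrier (free_group S) \<longleftrightarrow> reduced w \<and> fst ` set w \<subseteq> S"
  and mult_free_group [simp]: "u \<otimes>\<^bsub>free_group S\<^esub> v = reduce (u @ v)"
  and one_free_group [simp]: "\<one>\<^bsub>free_group S\<^esub> = []"
  by (auto simp: free_group_def)

lemma reduce_in_free_group: "fst ` set w \<subseteq> S \<Longrightarrow> reduce w \<in> carrier (free_group S)"
  using set_reduce[of w] by (auto simp: carrier_free_group)

lemma word_inv_in_free_group:
  "w \<in> carrier (free_group S) \<Longrightarrow> word_inv w \<in> carrier (free_group S)"
  by (auto simp: carrier_free_group set_word_inv)

lemma group_free_group: "group (free_group S)"
proof (rule groupI)
  fix w assume "w \<in> carrier (free_group S)"
  then show "\<exists>v\<in>carrier (free_group S). v \<otimes>\<^bsub>free_group S\<^esub> w = \<one>\<^bsub>free_group S\<^esub>"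
    by (intro bexI[of _ "word_inv w"]) (auto simp: word_inv_in_free_group)
next
  fix u v assume "u \<in> carrier (free_group S)" "v \<in> carrier (free_group S)"
  then show "u \<otimes>\<^bsub>free_group S\<^esub> v \<in> carrier (free_group S)"
    by (simp add: carrier_free_group image_Un reduce_in_free_group[unfolded carrier_free_group])
qed (auto simp: reduce_reduced carrier_free_group)

lemma inv_free_group:
  "w \<in> carrier (free_group S) \<Longrightarrow> inv\<^bsub>free_group S\<^esub> w = word_inv w"
  by (rule group.inv_equality[OF group_free_group]) (auto simp: word_inv_in_free_group)

definition letter_hom :: "('a letter \<Rightarrow> 'b letter list) \<Rightarrow> 'a letter list \<Rightarrow> 'b letter list" where
  "letter_hom f w = reduce (concat (map f w))"

lemma letter_hom_simps [simp]:
  "letter_hom f [] = []" "letter_hom f [l] = reduce (f l)"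
  by (simp_all add: letter_hom_def)

lemma reduced_letter_hom [simp]: "reduced (letter_hom f w)"
  by (simp add: letter_hom_def)

lemma letter_hom_append: "letter_hom f (u @ w) = reduce (letter_hom f u @ letter_hom f w)"
  by (simp add: letter_hom_def)

lemma letter_hom_Cons: "letter_hom f (l # w) = reduce (f l @ letter_hom f w)"
  by (simp add: letter_hom_def)

lemma letter_hom_reduce:
  assumes "\<And>l. l \<in> set w \<Longrightarrow> reduce (f l @ f (inv_letter l)) = []"
  shows "letter_hom f (reduce w) = letter_hom f w"
  using assms
proof (induction w)
  case (Cons l w)
  have IH: "letter_hom f (reduce w) = letter_hom f w"
    using Cons by simp
  have "letter_hom f (red_cons l v) = letter_hom f (l # v)" for v
  proof (cases v)
    case (Cons m v')
    have "reduce (f l @ f (inv_letter l) @ u) = reduce u" for u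
      using Cons.prems[of l] by (metis append.assoc append_Nil list.set_intros(1) reduce_append_reduce1)
    with Cons show ?thesis
      by (auto simp: letter_hom_def)
  qed simp
  with IH show ?case
    by (simp add: reduce_Cons letter_hom_Cons)
qed simp

lemma letter_hom_in_hom:
  assumes "\<And>l. fst l \<in> S \<Longrightarrow> reduce (f l @ f (inv_letter l)) = []"
    and "\<And>l. fst l \<in> S \<Longrightarrow> fst ` set (f l) \<subseteq> T"
  shows "letter_hom f \<in> hom (free_group S) (free_group T)"
proof (rule homI)
  fix u assume "u \<in> carrier (free_group S)"
  then have "fst ` set (concat (map f u)) \<subseteq> T"
    using assms(2) unfolding carrier_free_group by fastforce
  then show "letter_hom f u \<in> carrier (free_group T)"
    by (simp add: letter_hom_def reduce_in_free_group)
next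
  fix u v assume "u \<in> carrier (free_group S)" "v \<in> carrier (free_group S)"
  then have "letter_hom f (reduce (u @ v)) = letter_hom f (u @ v)"
    by (intro letter_hom_reduce assms(1)) (auto simp: carrier_free_group)
  then show "letter_hom f (u \<otimes>\<^bsub>free_group S\<^esub> v) =
      letter_hom f u \<otimes>\<^bsub>free_group T\<^esub> letter_hom f v"
    by (simp add: letter_hom_append)
qed

lemma letter_in_free_group: "[l] \<in> carrier (free_group S) \<longleftrightarrow> fst l \<in> S"
  by (auto simp: carrier_free_group)

lemma hom_free_group_eq:
  assumes h: "h \<in> hom (free_group S) G" and k: "k \<in> hom (free_group S) G" and G: "group G"
    and eq: "\<And>l. fst l \<in> S \<Longrightarrow> h [l] = k [l]"
    and w: "w \<in> carrier (free_group S)"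
  shows "h w = k w"
  using w
proof (induction w)
  case Nil
  show ?case
    using hom_one[OF h group_free_group G] hom_one[OF k group_free_group G] by simp
next
  case (Cons l w)
  then have l: "[l] \<in> carrier (free_group S)" and w: "w \<in> carrier (free_group S)"
    and lw: "l # w = [l] \<otimes>\<^bsub>free_group S\<^esub> w"
    by (auto simp: carrier_free_group reduce_reduced dest: reduced_ConsD)
  show ?case
    unfolding lw hom_mult[OF h l w] hom_mult[OF k l w] using Cons.IH[OF w] eq l
    by (simp add: letter_in_free_group)
qed

lemma hom_free_group_inv:
  assumes h: "h \<in> hom (free_group S) (free_group T)" and w: "w \<in> carrier (free_group S)"
  shows "h (word_inv w) = word_inv (h w)"
proof -
  have "h (inv\<^bsub>free_group S\<^esub> w) = inv\<^bsub>free_group T\<^esub> (h w)"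
    by (intro group_hom.hom_inv group_hom.intro group_hom_axioms.intro group_free_group h w)
  then show ?thesis
    using w hom_in_carrier[OF h w] by (simp add: inv_free_group)
qed

lemma hom_free_group_letter_hom:
  assumes h: "h \<in> hom (free_group S) (free_group T)" and w: "w \<in> carrier (free_group S)"
  shows "h w = letter_hom (\<lambda>l. h [l]) w"
proof (rule hom_free_group_eq[OF h _ group_free_group _ w])
  have *: "reduced (h [l])" "fst ` set (h [l]) \<subseteq> T" if "fst l \<in> S" for l
    using hom_in_carrier[OF h, of "[l]"] that by (auto simp: carrier_free_group)
  have "h [inv_letter l] = word_inv (h [l])" if "fst l \<in> S" for l
    using hom_free_group_inv[OF h, of "[l]"] that by (simp add: letter_in_free_group)
  with * show "letter_hom (\<lambda>l. h [l]) \<in> hom (free_group S) (free_group T)"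
    by (intro letter_hom_in_hom) auto
  show "h [l] = letter_hom (\<lambda>l. h [l]) [l]" if "fst l \<in> S" for l
    using *[OF that] by (simp add: reduce_reduced)
qed

section \<open>The rank of a free group\<close>

text \<open>
  The image of a word in the elementary abelian 2-group on the generators; its elements are finite
  sets of generators, added by symmetric difference.
\<close>

definition odd_gens :: "'a letter list \<Rightarrow> 'a set" where
  "odd_gens w = {x. odd (count_list (map fst w) x)}"

lemma odd_gens_simps [simp]:
  "odd_gens [] = {}" "odd_gens (l # w) = sym_diff {fst l} (odd_gens w)"
  "odd_gens (u @ w) = sym_diff (odd_gens u) (odd_gens w)"
  by (auto simp: odd_gens_def)

lemma odd_gens_reduce [simp]: "odd_gens (reduce w) = odd_gens w"
proof (induction w)
  case (Cons l w)
  have "odd_gens (red_cons l v) = sym_diff {fst l} (odd_gens v)" for v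
    by (cases v) auto
  then show ?case
    using Cons by (simp add: reduce_Cons)
qed simp

lemma odd_gens_word_inv [simp]: "odd_gens (word_inv w) = odd_gens w"
  by (induction w) auto

lemma odd_gens_subset: "odd_gens w \<subseteq> fst ` set w"
proof
  fix x assume "x \<in> odd_gens w"
  then have "count_list (map fst w) x \<noteq> 0"
    by (auto simp: odd_gens_def intro!: Nat.gr0I)
  then show "x \<in> fst ` set w"
    by (simp add: count_list_0_iff)
qed

lemma odd_gens_surj:
  assumes "finite S" "Y \<subseteq> S"
  shows "\<exists>w\<in>carrier (free_group S). odd_gens w = Y"
proof -
  from assms have "finite Y"
    by (rule finite_subset[rotated])
  then have "\<exists>w. fst ` set w \<subseteq> Y \<and> odd_gens w = Y"
  proof (induction Y)
    case (insert y Y)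
    then obtain w where "fst ` set w \<subseteq> Y" "odd_gens w = Y"
      by blast
    with insert show ?case
      by (intro exI[of _ "(y, True) # w"]) auto
  qed (intro exI[of _ "[]"], simp)
  then obtain w where "fst ` set w \<subseteq> Y" "odd_gens w = Y"
    by blast
  with assms show ?thesis
    by (intro bexI[of _ "reduce w"] reduce_in_free_group) auto
qed

text \<open>
  Modulo squares and commutators, \<open>h\<close> becomes a map \<open>M\<close> from the subsets of \<open>S\<close> to themselves that
  is additive for symmetric differences. It is onto because \<open>h\<close> is, hence injective because \<open>S\<close> is
  finite; so \<open>M\<close> separates the empty set and the singletons. The exponents \<open>b\<close> and \<open>c\<close> are
  invisible modulo 2.
\<close>

lemma surj_endo_basis_independent:
  assumes S: "finite S" and h: "h \<in> hom (free_group S) (free_group S)"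
    and surj: "h ` carrier (free_group S) = carrier (free_group S)"
    and x: "x \<in> S"
  shows "h [(x, b)] \<noteq> []"
    and "y \<in> S \<Longrightarrow> x \<noteq> y \<Longrightarrow> h [(x, b)] \<noteq> h [(y, c)]"
proof -
  \<comment> \<open>The additive map whose value at the singleton of a generator is read off its image.\<close>
  define M where "M Y = {z. odd (card {x \<in> Y. z \<in> odd_gens (h [(x, True)])})}" for Y
  have h_one: "h [] = []"
    using hom_one[OF h group_free_group group_free_group] by simp
  have False_eq: "odd_gens (h [(x, False)]) = odd_gens (h [(x, True)])" if "x \<in> S" for x
    using hom_free_group_inv[OF h, of "[(x, True)]"] that
    by (simp add: letter_in_free_group inv_letter_def)
  have M_insert: "M (sym_diff {x} Y) = sym_diff (odd_gens (h [(x, True)])) (M Y)"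
    if "finite Y" for x Y
  proof (subst set_eq_iff, intro allI)
    fix z
    let ?A = "{x \<in> Y. z \<in> odd_gens (h [(x, True)])}"
    have fin: "finite ?A"
      using that by simp
    have A: "{x' \<in> sym_diff {x} Y. z \<in> odd_gens (h [(x', True)])} =
        (if z \<in> odd_gens (h [(x, True)]) then sym_diff {x} ?A else ?A)"
      by auto
    have flip: "odd (card (sym_diff {x} ?A)) \<longleftrightarrow> even (card ?A)"
    proof (cases "x \<in> ?A")
      case True
      then have "sym_diff {x} ?A = ?A - {x}"
        by blast
      then show ?thesis
        using card_Suc_Diff1[OF fin True] by presburger
    next
      case False
      then have "sym_diff {x} ?A = insert x ?A"
        by blast
      then show ?thesis
        using card_insert_disjoint[OF fin False] by presburger
    qed
    have M1: "z \<in> M (sym_diff {x} Y) \<longleftrightarrow>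
        odd (card (if z \<in> odd_gens (h [(x, True)]) then sym_diff {x} ?A else ?A))"
      unfolding M_def mem_Collect_eq A ..
    have M2: "z \<in> M Y \<longleftrightarrow> odd (card ?A)"
      unfolding M_def mem_Collect_eq ..
    show "z \<in> M (sym_diff {x} Y) \<longleftrightarrow> z \<in> sym_diff (odd_gens (h [(x, True)])) (M Y)"
    proof (cases "z \<in> odd_gens (h [(x, True)])")
      case True
      then show ?thesis
        unfolding Un_iff Diff_iff M1 M2 if_P[OF True] flip by argo
    next
      case False
      then show ?thesis
        unfolding Un_iff Diff_iff M1 M2 if_not_P[OF False] by argo
    qed
  qed
  have M: "odd_gens (h w) = M (odd_gens w)" if "w \<in> carrier (free_group S)" for w
    using that
  proof (induction w)
    case Nil
    then show ?case
      by (simp add: h_one M_def)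
  next
    case (Cons l w)
    then have l: "[l] \<in> carrier (free_group S)" and w: "w \<in> carrier (free_group S)"
      and lw: "l # w = [l] \<otimes>\<^bsub>free_group S\<^esub> w"
      by (auto simp: carrier_free_group reduce_reduced dest: reduced_ConsD)
    have "finite (odd_gens w)"
      by (rule finite_subset[OF odd_gens_subset]) simp
    moreover have "odd_gens (h [l]) = odd_gens (h [(fst l, True)])"
      using False_eq[of "fst l"] l by (cases l; cases "snd l") (auto simp: letter_in_free_group)
    moreover have "odd_gens (h (l # w)) = sym_diff (odd_gens (h [l])) (odd_gens (h w))"
      unfolding lw hom_mult[OF h l w] by simp
    ultimately show ?case
      using Cons.IH[OF w] M_insert[of "odd_gens w" "fst l"] by simp
  qed
  have "Pow S \<subseteq> M ` Pow S"
  proof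
    fix Y assume "Y \<in> Pow S"
    then obtain w where w: "w \<in> carrier (free_group S)" "odd_gens w = Y"
      using odd_gens_surj[OF S] by blast
    then have "w \<in> h ` carrier (free_group S)"
      by (simp only: surj)
    then obtain v where v: "v \<in> carrier (free_group S)" "w = h v"
      by (rule imageE)
    have "odd_gens v \<subseteq> S"
      using v(1) odd_gens_subset[of v] unfolding carrier_free_group by (elim conjE) (rule order_trans)
    moreover have "Y = M (odd_gens v)"
      using M[OF v(1)] w v(2) by simp
    ultimately show "Y \<in> M ` Pow S"
      by blast
  qed
  moreover have "M ` Pow S \<subseteq> Pow S"
  proof (intro subsetI)
    fix Z assume "Z \<in> M ` Pow S"
    then obtain Y where Y: "Y \<subseteq> S" "Z = M Y"
      by blast
    then obtain w where w: "w \<in> carrier (free_group S)" "odd_gens w = Y"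
      using odd_gens_surj[OF S] by blast
    have "odd_gens (h w) \<subseteq> fst ` set (h w)"
      by (rule odd_gens_subset)
    also have "\<dots> \<subseteq> S"
      using hom_in_carrier[OF h w(1)] by (simp add: carrier_free_group)
    finally show "Z \<in> Pow S"
      using M[OF w(1)] w(2) Y by simp
  qed
  ultimately have inj: "inj_on M (Pow S)"
    using S by (intro eq_card_imp_inj_on) auto
  have Mx: "odd_gens (h [(z, b)]) = M {z}" if "z \<in> S" for z b
    using M[of "[(z, b)]"] that by (simp add: letter_in_free_group)
  show "h [(x, b)] \<noteq> []"
  proof
    assume "h [(x, b)] = []"
    then have "M {x} = M {}"
      using Mx[OF x, of b] by (simp add: M_def)
    with inj x show False
      by (auto dest: inj_onD)
  qed
  show "h [(x, b)] \<noteq> h [(y, c)]" if "y \<in> S" "x \<noteq> y"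
  proof
    assume "h [(x, b)] = h [(y, c)]"
    then have "M {x} = M {y}"
      using Mx[OF x, of b] Mx[OF that(1), of c] by simp
    with inj x that show False
      by (auto dest: inj_onD)
  qed
qed

section \<open>Embedding a free product of free groups into a free group\<close>

text \<open>
  If \<open>H\<close> is free on \<open>B\<close>, then the free product of \<open>H\<close> with a free group on \<open>S\<close> is free on the
  disjoint union of \<open>B\<close> and \<open>S\<close>: spell each syllable of a normal form in its own alphabet. Syllables
  from different factors have disjoint alphabets, so no cancellation occurs between neighbours.
\<close>

definition syllable_word ::
  "('h, 'm) monoid_scheme \<Rightarrow> 'h set \<Rightarrow> 'h + 'b letter list \<Rightarrow> ('h + 'b) letter list" where
  "syllable_word H B s = (case s of
     Inl a \<Rightarrow> map (map_prod Inl id) (inv_into (carrier (free_group B)) (word_value H) a)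
   | Inr w \<Rightarrow> map (map_prod Inr id) w)"

definition fp_word ::
  "('h, 'm) monoid_scheme \<Rightarrow> 'h set \<Rightarrow> ('h + 'b letter list) list \<Rightarrow> ('h + 'b) letter list" where
  "fp_word H B w = concat (map (syllable_word H B) w)"

lemma reduce_map_letters:
  assumes "inj f"
  shows "reduce (map (map_prod f id) w) = map (map_prod f id) (reduce w)"
proof (induction w)
  case (Cons l w)
  have "map_prod f id m = inv_letter (map_prod f id l) \<longleftrightarrow> m = inv_letter l" for m
    using assms by (cases l; cases m) (auto simp: inv_letter_def dest: injD)
  then have "red_cons (map_prod f id l) (map (map_prod f id) v) =
      map (map_prod f id) (red_cons l v)" for v
    by (cases v) auto
  then show ?case
    unfolding list.map reduce_Cons Cons.IH .
qed simp

lemma word_inv_map_letters: "word_inv (map (map_prod f id) w) = map (map_prod f id) (word_inv w)"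
  by (induction w) (auto simp: inv_letter_def)

lemma inj_map_letters: "inj f \<Longrightarrow> inj (map (map_prod f (id :: bool \<Rightarrow> bool)))"
  by (intro inj_mapI prod.inj_map) auto

locale free_factor =
  fixes H :: "('h, 'm) monoid_scheme" and B :: "'h set" and S :: "'b set"
  assumes group_H: "group H"
    and basis: "word_value H \<in> iso (free_group B) H"
begin

abbreviation "P \<equiv> free_product H (free_group S)"
abbreviation "syl \<equiv> (syllable_word H B :: 'h + 'b letter list \<Rightarrow> ('h + 'b) letter list)"
abbreviation "\<Theta> \<equiv> (fp_word H B :: ('h + 'b letter list) list \<Rightarrow> ('h + 'b) letter list)"
abbreviation "bw \<equiv> inv_into (carrier (free_group B)) (word_value H)"

lemma bw_iso: "bw \<in> iso H (free_group B)"
  by (rule group.iso_set_sym[OF group_free_group basis])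

lemma bw_mult: "a \<in> carrier H \<Longrightarrow> b \<in> carrier H \<Longrightarrow> bw (a \<otimes>\<^bsub>H\<^esub> b) = reduce (bw a @ bw b)"
  using bw_iso by (auto simp: iso_def hom_def)

lemma bw_carrier: "a \<in> carrier H \<Longrightarrow> bw a \<in> carrier (free_group B)"
  using bw_iso by (auto simp: iso_def hom_def)

lemma bw_one: "bw \<one>\<^bsub>H\<^esub> = []"
  using hom_one[OF _ group_H group_free_group, of bw B] bw_iso by (auto simp: iso_def)

lemma bw_inj: "a \<in> carrier H \<Longrightarrow> b \<in> carrier H \<Longrightarrow> bw a = bw b \<longleftrightarrow> a = b"
  using bw_iso by (auto simp: iso_def bij_betw_def inj_on_def)

lemma syl_Inl [simp]: "syl (Inl a) = map (map_prod Inl id) (bw a)"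
  and syl_Inr [simp]: "syl (Inr w) = map (map_prod Inr id) w"
  by (simp_all add: syllable_word_def)

lemma fp_factor_simps [simp]:
  "Inl a \<in> fp_factor H (free_group S) \<longleftrightarrow> a \<in> carrier H \<and> a \<noteq> \<one>\<^bsub>H\<^esub>"
  "Inr w \<in> fp_factor H (free_group S) \<longleftrightarrow> w \<in> carrier (free_group S) \<and> w \<noteq> []"
  by (auto simp: fp_factor_def)

lemma carrier_P: "w \<in> carrier P \<longleftrightarrow>
    set w \<subseteq> fp_factor H (free_group S) \<and> successively (\<lambda>s t. isl s \<noteq> isl t) w"
  and mult_P: "u \<otimes>\<^bsub>P\<^esub> v = foldr (fp_cons H (free_group S)) u v"
  and one_P: "\<one>\<^bsub>P\<^esub> = []"
  by (simp_all add: free_product_def)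

lemma Theta_simps [simp]: "\<Theta> [] = []" "\<Theta> (s # w) = syl s @ \<Theta> w"
  by (simp_all add: fp_word_def)

lemma syl_nonempty: "s \<in> fp_factor H (free_group S) \<Longrightarrow> syl s \<noteq> []"
  using bw_inj[of _ "\<one>\<^bsub>H\<^esub>"] group.is_monoid[OF group_H]
  by (cases s) (auto simp: bw_one monoid.one_closed)

lemma syl_reduced: "s \<in> fp_factor H (free_group S) \<Longrightarrow> reduced (syl s)"
proof -
  assume s: "s \<in> fp_factor H (free_group S)"
  have "reduce (syl s) = syl s"
  proof (cases s)
    case (Inl a)
    then have "reduced (bw a)"
      using s bw_carrier[of a] by (simp add: carrier_free_group)
    then show ?thesis
      unfolding Inl syl_Inl by (simp only: reduce_map_letters[OF inj_Inl] reduce_reduced)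
  next
    case (Inr w)
    then have "reduced w"
      using s by (simp add: carrier_free_group)
    then show ?thesis
      unfolding Inr syl_Inr by (simp only: reduce_map_letters[OF inj_Inr] reduce_reduced)
  qed
  then show ?thesis
    by (metis reduced_reduce)
qed

lemma syl_isl: "l \<in> set (syl s) \<Longrightarrow> isl (fst l) \<longleftrightarrow> isl s"
  by (cases s) auto

lemma syl_inj:
  "s \<in> fp_factor H (free_group S) \<Longrightarrow> t \<in> fp_factor H (free_group S) \<Longrightarrow> syl s = syl t \<Longrightarrow> s = t"
proof -
  assume s: "s \<in> fp_factor H (free_group S)" and t: "t \<in> fp_factor H (free_group S)"
    and eq: "syl s = syl t"
  obtain l where "l \<in> set (syl s)"
    using syl_nonempty[OF s] by (meson last_in_set)
  then have "isl s = isl t"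
    using syl_isl eq by metis
  then show "s = t"
    using s t eq bw_inj inj_map_letters[of "Inl :: 'h \<Rightarrow> 'h + 'b"]
      inj_map_letters[of "Inr :: 'b \<Rightarrow> 'h + 'b"]
    by (cases s; cases t) (auto simp: inj_eq)
qed

lemma Theta_hd:
  assumes "s # w \<in> carrier P" "w \<noteq> []"
  shows "\<Theta> w \<noteq> []" "isl (fst (hd (\<Theta> w))) \<longleftrightarrow> \<not> isl s"
proof -
  obtain t v where w: "w = t # v"
    using assms(2) by (cases w) auto
  then have "isl s \<noteq> isl t" "syl t \<noteq> []"
    using assms(1) by (auto simp: carrier_P syl_nonempty)
  then show "\<Theta> w \<noteq> []" "isl (fst (hd (\<Theta> w))) \<longleftrightarrow> \<not> isl s"
    using syl_isl[of "hd (syl t)" t] by (auto simp: w)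
qed

lemma carrier_P_Cons: "s # w \<in> carrier P \<Longrightarrow> w \<in> carrier P"
  by (auto simp: carrier_P successively_Cons)

lemma Theta_reduced: "w \<in> carrier P \<Longrightarrow> reduced (\<Theta> w)"
proof (induction w)
  case (Cons s w)
  have s: "s \<in> fp_factor H (free_group S)"
    using Cons.prems by (auto simp: carrier_P)
  have "w = [] \<or> hd (\<Theta> w) \<noteq> inv_letter (last (syl s))"
    using Theta_hd[OF Cons.prems] syl_isl[of "last (syl s)" s] syl_nonempty[OF s]
    by (metis fst_inv_letter last_in_set)
  then show ?case
    using Cons.IH[OF carrier_P_Cons[OF Cons.prems]] syl_reduced[OF s]
    by (auto simp: reduced_append)
qed simp

text \<open>
  A normal form can be recovered from its spelling: the first syllable is spelled by the longest
  initial run of letters from a single alphabet.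
\<close>

lemma Theta_inj_on: "inj_on \<Theta> (carrier P)"
proof -
  have split: "takeWhile (\<lambda>l. isl (fst l) = isl s) (\<Theta> (s # w)) = syl s"
    if "s # w \<in> carrier P" for s w
  proof (cases "w = []")
    case True
    then show ?thesis
      using syl_isl[of _ s] by (simp add: takeWhile_eq_all_conv)
  next
    case False
    from Theta_hd[OF that False] show ?thesis
      using syl_isl[of _ s] by (subst Theta_simps, subst takeWhile_append2) (auto simp: neq_Nil_conv)
  qed
  have "u = v" if "u \<in> carrier P" "v \<in> carrier P" "\<Theta> u = \<Theta> v" for u v
    using that
  proof (induction u arbitrary: v)
    case Nil
    then show ?case
      using syl_nonempty by (cases v) (auto simp: carrier_P)
  next
    case (Cons s u)
    have s: "s \<in> fp_factor H (free_group S)"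
      using Cons.prems by (auto simp: carrier_P)
    then obtain t v' where v: "v = t # v'"
      using Cons.prems syl_nonempty by (cases v) auto
    have t: "t \<in> fp_factor H (free_group S)"
      using Cons.prems by (auto simp: carrier_P v)
    have "hd (\<Theta> (s # u)) = hd (syl s)" "hd (\<Theta> v) = hd (syl t)"
      using syl_nonempty[OF s] syl_nonempty[OF t] by (auto simp: v)
    then have "hd (syl s) = hd (syl t)"
      using Cons.prems by simp
    then have "isl s = isl t"
      using syl_isl syl_nonempty[OF s] syl_nonempty[OF t] by (metis hd_in_set)
    then have "syl s = syl t"
      using split[of s u] split[of t v'] Cons.prems by (simp add: v)
    then show ?case
      using Cons.IH[of v'] Cons.prems syl_inj[OF s t] carrier_P_Cons by (auto simp: v)
  qed
  then show ?thesis
    by (auto intro: inj_onI)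
qed

text \<open>
  The case distinctions in the multiplication of normal forms are exactly the free reductions between
  a syllable and the spelling of the rest.
\<close>

lemma fp_cons_closed:
  assumes s: "s \<in> fp_factor H (free_group S)" and w: "w \<in> carrier P"
  shows "fp_cons H (free_group S) s w \<in> carrier P"
    and "\<Theta> (fp_cons H (free_group S) s w) = reduce (syl s @ \<Theta> w)"
proof -
  have "fp_cons H (free_group S) s w \<in> carrier P \<and>
    \<Theta> (fp_cons H (free_group S) s w) = reduce (syl s @ \<Theta> w)"
  proof (cases "w = [] \<or> isl (hd w) \<noteq> isl s")
    case True
    then have "fp_cons H (free_group S) s w = s # w"
      by (cases s; cases w; cases "hd w") auto
    moreover have "s # w \<in> carrier P"
      using True s w by (cases w) (auto simp: carrier_P)
    ultimately show ?thesis
      using Theta_reduced[of "s # w"] by (simp add: reduce_reduced)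
  next
    case False
    then obtain t v where wv: "w = t # v" and st: "isl t = isl s"
      by (cases w) auto
    have t: "t \<in> fp_factor H (free_group S)" and v: "v \<in> carrier P"
      using w carrier_P_Cons by (auto simp: wv carrier_P)
    have hd_v: "v = [] \<or> isl (hd v) \<noteq> isl t"
      using w by (cases v) (auto simp: wv carrier_P)
    have v_red: "reduce (\<Theta> v) = \<Theta> v"
      using Theta_reduced[OF v] by (rule reduce_reduced)
    show ?thesis
    proof (cases s)
      case (Inl a)
      then obtain b where b: "t = Inl b"
        using st by (cases t) auto
      have ab: "a \<in> carrier H" "b \<in> carrier H" "a \<otimes>\<^bsub>H\<^esub> b \<in> carrier H"
        using s t Inl b monoid.m_closed[OF group.is_monoid[OF group_H]] by auto
      have red: "reduce (syl s @ \<Theta> w) = reduce (map (map_prod Inl id) (bw (a \<otimes>\<^bsub>H\<^esub> b)) @ \<Theta> v)"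
        unfolding bw_mult[OF ab(1,2)] reduce_map_letters[OF inj_Inl, symmetric] reduce_append_reduce1
        by (simp add: wv Inl b)
      show ?thesis
      proof (cases "a \<otimes>\<^bsub>H\<^esub> b = \<one>\<^bsub>H\<^esub>")
        case True
        then show ?thesis
          using red v by (simp add: Inl b wv bw_one v_red)
      next
        case False
        then have "Inl (a \<otimes>\<^bsub>H\<^esub> b) # v \<in> carrier P"
          using v ab hd_v by (cases v) (auto simp: carrier_P b)
        then show ?thesis
          using red False Theta_reduced[of "Inl (a \<otimes>\<^bsub>H\<^esub> b) # v"]
          by (simp add: Inl b wv reduce_reduced)
      qed
    next
      case (Inr a)
      then obtain b where b: "t = Inr b"
        using st by (cases t) auto
      have ab: "reduce (a @ b) \<in> carrier (free_group S)"
        using s t Inr b monoid.m_closed[OF group.is_monoid[OF group_free_group], of a S b] by auto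
      have red: "reduce (syl s @ \<Theta> w) = reduce (map (map_prod Inr id) (reduce (a @ b)) @ \<Theta> v)"
        unfolding reduce_map_letters[OF inj_Inr, symmetric] reduce_append_reduce1
        by (simp add: wv Inr b)
      show ?thesis
      proof (cases "reduce (a @ b) = []")
        case True
        then show ?thesis
          using red v by (simp add: Inr b wv v_red)
      next
        case False
        then have "Inr (reduce (a @ b)) # v \<in> carrier P"
          using v ab hd_v by (cases v) (auto simp: carrier_P b)
        then show ?thesis
          using red False Theta_reduced[of "Inr (reduce (a @ b)) # v"]
          by (simp add: Inr b wv reduce_reduced)
      qed
    qed
  qed
  then show "fp_cons H (free_group S) s w \<in> carrier P"
    and "\<Theta> (fp_cons H (free_group S) s w) = reduce (syl s @ \<Theta> w)"
    by auto
qed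

lemma foldr_fp_cons:
  assumes "set u \<subseteq> fp_factor H (free_group S)" and w: "w \<in> carrier P"
  shows "foldr (fp_cons H (free_group S)) u w \<in> carrier P \<and>
    \<Theta> (foldr (fp_cons H (free_group S)) u w) = reduce (\<Theta> u @ \<Theta> w)"
  using assms(1)
proof (induction u)
  case Nil
  then show ?case
    using w Theta_reduced[OF w] by (simp add: reduce_reduced)
qed (auto simp: fp_cons_closed)

lemma mult_P_closed: "u \<in> carrier P \<Longrightarrow> w \<in> carrier P \<Longrightarrow> u \<otimes>\<^bsub>P\<^esub> w \<in> carrier P"
  and Theta_mult: "u \<in> carrier P \<Longrightarrow> w \<in> carrier P \<Longrightarrow> \<Theta> (u \<otimes>\<^bsub>P\<^esub> w) = reduce (\<Theta> u @ \<Theta> w)"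
  using foldr_fp_cons[of u w] by (auto simp: carrier_P mult_P)

lemma Theta_hom: "\<Theta> \<in> hom P (free_group UNIV)"
  by (rule homI) (auto simp: Theta_mult Theta_reduced carrier_free_group)

lemma inverse_P:
  assumes "w \<in> carrier P"
  shows "\<exists>v\<in>carrier P. v \<otimes>\<^bsub>P\<^esub> w = \<one>\<^bsub>P\<^esub>"
proof -
  define si where "si s = map_sum (m_inv H) word_inv s" for s :: "'h + 'b letter list"
  define v where "v = rev (map si w)"
  have si: "si s \<in> fp_factor H (free_group S)" "syl (si s) = word_inv (syl s)"
    if s: "s \<in> fp_factor H (free_group S)" for s
  proof -
    have "si s \<in> fp_factor H (free_group S) \<and> syl (si s) = word_inv (syl s)"
    proof (cases s)
      case (Inl a)
      then have a: "a \<in> carrier H" "a \<noteq> \<one>\<^bsub>H\<^esub>"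
        using s by auto
      have "bw (inv\<^bsub>H\<^esub> a) = inv\<^bsub>free_group B\<^esub> (bw a)"
        using bw_iso a(1) by (intro group_hom.hom_inv group_hom.intro group_hom_axioms.intro
            group_free_group group_H) (auto simp: iso_def)
      moreover have "inv\<^bsub>H\<^esub> a \<noteq> \<one>\<^bsub>H\<^esub>"
        using a group_H by (simp add: group.inv_eq_1_iff)
      ultimately show ?thesis
        using a bw_carrier[OF a(1)] group.inv_closed[OF group_H a(1)]
        by (simp add: Inl si_def inv_free_group word_inv_map_letters)
    next
      case (Inr u)
      then show ?thesis
        using s by (simp add: si_def word_inv_map_letters word_inv_in_free_group)
    qed
    then show "si s \<in> fp_factor H (free_group S)" "syl (si s) = word_inv (syl s)"
      by auto
  qed
  have isl_si: "isl (si s) = isl s" for s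
    by (cases s) (auto simp: si_def)
  have "set v \<subseteq> fp_factor H (free_group S)"
    using assms si by (auto simp: v_def carrier_P)
  moreover have "successively (\<lambda>s t. isl s \<noteq> isl t) v"
    using assms unfolding v_def successively_rev successively_map isl_si
    by (auto simp: carrier_P elim: successively_mono)
  ultimately have v: "v \<in> carrier P"
    by (simp add: carrier_P)
  have "\<Theta> v = word_inv (\<Theta> w)"
    using assms unfolding v_def
  proof (induction w)
    case (Cons s w)
    have app: "\<Theta> (a @ b) = \<Theta> a @ \<Theta> b" for a b
      by (simp add: fp_word_def)
    have "s \<in> fp_factor H (free_group S)"
      using Cons.prems by (auto simp: carrier_P)
    then show ?case
      using Cons.IH[OF carrier_P_Cons[OF Cons.prems]] si by (simp add: app)
  qed simp
  then have "\<Theta> (v \<otimes>\<^bsub>P\<^esub> w) = \<Theta> []"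
    by (simp add: Theta_mult[OF v assms])
  then have "v \<otimes>\<^bsub>P\<^esub> w = []"
    using Theta_inj_on mult_P_closed[OF v assms] by (auto simp: inj_on_def carrier_P)
  with v show ?thesis
    by (auto simp: one_P)
qed

text \<open>
  Associativity is inherited from the free group, because \<open>\<Theta>\<close> is injective and multiplicative.
\<close>

lemma group_P: "group P"
proof (rule groupI)
  show one: "\<one>\<^bsub>P\<^esub> \<in> carrier P"
    by (simp add: one_P carrier_P)
  fix u v w assume u: "u \<in> carrier P" and v: "v \<in> carrier P" and w: "w \<in> carrier P"
  have "\<Theta> (u \<otimes>\<^bsub>P\<^esub> v \<otimes>\<^bsub>P\<^esub> w) = \<Theta> (u \<otimes>\<^bsub>P\<^esub> (v \<otimes>\<^bsub>P\<^esub> w))"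
    by (simp add: Theta_mult mult_P_closed u v w)
  then show "u \<otimes>\<^bsub>P\<^esub> v \<otimes>\<^bsub>P\<^esub> w = u \<otimes>\<^bsub>P\<^esub> (v \<otimes>\<^bsub>P\<^esub> w)"
    using Theta_inj_on by (auto simp: inj_on_def mult_P_closed u v w)
  show "\<one>\<^bsub>P\<^esub> \<otimes>\<^bsub>P\<^esub> u = u"
    by (simp add: one_P mult_P)
qed (auto simp: mult_P_closed inverse_P)

lemma fp_inr_hom: "fp_inr (free_group S) \<in> hom (free_group S) P"
proof (rule homI)
  show "fp_inr (free_group S) u \<in> carrier P" if "u \<in> carrier (free_group S)" for u
    using that by (auto simp: fp_inr_def carrier_P)
qed (auto simp: fp_inr_def mult_P reduce_reduced carrier_free_group)

lemma Theta_fp_inr: "\<Theta> (fp_inr (free_group S) u) = map (map_prod Inr id) u"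
  by (simp add: fp_inr_def)

end

section \<open>Zieschang elements as ranked words\<close>

lemma finite_acyclic_rank:
  assumes "finite R" "acyclic R"
  shows "\<exists>f :: 'a \<Rightarrow> real. \<forall>(a, b) \<in> R. f a < f b"
proof -
  define f where "f u = real (card {w. (w, u) \<in> R\<^sup>+})" for u
  have "f a < f b" if ab: "(a, b) \<in> R" for a b
  proof -
    have "finite {w. (w, b) \<in> R\<^sup>+}"
      by (rule finite_subset[OF _ finite_Domain[OF assms(1)]])
        (auto dest: tranclD)
    moreover have "{w. (w, a) \<in> R\<^sup>+} \<subset> {w. (w, b) \<in> R\<^sup>+}"
      using ab assms(2) by (auto simp: acyclic_def intro: trancl_into_trancl)
    ultimately show ?thesis
      unfolding f_def by (simp add: psubset_card_mono)
  qed
  then show ?thesis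
    by blast
qed

text \<open>
  A shortest closed directed walk repeats no vertex, and no edge as distinct edges have distinct
  tails; so it is a cycle. Hence the directed edges of a forest generate a strict order, and the
  number of predecessors is strictly increasing along every edge.
\<close>

lemma forest_imp_rank:
  fixes tl hd :: "'e \<Rightarrow> 'v"
  assumes fin: "finite E" and inj: "inj_on tl E"
    and ends: "\<And>e. e \<in> E \<Longrightarrow> ends e = {tl e, hd e}"
    and forest: "is_forest E ends"
  shows "\<exists>f :: 'v \<Rightarrow> real. \<forall>e \<in> E. f (tl e) < f (hd e)"
proof -
  define R where "R = (\<lambda>e. (tl e, hd e)) ` E"
  have "acyclic R"
  proof (rule ccontr)
    define closed where "closed n \<longleftrightarrow> n > 0 \<and>
      (\<exists>F. F 0 = F n \<and> (\<forall>i<n. (F i, F (Suc i)) \<in> R))" for n :: nat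
    assume "\<not> acyclic R"
    then obtain u where "(u, u) \<in> R\<^sup>+"
      by (auto simp: acyclic_def)
    then obtain m where "m > 0" "(u, u) \<in> R ^^ m"
      by (auto simp: trancl_power)
    then have "closed m"
      unfolding closed_def relpow_fun_conv by metis
    define n where "n = (LEAST n. closed n)"
    have "closed n"
      unfolding n_def using \<open>closed m\<close> by (rule LeastI)
    have minimal: "\<not> closed k" if "k < n" for k
      using not_less_Least that unfolding n_def by blast
    from \<open>closed n\<close> obtain F where n: "n > 0" and F: "F 0 = F n"
      "\<And>i. i < n \<Longrightarrow> (F i, F (Suc i)) \<in> R"
      by (auto simp: closed_def)
    have "\<exists>e \<in> E. tl e = F i \<and> hd e = F (Suc i)" if "i < n" for i
      using F(2)[OF that] by (auto simp: R_def)
    then obtain e where e: "\<And>i. i < n \<Longrightarrow> e i \<in> E \<and> tl (e i) = F i \<and> hd (e i) = F (Suc i)"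
      by metis
    have F_neq: "F i \<noteq> F j" if "i < j" "j < n" for i j
    proof
      assume "F i = F j"
      then have "closed (j - i)"
        unfolding closed_def using that F(2)
        by (intro conjI exI[of _ "\<lambda>k. F (i + k)"]) auto
      with minimal that show False
        by auto
    qed
    have F_inj: "inj_on F {0..<n}"
      using F_neq by (intro inj_onI) (metis atLeastLessThan_iff linorder_cases)
    then have e_inj: "inj_on e {0..<n}"
      using e by (intro inj_onI) (metis atLeastLessThan_iff inj_onD)
    have "is_cycle E ends (map F [0..<n]) (map e [0..<n])"
      unfolding is_cycle_def
    proof (intro conjI allI impI)
      fix i assume "i < length (map F [0..<n])"
      then have i: "i < n"
        by simp
      have "F (Suc i) = F (Suc i mod n)"
        using i F(1) by (cases "Suc i = n") auto
      with e[OF i] ends i n show "ends (map e [0..<n] ! i) =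
          {map F [0..<n] ! i, map F [0..<n] ! (Suc i mod length (map F [0..<n]))}"
        by simp
    qed (use n e F_inj e_inj in \<open>auto simp: distinct_map\<close>)
    with forest show False
      by (auto simp: is_forest_def)
  qed
  moreover have "finite R"
    using fin by (simp add: R_def)
  ultimately obtain f :: "'v \<Rightarrow> real" where "\<forall>(a, b) \<in> R. f a < f b"
    using finite_acyclic_rank by blast
  then show ?thesis
    by (auto simp: R_def)
qed

text \<open>
  A vertex of greatest rank on a cycle is the head of both of its cycle edges. As heads are distinct,
  the two edges coincide, so the cycle is a loop, which no strictly increasing rank admits.
\<close>

lemma rank_imp_forest:
  fixes tl hd :: "'e \<Rightarrow> 'v" and f :: "'v \<Rightarrow> real"
  assumes inj: "inj_on hd E"
    and ends: "\<And>e. e \<in> E \<Longrightarrow> ends e = {tl e, hd e}"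
    and rank: "\<And>e. e \<in> E \<Longrightarrow> f (tl e) < f (hd e)"
  shows "is_forest E ends"
  unfolding is_forest_def
proof clarify
  fix vs es assume cycle: "is_cycle E ends vs es"
  define n where "n = length vs"
  have n: "n > 0" "length es = n" "distinct es"
    and es: "\<And>i. i < n \<Longrightarrow> es ! i \<in> E"
    and inc: "\<And>i. i < n \<Longrightarrow> ends (es ! i) = {vs ! i, vs ! (Suc i mod n)}"
    using cycle by (auto simp: is_cycle_def n_def)
  have "finite {..<n}" "{..<n} \<noteq> {}"
    using n by auto
  then obtain i where "i \<in> {..<n}" and max: "\<forall>j\<in>{..<n}. f (vs ! j) \<le> f (vs ! i)"
    using Max_in[of "(\<lambda>i. f (vs ! i)) ` {..<n}"] Max_ge[of "(\<lambda>i. f (vs ! i)) ` {..<n}"]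
    by fastforce
  then have i: "i < n" and max: "\<And>j. j < n \<Longrightarrow> f (vs ! j) \<le> f (vs ! i)"
    by auto
  have head: "hd (es ! k) = vs ! i" if "k < n" "k = i \<or> Suc k mod n = i" for k
  proof -
    have "{tl (es ! k), hd (es ! k)} = {vs ! k, vs ! (Suc k mod n)}"
      using inc[OF that(1)] ends[OF es[OF that(1)]] by simp
    moreover have "f (tl (es ! k)) < f (hd (es ! k))"
      using rank es that by blast
    moreover have "f (vs ! k) \<le> f (vs ! i)" "f (vs ! (Suc k mod n)) \<le> f (vs ! i)"
      using max that n by auto
    ultimately show ?thesis
      using that(2) by (auto simp: doubleton_eq_iff)
  qed
  \<comment> \<open>The cyclic predecessor of i.\<close>
  define k where "k = (if i = 0 then n - 1 else i - 1)"
  have k: "k < n" "Suc k mod n = i"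
    using i n by (auto simp: k_def)
  have "hd (es ! k) = hd (es ! i)"
    using head[of k] head[of i] k i by simp
  then have "es ! k = es ! i"
    using inj es k i by (auto dest: inj_onD)
  then have "k = i"
    using n k i by (simp add: nth_eq_iff_index_eq)
  then have "ends (es ! i) = {vs ! i}"
    using inc[OF i] k by simp
  then have "tl (es ! i) = hd (es ! i)"
    using ends[OF es[OF i]] by auto
  with rank[OF es[OF i]] show False
    by simp
qed

text \<open>
  Direct the edges of the graph of \<open>V\<close> from \<open>v\<^sub>k\<close> to the inverse of \<open>v\<^sub>k\<^sub>+\<^sub>1\<close>, and from the inverse of
  \<open>t\<^sub>j\<close> to \<open>t\<^sub>j\<close>. A ranking certifies that the graph is a forest. Unlike the absence of cycles, it is a
  local condition on neighbours in \<open>V\<close>, and real values leave room to insert a vertex into an edge.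
\<close>

definition ranking :: "nat \<Rightarrow> gen letter list \<Rightarrow> (gen letter \<Rightarrow> real) \<Rightarrow> bool" where
  "ranking p V f \<longleftrightarrow> successively (\<lambda>l m. f l < f (inv_letter m)) V \<and>
     (\<forall>j \<in> {1..p}. f (Tgen j, False) < f (Tgen j, True))"

definition ranked_word :: "nat \<Rightarrow> nat \<Rightarrow> gen letter list \<Rightarrow> bool" where
  "ranked_word g p V \<longleftrightarrow>
     distinct V \<and> set V = t_letters p \<union> x_letters g \<and> (\<exists>f. ranking p V f)"

lemma ranking_reduced: "ranking p V f \<Longrightarrow> reduced V"
  unfolding ranking_def reduced_def by (elim conjE successively_mono) auto

lemma ranked_word_reduced: "ranked_word g p V \<Longrightarrow> reduced V"
  by (auto simp: ranked_word_def ranking_reduced)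

lemma card_v_letters: "card (t_letters p \<union> x_letters g) = 4 * g + p"
proof -
  have "card (t_letters p) = p"
    by (simp add: t_letters_def card_cartesian_product card_image inj_on_def)
  moreover have "card (x_letters g) = 4 * g"
    unfolding x_letters_def
    by (subst card_cartesian_product, subst card_Un_disjoint) (auto simp: card_image inj_on_def)
  ultimately show "card (t_letters p \<union> x_letters g) = 4 * g + p"
    by (subst card_Un_disjoint) (auto simp: t_letters_def x_letters_def)
qed

lemma length_ranked_word: "ranked_word g p V \<Longrightarrow> length V = 4 * g + p"
  using distinct_card[of V] card_v_letters by (auto simp: ranked_word_def)

fun edge_tail :: "(nat \<Rightarrow> gen letter) \<Rightarrow> nat + nat \<Rightarrow> gen letter" where
  "edge_tail v (Inl j) = (Tgen j, False)"
| "edge_tail v (Inr k) = v k"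

fun edge_head :: "(nat \<Rightarrow> gen letter) \<Rightarrow> nat + nat \<Rightarrow> gen letter" where
  "edge_head v (Inl j) = (Tgen j, True)"
| "edge_head v (Inr k) = inv_letter (v (k + 1))"

lemma v_letter_cases:
  "l \<in> t_letters p \<union> x_letters g \<longleftrightarrow>
    (\<exists>j \<in> {1..p}. l = (Tgen j, True)) \<or> fst l \<in> Xgen ` {1..g} \<union> Ygen ` {1..g}"
  by (cases l) (auto simp: t_letters_def x_letters_def)

lemma edge_inj:
  assumes "bij_betw v {1..4 * g + p} (t_letters p \<union> x_letters g)"
  shows "inj_on (edge_tail v) (zgraph_edges g p)" "inj_on (edge_head v) (zgraph_edges g p)"
proof -
  have inj: "inj_on v {1..4 * g + p}"
    using assms by (simp add: bij_betw_def)
  have neq: "v k \<noteq> (Tgen j, False)" "inv_letter (v k) \<noteq> (Tgen j, True)"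
    if "k \<in> {1..4 * g + p}" for k j
    using bij_betwE[OF assms] that v_letter_cases[of "v k" p g] by (auto simp: inv_letter_def)
  have bound: "k \<in> {1..4 * g + p}" "Suc k \<in> {1..4 * g + p}"
    if "Inr k \<in> zgraph_edges g p" for k
    using that by (auto simp: zgraph_edges_def)
  show "inj_on (edge_tail v) (zgraph_edges g p)"
  proof (rule inj_onI)
    fix d e assume d: "d \<in> zgraph_edges g p" and e: "e \<in> zgraph_edges g p"
      and eq: "edge_tail v d = edge_tail v e"
    show "d = e"
    proof (cases d)
      case (Inl i)
      show ?thesis
        using eq neq(1)[OF bound(1)] e by (cases e) (auto simp: Inl dest!: sym[of "(Tgen i, _)"])
    next
      case (Inr k)
      show ?thesis
      proof (cases e)
        case (Inl i)
        then show ?thesis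
          using eq neq(1)[OF bound(1)] d by (simp add: Inr)
      next
        case (Inr m)
        have "k = m"
          by (rule inj_onD[OF inj _ bound(1) bound(1)])
            (use eq d e \<open>d = Inr k\<close> Inr in auto)
        then show ?thesis
          using \<open>d = Inr k\<close> Inr by simp
      qed
    qed
  qed
  show "inj_on (edge_head v) (zgraph_edges g p)"
  proof (rule inj_onI)
    fix d e assume d: "d \<in> zgraph_edges g p" and e: "e \<in> zgraph_edges g p"
      and eq: "edge_head v d = edge_head v e"
    show "d = e"
    proof (cases d)
      case (Inl i)
      show ?thesis
        using eq neq(2)[OF bound(2)] e by (cases e) (auto simp: Inl dest!: sym[of "(Tgen i, _)"])
    next
      case (Inr k)
      show ?thesis
      proof (cases e)
        case (Inl i)
        then show ?thesis
          using eq neq(2)[OF bound(2)] d by (simp add: Inr)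
      next
        case (Inr m)
        have "Suc k = Suc m"
          by (rule inj_onD[OF inj _ bound(2) bound(2)])
            (use eq d e \<open>d = Inr k\<close> Inr in auto)
        then show ?thesis
          using \<open>d = Inr k\<close> Inr by simp
      qed
    qed
  qed
qed

lemma zgraph_ends_eq: "zgraph_ends v e = {edge_tail v e, edge_head v e}"
  by (cases e) auto

lemma zieschang_enum_imp_ranked_word:
  assumes "zieschang_enum g p v V"
  shows "ranked_word g p V" and "V = map v [1..<4 * g + p + 1]"
proof -
  define L where "L = map v [1..<4 * g + p + 1]"
  have bij: "bij_betw v {1..4 * g + p} (t_letters p \<union> x_letters g)" and V: "V = reduce L"
    and forest: "is_forest (zgraph_edges g p) (zgraph_ends v)"
    using assms by (auto simp: zieschang_enum_def L_def)
  have range: "set [1..<4 * g + p + 1] = {1..4 * g + p}"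
    by auto
  obtain f :: "gen letter \<Rightarrow> real" where
    f: "\<And>e. e \<in> zgraph_edges g p \<Longrightarrow> f (edge_tail v e) < f (edge_head v e)"
    using forest_imp_rank[OF _ edge_inj(1)[OF bij] zgraph_ends_eq forest]
    by (auto simp: zgraph_edges_def)
  have "f (v k) < f (inv_letter (v (Suc k)))" if "1 \<le> k" "k < 4 * g + p" for k
    using f[of "Inr k"] that by (auto simp: zgraph_edges_def InrI)
  then have "successively (\<lambda>l m. f l < f (inv_letter m)) L"
    by (auto simp: L_def successively_conv_nth simp del: upt_Suc)
  moreover have "\<forall>j \<in> {1..p}. f (Tgen j, False) < f (Tgen j, True)"
  proof
    fix j assume "j \<in> {1..p}"
    then show "f (Tgen j, False) < f (Tgen j, True)"
      using f[of "Inl j"] by (auto simp: zgraph_edges_def InlI)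
  qed
  ultimately have rank: "ranking p L f"
    by (simp add: ranking_def)
  with V have VL: "V = L"
    by (simp add: ranking_reduced reduce_reduced)
  then show "V = map v [1..<4 * g + p + 1]"
    by (simp add: L_def)
  have "distinct L" "set L = t_letters p \<union> x_letters g"
    using bij unfolding L_def distinct_map set_map range bij_betw_def by simp_all
  with rank show "ranked_word g p V"
    by (auto simp: VL ranked_word_def)
qed

lemma ranked_word_imp_zieschang_enum:
  assumes V: "ranked_word g p V"
  shows "zieschang_enum g p (\<lambda>k. V ! (k - 1)) V"
proof -
  \<comment> \<open>Zieschang elements are enumerated from 1, lists from 0.\<close>
  define v where "v k = V ! (k - 1)" for k :: nat
  have len: "length V = 4 * g + p"
    using V by (rule length_ranked_word)
  obtain f where dist: "distinct V" and set_V: "set V = t_letters p \<union> x_letters g"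
    and f: "ranking p V f"
    using V by (auto simp: ranked_word_def)
  have "bij_betw ((!) V) {..<4 * g + p} (set V)"
    by (intro bij_betw_nth dist) (simp_all add: len)
  moreover have "bij_betw (\<lambda>k. k - 1) {1..4 * g + p} {..<4 * g + p}"
    by (rule bij_betw_byWitness[of _ Suc]) auto
  ultimately have "bij_betw ((!) V \<circ> (\<lambda>k. k - 1)) {1..4 * g + p} (set V)"
    by (rule bij_betw_trans[rotated])
  then have bij: "bij_betw v {1..4 * g + p} (t_letters p \<union> x_letters g)"
    unfolding set_V v_def[abs_def] o_def .
  have "map v [1..<4 * g + p + 1] = V"
    by (rule nth_equalityI) (auto simp: v_def len simp del: upt_Suc)
  moreover have "is_forest (zgraph_edges g p) (zgraph_ends v)"
  proof (rule rank_imp_forest[OF edge_inj(2)[OF bij] zgraph_ends_eq])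
    fix e assume e: "e \<in> zgraph_edges g p"
    show "f (edge_tail v e) < f (edge_head v e)"
    proof (cases e)
      case (Inl j)
      then show ?thesis
        using e f by (auto simp: ranking_def zgraph_edges_def)
    next
      case (Inr k)
      then have k: "1 \<le> k" "k < 4 * g + p"
        using e by (auto simp: zgraph_edges_def)
      then show ?thesis
        using f successively_nth[of "\<lambda>l m. f l < f (inv_letter m)" V "k - 1"] len
        by (simp add: Inr ranking_def v_def)
    qed
  qed
  ultimately show ?thesis
    using bij ranked_word_reduced[OF V]
    unfolding zieschang_enum_def v_def[abs_def] by (simp only: reduce_reduced simp_thms)
qed

lemma zieschang_elements_iff: "V \<in> zieschang_elements g p \<longleftrightarrow> ranked_word g p V"
  using zieschang_enum_imp_ranked_word(1) ranked_word_imp_zieschang_enum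
  unfolding zieschang_elements_def by blast

text \<open>
  Reversing \<open>V\<close> and replacing each vertex by its inverse letter reverses all edges of the graph. This
  symmetry exchanges the Nielsen moves of left and of right type.
\<close>

lemma ranked_word_rev: "ranked_word g p V \<Longrightarrow> ranked_word g p (rev V)"
proof -
  assume V: "ranked_word g p V"
  then obtain f where f: "ranking p V f"
    by (auto simp: ranked_word_def)
  then have "ranking p (rev V) (\<lambda>l. - f (inv_letter l))"
    by (auto simp: ranking_def inv_letter_def elim: successively_mono)
  with V show ?thesis
    by (auto simp: ranked_word_def)
qed

section \<open>Nielsen moves on ranked words\<close>

definition is_t :: "gen letter \<Rightarrow> bool" where
  "is_t l \<longleftrightarrow> fst l \<in> range Tgen"

lemma is_t_inv_letter [simp]: "is_t (inv_letter l) \<longleftrightarrow> is_t l"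
  by (simp add: is_t_def)

text \<open>
  The common form of the Nielsen moves, as the values of an automorphism on letters: an \<open>x\<close>-letter \<open>u\<close>
  is multiplied on the right by the inverse of \<open>w\<close>, a letter \<open>t\<^sub>j\<close> or its inverse is conjugated by \<open>w\<close>. The inverse
  automorphism arises by inverting \<open>w\<close>.
\<close>

definition twist :: "gen letter \<Rightarrow> gen letter \<Rightarrow> gen letter \<Rightarrow> gen letter list" where
  "twist u w l =
    (if l = u then (if is_t u then [w, u, inv_letter w] else [u, inv_letter w])
     else if l = inv_letter u then (if is_t u then [w, inv_letter u, inv_letter w] else [w, inv_letter u])
     else [l])"

text \<open>
  The end points of an edge of the graph that joins neighbours in \<open>V\<close>. With this notion the four kinds of
  moves become one: a right move at \<open>v\<^sub>k\<close> is a twist of \<open>v\<^sub>k\<close>, and a left move at \<open>v\<^sub>k\<close> is a twist of the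
  inverse of \<open>v\<^sub>k\<close>.
\<close>

definition corner :: "gen letter list \<Rightarrow> gen letter \<Rightarrow> gen letter \<Rightarrow> bool" where
  "corner V u w \<longleftrightarrow> (\<exists>A B. V = A @ u # inv_letter w # B) \<or> (\<exists>A B. V = A @ w # inv_letter u # B)"

lemma corner_sym: "corner V u w \<Longrightarrow> corner V w u"
  by (auto simp: corner_def)

lemma v_letter_inv:
  assumes "l \<in> t_letters p \<union> x_letters g"
  shows "inv_letter l \<in> t_letters p \<union> x_letters g \<longleftrightarrow> \<not> is_t l"
  using assms by (cases l) (auto simp: t_letters_def x_letters_def is_t_def inv_letter_def)

lemma ranking_cong:
  assumes "successively (\<lambda>l m. f l < f (inv_letter m)) A"
    and "\<And>l. l \<in> set A \<Longrightarrow> f' l = f l \<and> f' (inv_letter l) = f (inv_letter l)"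
  shows "successively (\<lambda>l m. f' l < f' (inv_letter m)) A"
  using assms by (auto cong: successively_cong)

lemma real_between:
  fixes a :: real
  assumes "B \<noteq> [] \<Longrightarrow> a < F (hd B)"
  shows "\<exists>y>a. B \<noteq> [] \<longrightarrow> y < F (hd B)"
  using assms dense[of a "F (hd B)"] by (cases "B = []") (auto intro: gt_ex)

lemma concat_map_twist:
  "u \<notin> set A \<Longrightarrow> inv_letter u \<notin> set A \<Longrightarrow> concat (map (twist u b) A) = A"
  by (induction A) (auto simp: twist_def)

text \<open>
  The twist deletes \<open>b\<close> behind \<open>u\<close> and inserts it in front of the inverse of \<open>u\<close>; for a \<open>t\<close>-letter it
  exchanges \<open>u\<close> and \<open>b\<close>. In the graph, the vertex \<open>u\<close> (for a \<open>t\<close>-letter also its inverse) is taken off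
  the path that leads to the inverse of \<open>b\<close> and put directly behind \<open>b\<close>. So it suffices to give \<open>u\<close>
  (and its inverse) a new rank between \<open>b\<close> and the successor of \<open>b\<close>.
\<close>

lemma ranked_word_twist_right:
  assumes V: "ranked_word g p V" and split: "V = A @ u # b # B"
  shows "ranked_word g p (letter_hom (twist u b) V)"
proof -
  obtain f where dist: "distinct V" and set_V: "set V = t_letters p \<union> x_letters g"
    and f: "ranking p V f"
    using V by (auto simp: ranked_word_def)
  have fA: "successively (\<lambda>l m. f l < f (inv_letter m)) A"
    and fB: "successively (\<lambda>l m. f l < f (inv_letter m)) B"
    and fAu: "A \<noteq> [] \<Longrightarrow> f (last A) < f (inv_letter u)"
    and fub: "f u < f (inv_letter b)"
    and fbB: "B \<noteq> [] \<Longrightarrow> f b < f (inv_letter (hd B))"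
    and ft: "\<And>j. j \<in> {1..p} \<Longrightarrow> f (Tgen j, False) < f (Tgen j, True)"
    using f by (auto simp: ranking_def split successively_append_iff successively_Cons)
  have notin: "u \<notin> set A" "u \<notin> set B" "b \<noteq> u" "b \<notin> set A" "b \<notin> set B"
    using dist by (auto simp: split)
  have bu: "b \<noteq> inv_letter u"
    using fub by auto
  obtain y where y: "f b < y" "B \<noteq> [] \<Longrightarrow> y < f (inv_letter (hd B))"
    using real_between[of B "f b" "\<lambda>l. f (inv_letter l)"] fbB by blast
  have u_in: "u \<in> t_letters p \<union> x_letters g"
    using set_V by (auto simp: split)
  show ?thesis
  proof (cases "is_t u")
    case True
    have "inv_letter u \<notin> set V"
      using v_letter_inv[OF u_in] True by (simp add: set_V)
    then have iu: "inv_letter u \<notin> set A" "inv_letter u \<notin> set B"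
      by (auto simp: split)
    obtain j where j: "j \<in> {1..p}" "u = (Tgen j, True)"
      using u_in True by (auto simp: t_letters_def x_letters_def is_t_def)
    obtain x where x: "f b < x" "x < y"
      using dense y by blast
    define f' where "f' = f(inv_letter u := x, u := y)"
    have f': "f' l = f l \<and> f' (inv_letter l) = f (inv_letter l)"
      if "l \<noteq> u" "l \<noteq> inv_letter u" for l
      using that by (auto simp: f'_def)
    have b': "f' b = f b" "f' (inv_letter b) = f (inv_letter b)"
      using f' notin bu by auto
    have u': "f' u = y" "f' (inv_letter u) = x"
      by (auto simp: f'_def)
    have fu: "f (inv_letter u) < f u"
      using ft[OF j(1)] by (simp add: j inv_letter_def)
    have A': "successively (\<lambda>l m. f' l < f' (inv_letter m)) A"
      using fA by (rule ranking_cong) (metis f' notin(1) iu(1))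
    have B': "successively (\<lambda>l m. f' l < f' (inv_letter m)) B"
      using fB by (rule ranking_cong) (metis f' notin(2) iu(2))
    have lastA: "f' (last A) = f (last A)" if "A \<noteq> []"
      using that f' notin(1) iu(1) by (metis last_in_set)
    have hdB: "f' (inv_letter (hd B)) = f (inv_letter (hd B))" if "B \<noteq> []"
      using that f' notin(2) iu(2) by (metis hd_in_set)
    have "ranking p (A @ b # u # B) f'"
      unfolding ranking_def
    proof (intro conjI ballI)
      show "successively (\<lambda>l m. f' l < f' (inv_letter m)) (A @ b # u # B)"
        using A' B' lastA hdB fAu fub fu y x
        by (cases "A = []"; cases "B = []") (simp_all add: successively_append_iff successively_Cons b' u')
      show "f' (Tgen k, False) < f' (Tgen k, True)" if "k \<in> {1..p}" for k
        using ft[OF that] x by (auto simp: f'_def j inv_letter_def)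
    qed
    then have W: "ranked_word g p (A @ b # u # B)"
      using dist set_V by (auto simp: ranked_word_def split)
    have "letter_hom (twist u b) V = reduce (A @ b # u # inv_letter b # b # B)"
      using notin bu iu True
      by (simp add: letter_hom_def split concat_map_twist) (simp add: twist_def)
    also have "\<dots> = reduce (A @ b # u # B)"
      using reduce_cong[OF refl, of "inv_letter b # b # B" B "A @ [b, u]"] by simp
    also have "\<dots> = A @ b # u # B"
      using W by (simp add: reduce_reduced ranked_word_reduced)
    finally show ?thesis
      using W by simp
  next
    case False
    have "inv_letter u \<in> set V"
      using v_letter_inv[OF u_in] False by (simp add: set_V)
    then have iu: "inv_letter u \<in> set A \<or> inv_letter u \<in> set B"
      using bu by (auto simp: split)
    define f' where "f' = f(u := y)"
    have f': "f' l = f l \<and> f' (inv_letter l) = f (inv_letter l)"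
      if "l \<noteq> u" "l \<noteq> inv_letter u" for l
      using that by (auto simp: f'_def)
    have b': "f' b = f b" "f' (inv_letter b) = f (inv_letter b)"
      using f' notin bu by auto
    have u': "f' u = y" "f' (inv_letter u) = f (inv_letter u)"
      by (auto simp: f'_def)
    have t': "f' (Tgen k, False) < f' (Tgen k, True)" if "k \<in> {1..p}" for k
      using ft[OF that] False by (auto simp: f'_def is_t_def)
    have seq: "successively (\<lambda>l m. f' l < f' (inv_letter m)) D"
      "D \<noteq> [] \<Longrightarrow> f' (last D) = f (last D)"
      "D \<noteq> [] \<Longrightarrow> f' (inv_letter (hd D)) = f (inv_letter (hd D))"
      if "successively (\<lambda>l m. f l < f (inv_letter m)) D" "u \<notin> set D" "inv_letter u \<notin> set D" for D
    proof -
      show "successively (\<lambda>l m. f' l < f' (inv_letter m)) D"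
        using that(1) by (rule ranking_cong) (metis f' that(2,3))
      show "D \<noteq> [] \<Longrightarrow> f' (last D) = f (last D)"
        using f' that(2,3) by (metis last_in_set)
      show "D \<noteq> [] \<Longrightarrow> f' (inv_letter (hd D)) = f (inv_letter (hd D))"
        using f' that(2,3) by (metis hd_in_set)
    qed
    show ?thesis
    proof (cases "inv_letter u \<in> set A")
      case True
      then obtain A1 A2 where A: "A = A1 @ inv_letter u # A2"
        by (auto dest: split_list)
      have iu': "inv_letter u \<notin> set A1" "inv_letter u \<notin> set A2" "inv_letter u \<notin> set B"
        using dist by (auto simp: split A)
      have f12: "successively (\<lambda>l m. f l < f (inv_letter m)) A1"
        "successively (\<lambda>l m. f l < f (inv_letter m)) A2"
        "A1 \<noteq> [] \<Longrightarrow> f (last A1) < f u"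
        "A2 \<noteq> [] \<Longrightarrow> f (inv_letter u) < f (inv_letter (hd A2))"
        "A2 \<noteq> [] \<Longrightarrow> f (last A2) < f (inv_letter u)"
        "A2 = [] \<Longrightarrow> f (inv_letter u) < f (inv_letter u)"
        using fA fAu by (auto simp: A successively_append_iff successively_Cons)
      have "ranking p (A1 @ b # inv_letter u # A2 @ u # B) f'"
        unfolding ranking_def
        using seq[OF f12(1)] seq[OF f12(2)] seq[OF fB] iu' notin f12 t' y fub
        by (cases "A1 = []"; cases "A2 = []"; cases "B = []")
          (simp_all add: A successively_append_iff successively_Cons b' u')
      then have W: "ranked_word g p (A1 @ b # inv_letter u # A2 @ u # B)"
        using dist set_V by (auto simp: ranked_word_def split A)
      have "letter_hom (twist u b) V =
          reduce (A1 @ b # inv_letter u # A2 @ u # inv_letter b # b # B)"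
        using notin bu iu' False
        by (simp add: letter_hom_def split A concat_map_twist) (simp add: twist_def)
      also have "\<dots> = reduce (A1 @ b # inv_letter u # A2 @ u # B)"
        using reduce_cong[OF refl, of "inv_letter b # b # B" B "A1 @ b # inv_letter u # A2 @ [u]"]
        by simp
      also have "\<dots> = A1 @ b # inv_letter u # A2 @ u # B"
        using W by (simp add: reduce_reduced ranked_word_reduced)
      finally show ?thesis
        using W by simp
    next
      case iuA: False
      then obtain B1 B2 where B: "B = B1 @ inv_letter u # B2"
        using iu by (auto dest: split_list)
      have iu': "inv_letter u \<notin> set A" "inv_letter u \<notin> set B1" "inv_letter u \<notin> set B2"
        using dist iuA by (auto simp: split B)
      have f12: "successively (\<lambda>l m. f l < f (inv_letter m)) B1"
        "successively (\<lambda>l m. f l < f (inv_letter m)) B2"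
        "B1 \<noteq> [] \<Longrightarrow> f (last B1) < f u"
        "B2 \<noteq> [] \<Longrightarrow> f (inv_letter u) < f (inv_letter (hd B2))"
        using fB by (auto simp: B successively_append_iff successively_Cons)
      have W: "ranked_word g p (A @ u # B1 @ b # inv_letter u # B2)"
      proof (cases "B1 = []")
        case True
        then show ?thesis
          using V by (simp add: split B)
      next
        case False
        then have "ranking p (A @ u # B1 @ b # inv_letter u # B2) f'"
          unfolding ranking_def
          using seq[OF f12(1)] seq[OF f12(2)] seq[OF fA] iu' notin f12 t' y fub fAu
          by (cases "A = []"; cases "B2 = []")
            (simp_all add: B successively_append_iff successively_Cons b' u')
        then show ?thesis
          using dist set_V by (auto simp: ranked_word_def split B)
      qed
      have "letter_hom (twist u b) V =
          reduce (A @ u # inv_letter b # b # B1 @ b # inv_letter u # B2)"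
        using notin bu iu' False
        by (simp add: letter_hom_def split B concat_map_twist) (simp add: twist_def)
      also have "\<dots> = reduce (A @ u # B1 @ b # inv_letter u # B2)"
        using reduce_cong[OF refl, of "inv_letter b # b # B1 @ b # inv_letter u # B2"
            "B1 @ b # inv_letter u # B2" "A @ [u]"]
        by simp
      also have "\<dots> = A @ u # B1 @ b # inv_letter u # B2"
        using W by (simp add: reduce_reduced ranked_word_reduced)
      finally show ?thesis
        using W by simp
    qed
  qed
qed

text \<open>
  Left moves are right moves on the reversed word.
\<close>

lemma ranked_word_twist:
  assumes V: "ranked_word g p V" and corner: "corner V u w"
  shows "ranked_word g p (letter_hom (twist u (inv_letter w)) V)"
proof -
  consider A B where "V = A @ u # inv_letter w # B" | A B where "V = A @ w # inv_letter u # B"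
    using corner by (auto simp: corner_def)
  then show ?thesis
  proof cases
    case 1
    then show ?thesis
      using ranked_word_twist_right[OF V] by simp
  next
    case 2
    have "twist u (inv_letter w) l = rev (twist (inv_letter u) w l)" for l
      by (auto simp: twist_def)
    then have "concat (map (twist u (inv_letter w)) V) =
        rev (concat (map (twist (inv_letter u) w) (rev V)))"
      by (simp add: rev_concat rev_map o_def del: rev_map[symmetric] cong: map_cong)
    then have "letter_hom (twist u (inv_letter w)) V = rev (letter_hom (twist (inv_letter u) w) (rev V))"
      by (simp add: letter_hom_def reduce_rev)
    moreover have "rev V = rev B @ inv_letter u # w # rev A"
      using 2 by simp
    ultimately show ?thesis
      using ranked_word_rev[OF ranked_word_twist_right[OF ranked_word_rev[OF V]]] by metis
  qed
qed

lemma corner_letters: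
  assumes V: "ranked_word g p V" and corner: "corner V u w"
  shows "u \<in> letters g p" "w \<in> letters g p" "u \<noteq> w" "u \<noteq> inv_letter w"
    and "is_t u \<Longrightarrow> is_t w \<Longrightarrow> snd u \<noteq> snd w"
proof -
  obtain f where dist: "distinct V" and set_V: "set V = t_letters p \<union> x_letters g"
    and f: "ranking p V f"
    using V by (auto simp: ranked_word_def)
  have in_V: "u \<in> set V \<and> inv_letter w \<in> set V \<or> w \<in> set V \<and> inv_letter u \<in> set V"
    using corner by (auto simp: corner_def)
  have "l \<in> letters g p" if "l \<in> set V \<or> inv_letter l \<in> set V" for l
    using that unfolding set_V
    by (cases l) (auto simp: letters_def gens_def t_letters_def x_letters_def inv_letter_def)
  then show "u \<in> letters g p" "w \<in> letters g p"
    using in_V by blast+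
  show "u \<noteq> w"
    using f corner by (auto simp: ranking_def corner_def successively_append_iff)
  show "u \<noteq> inv_letter w"
    using dist corner by (auto simp: corner_def)
  show "snd u \<noteq> snd w" if "is_t u" "is_t w"
    using that in_V unfolding set_V
    by (auto simp: t_letters_def x_letters_def is_t_def inv_letter_def)
qed

section \<open>Nielsen edges\<close>

lemma group_Fgp: "group (Fgp g p)"
  by (simp add: Fgp_def group_free_group)

lemma letter_in_Fgp: "[l] \<in> carrier (Fgp g p) \<longleftrightarrow> l \<in> letters g p"
  by (cases l) (simp add: Fgp_def letter_in_free_group letters_def)

lemma letters_iff: "l \<in> letters g p \<longleftrightarrow> fst l \<in> gens g p"
  by (cases l) (simp add: letters_def)

lemma inv_letter_letters [simp]: "inv_letter l \<in> letters g p \<longleftrightarrow> l \<in> letters g p"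
  by (simp add: letters_iff)

lemma carrier_Fgp: "w \<in> carrier (Fgp g p) \<longleftrightarrow> reduced w \<and> set w \<subseteq> letters g p"
  by (auto simp: Fgp_def carrier_free_group letters_iff)

lemma letters_eq: "letters g p = t_letters p \<union> inv_letter ` t_letters p \<union> x_letters g"
  by (auto simp: letters_def gens_def t_letters_def x_letters_def inv_letter_def image_iff)

lemma finite_letters: "finite (letters g p)"
  by (simp add: letters_eq t_letters_def x_letters_def)

lemma x_letters_not_t: "x_letters g \<inter> (t_letters p \<union> inv_letter ` t_letters p) = {}"
  by (auto simp: t_letters_def x_letters_def inv_letter_def)

lemma ranked_word_carrier: "ranked_word g p V \<Longrightarrow> V \<in> carrier (Fgp g p)"
  using ranked_word_reduced[of g p V] by (auto simp: carrier_Fgp ranked_word_def letters_eq)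

lemma hom_Fgp_eq:
  assumes "h \<in> hom (Fgp g p) G" "k \<in> hom (Fgp g p) G" "group G"
    and "\<And>l. l \<in> letters g p \<Longrightarrow> h [l] = k [l]" and "w \<in> carrier (Fgp g p)"
  shows "h w = k w"
  using hom_free_group_eq[of h "gens g p" G k w] assms by (simp add: Fgp_def letters_iff)

lemma letter_hom_in_hom_Fgp:
  assumes "\<And>l. l \<in> letters g p \<Longrightarrow> f (inv_letter l) = word_inv (f l)"
    and "\<And>l. l \<in> letters g p \<Longrightarrow> set (f l) \<subseteq> letters g p"
  shows "letter_hom f \<in> hom (Fgp g p) (Fgp g p)"
  unfolding Fgp_def
proof (rule letter_hom_in_hom)
  fix l :: "gen letter" assume "fst l \<in> gens g p"
  then show "reduce (f l @ f (inv_letter l)) = []" "fst ` set (f l) \<subseteq> gens g p"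
    using assms(1)[of l] assms(2)[of l] by (auto simp: letters_iff)
qed

lemma restrict_hom: "h \<in> hom G G \<Longrightarrow> group G \<Longrightarrow> restrict h (carrier G) \<in> hom G G"
  by (auto simp: hom_def Pi_iff monoid.m_closed group.is_monoid)

lemma mutually_inverse_auto:
  assumes G: "group G" and h: "h \<in> hom G G" and k: "k \<in> hom G G"
    and hk: "\<And>v. v \<in> carrier G \<Longrightarrow> h (k v) = v" and kh: "\<And>v. v \<in> carrier G \<Longrightarrow> k (h v) = v"
  shows "restrict h (carrier G) \<in> auto G"
    and "inv\<^bsub>AutoGroup G\<^esub> (restrict h (carrier G)) = restrict k (carrier G)"
proof -
  have Bij: "restrict f (carrier G) \<in> Bij (carrier G)"
    if "f \<in> hom G G" "f' \<in> hom G G" "\<And>v. v \<in> carrier G \<Longrightarrow> f (f' v) = v"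
      "\<And>v. v \<in> carrier G \<Longrightarrow> f' (f v) = v" for f f'
  proof -
    have "bij_betw f (carrier G) (carrier G)"
      by (rule bij_betw_byWitness[of _ f']) (use that hom_in_carrier in fastforce)+
    then show ?thesis
      by (simp add: Bij_def bij_betw_restrict_eq)
  qed
  have aut: "restrict h (carrier G) \<in> auto G" "restrict k (carrier G) \<in> auto G"
    using Bij[OF h k hk kh] Bij[OF k h kh hk] restrict_hom[OF h G] restrict_hom[OF k G]
    by (simp_all add: auto_def)
  then show "restrict h (carrier G) \<in> auto G"
    by simp
  have "restrict k (carrier G) \<otimes>\<^bsub>AutoGroup G\<^esub> restrict h (carrier G) = \<one>\<^bsub>AutoGroup G\<^esub>"
    using Bij[OF h k hk kh] Bij[OF k h kh hk] kh hom_in_carrier[OF h]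
    by (auto simp: AutoGroup_def BijGroup_def compose_def restrict_def)
  then show "inv\<^bsub>AutoGroup G\<^esub> (restrict h (carrier G)) = restrict k (carrier G)"
    by (rule group.inv_equality[OF group.AutoGroup[OF G]])
      (use aut in \<open>simp_all add: AutoGroup_def BijGroup_def\<close>)
qed

lemma auto_hom: "\<phi> \<in> auto G \<Longrightarrow> \<phi> \<in> hom G G"
  by (simp add: auto_def)

lemma auto_bij: "\<phi> \<in> auto G \<Longrightarrow> bij_betw \<phi> (carrier G) (carrier G)"
  by (simp add: auto_def Bij_def)

lemma AutoGroup_mult:
  "\<psi> \<in> auto G \<Longrightarrow> \<phi> \<in> auto G \<Longrightarrow> \<psi> \<otimes>\<^bsub>AutoGroup G\<^esub> \<phi> = compose (carrier G) \<psi> \<phi>"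
  by (simp add: AutoGroup_def BijGroup_def auto_def)

lemma AutoGroup_carrier [simp]: "carrier (AutoGroup G) = auto G"
  by (simp add: AutoGroup_def)

lemma AutoGroup_one: "\<one>\<^bsub>AutoGroup G\<^esub> = (\<lambda>x \<in> carrier G. x)"
  by (simp add: AutoGroup_def BijGroup_def)

lemma conj_class_image:
  fixes G (structure)
  assumes G: "group G" and \<phi>: "\<phi> \<in> auto G" and u: "u \<in> carrier G"
  shows "\<phi> ` conj_class G u = conj_class G (\<phi> u)"
proof -
  interpret group G by fact
  have bij: "\<phi> ` carrier G = carrier G"
    using auto_bij[OF \<phi>] by (simp add: bij_betw_def)
  interpret hom: group_hom G G \<phi>
    by (intro group_hom.intro group_hom_axioms.intro G auto_hom \<phi>)
  have eq: "\<phi> (inv h \<otimes> u \<otimes> h) = inv (\<phi> h) \<otimes> \<phi> u \<otimes> \<phi> h" if "h \<in> carrier G" for h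
    using that u by simp
  have "\<phi> ` conj_class G u = (\<lambda>h. \<phi> (inv h \<otimes> u \<otimes> h)) ` carrier G"
    by (auto simp: conj_class_def)
  also have "\<dots> = (\<lambda>h. inv (\<phi> h) \<otimes> \<phi> u \<otimes> \<phi> h) ` carrier G"
    using eq by (rule image_cong[OF refl])
  also have "\<dots> = (\<lambda>h. inv h \<otimes> \<phi> u \<otimes> h) ` \<phi> ` carrier G"
    by (simp add: image_image)
  finally show ?thesis
    unfolding bij by (auto simp: conj_class_def)
qed

lemma conj_class_eq:
  fixes G (structure)
  assumes G: "group G" and u: "u \<in> carrier G" and v: "v \<in> conj_class G u"
  shows "conj_class G v = conj_class G u"
proof -
  interpret group G by fact
  obtain h where h: "h \<in> carrier G" and v: "v = inv h \<otimes> u \<otimes> h"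
    using v by (auto simp: conj_class_def)
  have 1: "inv k \<otimes> v \<otimes> k = inv (h \<otimes> k) \<otimes> u \<otimes> (h \<otimes> k)" if "k \<in> carrier G" for k
    using that h u by (simp add: v inv_mult_group m_assoc)
  have 2: "inv k \<otimes> u \<otimes> k = inv (inv h \<otimes> k) \<otimes> v \<otimes> (inv h \<otimes> k)" if "k \<in> carrier G" for k
  proof -
    have "h \<otimes> (inv h \<otimes> k) = k"
      using that h by (simp add: m_assoc[symmetric])
    then show ?thesis
      using 1[of "inv h \<otimes> k"] that h by simp
  qed
  show ?thesis
    unfolding conj_class_def
  proof (intro equalityI subsetI)
    fix x assume "x \<in> {inv k \<otimes> v \<otimes> k |k. k \<in> carrier G}"
    then obtain k where "k \<in> carrier G" "x = inv k \<otimes> v \<otimes> k"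
      by blast
    with 1 h show "x \<in> {inv k \<otimes> u \<otimes> k |k. k \<in> carrier G}"
      by (intro CollectI exI[of _ "h \<otimes> k"]) simp
  next
    fix x assume "x \<in> {inv k \<otimes> u \<otimes> k |k. k \<in> carrier G}"
    then obtain k where "k \<in> carrier G" "x = inv k \<otimes> u \<otimes> k"
      by blast
    with 2 h show "x \<in> {inv k \<otimes> v \<otimes> k |k. k \<in> carrier G}"
      by (intro CollectI exI[of _ "inv h \<otimes> k"]) simp
  qed
qed

lemma t_letter_in_Fgp: "j \<in> {1..p} \<Longrightarrow> [(Tgen j, True)] \<in> carrier (Fgp g p)"
  by (auto simp: letter_in_Fgp letters_iff gens_def)

text \<open>
  The induced map on the finitely many classes is onto, hence bijective.
\<close>

lemma t_classes_bij:
  assumes \<phi>: "\<phi> \<in> auto (Fgp g p)" and \<sigma>: "\<sigma> ` {1..p} = {1..p}"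
    and conj: "\<And>j. j \<in> {1..p} \<Longrightarrow> \<phi> [(Tgen j, True)] \<in> conj_class (Fgp g p) [(Tgen (\<sigma> j), True)]"
  shows "bij_betw (\<lambda>C. \<phi> ` C) (t_classes g p) (t_classes g p)"
proof -
  have eq: "\<phi> ` conj_class (Fgp g p) [(Tgen j, True)] = conj_class (Fgp g p) [(Tgen (\<sigma> j), True)]"
    if "j \<in> {1..p}" for j
  proof -
    have "\<sigma> j \<in> {1..p}"
      using that \<sigma> by blast
    then show ?thesis
      using conj_class_image[OF group_Fgp \<phi> t_letter_in_Fgp[OF that]]
        conj_class_eq[OF group_Fgp t_letter_in_Fgp conj[OF that]] by simp
  qed
  have "(\<lambda>C. \<phi> ` C) ` t_classes g p =
      (\<lambda>j. conj_class (Fgp g p) [(Tgen (\<sigma> j), True)]) ` {1..p}"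
    unfolding t_classes_def image_image using eq by (rule image_cong[OF refl])
  also have "\<dots> = (\<lambda>j. conj_class (Fgp g p) [(Tgen j, True)]) ` \<sigma> ` {1..p}"
    by (simp only: image_image)
  finally have "(\<lambda>C. \<phi> ` C) ` t_classes g p = t_classes g p"
    by (simp only: \<sigma> t_classes_def)
  then show ?thesis
    by (auto simp: bij_betw_def t_classes_def intro!: eq_card_imp_inj_on)
qed

lemma twist_inv_letter: "twist u w (inv_letter l) = word_inv (twist u w l)"
  by (auto simp: twist_def)

lemma twist_hom:
  assumes "u \<in> letters g p" "w \<in> letters g p"
  shows "letter_hom (twist u w) \<in> hom (Fgp g p) (Fgp g p)"
  by (rule letter_hom_in_hom_Fgp) (use assms in \<open>auto simp: twist_inv_letter twist_def\<close>)

lemma twist_cancel: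
  assumes "u \<in> letters g p" "w \<in> letters g p" "u \<noteq> w" "u \<noteq> inv_letter w"
    and v: "v \<in> carrier (Fgp g p)"
  shows "letter_hom (twist u w) (letter_hom (twist u (inv_letter w)) v) = v"
proof -
  let ?h = "letter_hom (twist u w)" and ?k = "letter_hom (twist u (inv_letter w))"
  have h: "?h \<in> hom (Fgp g p) (Fgp g p)" and k: "?k \<in> hom (Fgp g p) (Fgp g p)"
    using assms by (simp_all add: twist_hom)
  have w: "w \<noteq> u" "w \<noteq> inv_letter u" "inv_letter w \<noteq> u"
    using assms by auto
  have "(?h \<circ> ?k) v = id v"
  proof (rule hom_Fgp_eq[OF _ _ group_Fgp _ v])
    show "?h \<circ> ?k \<in> hom (Fgp g p) (Fgp g p)"
      using hom_compose[OF k h] by (simp add: o_def)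
    show "id \<in> hom (Fgp g p) (Fgp g p)"
      by (auto simp: hom_def)
    fix l assume "l \<in> letters g p"
    have red: "?h (reduce x) = ?h x" for x
      by (rule letter_hom_reduce) (simp add: twist_inv_letter)
    have tw: "twist u w w = [w]" "twist u w (inv_letter w) = [inv_letter w]"
      using w by (auto simp: twist_def)
    consider "l = u" | "l = inv_letter u" | "l \<noteq> u" "l \<noteq> inv_letter u"
      by blast
    then show "(?h \<circ> ?k) [l] = id [l]"
    proof cases
      case 1
      have "letter_hom (twist u w) (twist u (inv_letter w) u) = [u]"
        by (simp add: letter_hom_def tw twist_def[of u "inv_letter w"])
          (simp add: twist_def reduce_reduced reduce_Cons)
      then show ?thesis
        by (simp add: 1 red)
    next
      case 2
      have "letter_hom (twist u w) (twist u (inv_letter w) (inv_letter u)) = [inv_letter u]"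
        by (simp add: letter_hom_def tw twist_def[of u "inv_letter w"])
          (simp add: twist_def reduce_reduced reduce_Cons)
      then show ?thesis
        by (simp add: 2 red)
    next
      case 3
      then show ?thesis
        by (simp add: twist_def reduce_reduced)
    qed
  qed
  then show ?thesis
    by simp
qed

lemma twist_auto:
  assumes "u \<in> letters g p" "w \<in> letters g p" "u \<noteq> w" "u \<noteq> inv_letter w"
  shows "restrict (letter_hom (twist u w)) (carrier (Fgp g p)) \<in> auto (Fgp g p)"
    and "inv\<^bsub>AutoGroup (Fgp g p)\<^esub> (restrict (letter_hom (twist u (inv_letter w))) (carrier (Fgp g p)))
      = restrict (letter_hom (twist u w)) (carrier (Fgp g p))"
proof -
  have c1: "letter_hom (twist u w) (letter_hom (twist u (inv_letter w)) v) = v"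
    and c2: "letter_hom (twist u (inv_letter w)) (letter_hom (twist u w) v) = v"
    if "v \<in> carrier (Fgp g p)" for v
    using twist_cancel[of u g p w v] twist_cancel[of u g p "inv_letter w" v] assms that by auto
  have h: "letter_hom (twist u w) \<in> hom (Fgp g p) (Fgp g p)"
    "letter_hom (twist u (inv_letter w)) \<in> hom (Fgp g p) (Fgp g p)"
    using assms by (simp_all add: twist_hom)
  show "restrict (letter_hom (twist u w)) (carrier (Fgp g p)) \<in> auto (Fgp g p)"
    by (rule mutually_inverse_auto(1)[OF group_Fgp h c1 c2])
  show "inv\<^bsub>AutoGroup (Fgp g p)\<^esub> (restrict (letter_hom (twist u (inv_letter w))) (carrier (Fgp g p)))
      = restrict (letter_hom (twist u w)) (carrier (Fgp g p))"
    by (rule mutually_inverse_auto(2)[OF group_Fgp h(2) h(1) c2 c1])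
qed

text \<open>
  The position of the corner in \<open>V\<close> decides between right and left type, the kind of the letter \<open>u\<close>
  between \<open>nielsen2\<close> and \<open>nielsen3\<close>.
\<close>

lemma twist_nielsen_edge:
  assumes V: "ranked_word g p V" and corner: "corner V u w"
  defines "\<mu> \<equiv> restrict (letter_hom (twist u (inv_letter w))) (carrier (Fgp g p))"
  shows "(V, \<mu> V, \<mu>) \<in> nielsen_edges g p"
proof -
  define b where "b = inv_letter w"
  note uw = corner_letters[OF V corner]
  have b: "b \<in> letters g p" "u \<noteq> b" "u \<noteq> inv_letter b"
    using uw by (auto simp: b_def)
  have \<mu>: "\<mu> \<in> auto (Fgp g p)"
    using twist_auto(1)[OF uw(1) b] by (simp add: \<mu>_def b_def)
  have \<mu>V: "\<mu> V = letter_hom (twist u b) V"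
    using ranked_word_carrier[OF V] by (simp add: \<mu>_def b_def)
  have \<mu>_letter: "\<mu> [l] = reduce (twist u b l)" if "l \<in> letters g p" for l
    using that by (simp add: \<mu>_def b_def letter_in_Fgp)
  have W: "ranked_word g p (\<mu> V)"
    unfolding \<mu>V b_def by (rule ranked_word_twist[OF V corner])
  have "bij_betw (\<lambda>C. \<mu> ` C) (t_classes g p) (t_classes g p)"
  proof (rule t_classes_bij[OF \<mu>, of id])
    fix j assume j: "j \<in> {1..p}"
    let ?t = "(Tgen j, True)"
    have t: "?t \<in> letters g p"
      using t_letter_in_Fgp[OF j] by (simp add: letter_in_Fgp)
    have one: "[?t] \<in> conj_class (Fgp g p) [?t]"
      unfolding conj_class_def
      by (intro CollectI exI[of _ "[]"])
        (simp add: Fgp_def inv_free_group carrier_free_group reduce_reduced)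
    have conj: "reduce [l, ?t, inv_letter l] \<in> conj_class (Fgp g p) [?t]" if "l \<in> letters g p" for l
      unfolding conj_class_def using that
      by (intro CollectI exI[of _ "[inv_letter l]"])
        (simp add: Fgp_def inv_free_group carrier_free_group letters_iff reduce_append_reduce1[of "[_, _]", simplified])
    show "\<mu> [?t] \<in> conj_class (Fgp g p) [(Tgen (id j), True)]"
    proof (cases "?t = u \<or> ?t = inv_letter u")
      case True
      moreover have "is_t ?t"
        by (simp add: is_t_def)
      ultimately have "is_t u"
        by (metis is_t_inv_letter)
      with True have "twist u b ?t = [b, ?t, inv_letter b]"
        by (auto simp: twist_def)
      then show ?thesis
        using \<mu>_letter[OF t] conj[OF b(1)] by simp
    next
      case False
      then have "twist u b ?t = [?t]"
        by (auto simp: twist_def)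
      then show ?thesis
        using \<mu>_letter[OF t] one by (simp add: reduce_reduced)
    qed
  qed simp
  with V W \<mu> have edge: "(V, \<mu> V, \<mu>) \<in> zieschang_edges g p"
    by (simp add: zieschang_edges_def zieschang_elements_iff)
  define v where "v k = V ! (k - 1)" for k :: nat
  have enum: "zieschang_enum g p v V"
    using ranked_word_imp_zieschang_enum[OF V] by (simp add: v_def[abs_def])
  have fixes_others: "fixes_other_letters g p u \<mu>"
    by (auto simp: fixes_other_letters_def \<mu>_letter twist_def reduce_reduced)
  then have fixes_others': "fixes_other_letters g p (inv_letter u) \<mu>"
    by (auto simp: fixes_other_letters_def)
  have len: "length V = 4 * g + p"
    by (rule length_ranked_word[OF V])
  have set_V: "set V = t_letters p \<union> x_letters g"
    using V by (simp add: ranked_word_def)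
  have sort: "if is_t l then l \<in> t_letters p else l \<in> x_letters g" if "l \<in> set V" for l
    using that unfolding set_V by (auto simp: t_letters_def x_letters_def is_t_def)
  have invs: "inv\<^bsub>Fgp g p\<^esub> [l] = [inv_letter l]" if "l \<in> letters g p" for l
    using that by (simp add: Fgp_def inv_free_group carrier_free_group letters_iff)
  have mult: "x \<otimes>\<^bsub>Fgp g p\<^esub> y = reduce (x @ y)" for x y
    by (simp add: Fgp_def)
  consider A B where "V = A @ u # b # B" | A B where "V = A @ w # inv_letter u # B"
    using corner by (auto simp: corner_def b_def)
  then have "nielsen2 g p v \<mu> \<or> nielsen3 g p v \<mu>"
  proof cases
    case 1
    define k where "k = length A + 1"
    have k: "k \<in> {1..4 * g + p - 1}" "v k = u" "v (k + 1) = b"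
      using len by (auto simp: 1 k_def v_def nth_append)
    have u: "u \<in> set V"
      by (simp add: 1)
    show ?thesis
    proof (cases "is_t u")
      case True
      have "\<mu> [u] = [b] \<otimes>\<^bsub>Fgp g p\<^esub> [u] \<otimes>\<^bsub>Fgp g p\<^esub> inv\<^bsub>Fgp g p\<^esub> [b]"
        using True reduce_append_reduce1[of "[b, u]" "[inv_letter b]"]
        by (simp add: \<mu>_letter[OF uw(1)] invs[OF b(1)] mult twist_def)
      then have "nielsen3 g p v \<mu>"
        unfolding nielsen3_def using sort[OF u] True fixes_others k by (intro disjI1 bexI[of _ k]) auto
      then show ?thesis ..
    next
      case False
      have "\<mu> [u] = [u] \<otimes>\<^bsub>Fgp g p\<^esub> inv\<^bsub>Fgp g p\<^esub> [b]"
        using False by (simp add: \<mu>_letter[OF uw(1)] invs[OF b(1)] mult twist_def)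
      then have "nielsen2 g p v \<mu>"
        unfolding nielsen2_def using sort[OF u] False fixes_others k by (intro disjI1 bexI[of _ k]) auto
      then show ?thesis ..
    qed
  next
    case 2
    define k where "k = length A + 2"
    have k: "k \<in> {2..4 * g + p}" "v k = inv_letter u" "v (k - 1) = w"
      using len by (auto simp: 2 k_def v_def nth_append)
    have u: "inv_letter u \<in> set V"
      by (simp add: 2)
    have iu: "inv_letter u \<in> letters g p"
      using uw by simp
    show ?thesis
    proof (cases "is_t u")
      case True
      have "\<mu> [inv_letter u] = inv\<^bsub>Fgp g p\<^esub> [w] \<otimes>\<^bsub>Fgp g p\<^esub> [inv_letter u] \<otimes>\<^bsub>Fgp g p\<^esub> [w]"
        using True reduce_append_reduce1[of "[b, inv_letter u]" "[w]"]
        by (simp add: \<mu>_letter[OF iu] invs[OF uw(2)] mult twist_def b_def)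
      then have "nielsen3 g p v \<mu>"
        unfolding nielsen3_def using sort[OF u] True fixes_others' k by (intro disjI2 bexI[of _ k]) auto
      then show ?thesis ..
    next
      case False
      have "\<mu> [inv_letter u] = inv\<^bsub>Fgp g p\<^esub> [w] \<otimes>\<^bsub>Fgp g p\<^esub> [inv_letter u]"
        using False by (simp add: \<mu>_letter[OF iu] invs[OF uw(2)] mult twist_def b_def)
      then have "nielsen2 g p v \<mu>"
        unfolding nielsen2_def using sort[OF u] False fixes_others' k by (intro disjI2 bexI[of _ k]) auto
      then show ?thesis ..
    qed
  qed
  then show ?thesis
    using edge enum unfolding nielsen_edges_def by blast
qed

text \<open>
  The inverse edge, which leads to \<open>V\<close>: precomposing a homomorphism with it changes the image of \<open>u\<close> by
  the image of \<open>w\<close>, which can be used to cancel a common suffix of the two images.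
\<close>

lemma twist_subgroupoid:
  assumes V: "ranked_word g p V" and corner: "corner V u w"
  shows "\<exists>W. ranked_word g p W \<and> letter_hom (twist u w) W = V \<and>
    (W, V, restrict (letter_hom (twist u w)) (carrier (Fgp g p))) \<in> nielsen_subgroupoid g p"
proof -
  note uw = corner_letters[OF V corner]
  have "ranked_word g p (letter_hom (twist u (inv_letter w)) V)"
    by (rule ranked_word_twist[OF V corner])
  moreover have "(letter_hom (twist u (inv_letter w)) V, V,
      inv\<^bsub>AutoGroup (Fgp g p)\<^esub> (restrict (letter_hom (twist u (inv_letter w))) (carrier (Fgp g p))))
      \<in> nielsen_subgroupoid g p"
    using nielsen_subgroupoid.inverse[OF nielsen_subgroupoid.edge[OF twist_nielsen_edge[OF V corner]]]
      ranked_word_carrier[OF V] by simp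
  moreover have "letter_hom (twist u w) (letter_hom (twist u (inv_letter w)) V) = V"
    by (rule twist_cancel[OF uw(1-4) ranked_word_carrier[OF V]])
  ultimately show ?thesis
    unfolding twist_auto(2)[OF uw(1-4)] by blast
qed

text \<open>
  Counting shows that \<open>\<sigma>\<close> permutes the \<open>t\<close>-letters, their inverses and the \<open>x\<close>-letters separately; a
  ranking is transported along \<open>\<sigma>\<close>.
\<close>

lemma permutation_nielsen_edge:
  assumes V: "ranked_word g p V"
    and inv: "\<And>l. l \<in> letters g p \<Longrightarrow> \<sigma> (inv_letter l) = inv_letter (\<sigma> l)"
    and inj: "inj_on \<sigma> (letters g p)" and closed: "\<sigma> ` letters g p \<subseteq> letters g p"
    and t: "\<sigma> ` t_letters p \<subseteq> t_letters p"
  defines "\<mu> \<equiv> restrict (letter_hom (\<lambda>l. [\<sigma> l])) (carrier (Fgp g p))"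
  shows "ranked_word g p (map \<sigma> V)" "(V, map \<sigma> V, \<mu>) \<in> nielsen_edges g p"
proof -
  let ?L = "letters g p"
  have sub: "t_letters p \<subseteq> ?L" "x_letters g \<subseteq> ?L"
    by (auto simp: letters_eq)
  have fin: "finite (t_letters p)" "finite (x_letters g)"
    by (auto simp: t_letters_def x_letters_def)
  have t_eq: "\<sigma> ` t_letters p = t_letters p"
    using t inj_on_subset[OF inj sub(1)] fin by (metis card_image card_subset_eq)
  have ti_eq: "\<sigma> ` inv_letter ` t_letters p = inv_letter ` t_letters p"
  proof -
    have "\<sigma> ` inv_letter ` t_letters p = inv_letter ` \<sigma> ` t_letters p"
      unfolding image_image using inv sub(1) by (intro image_cong) auto
    then show ?thesis
      by (simp add: t_eq)
  qed
  have "\<sigma> ` x_letters g \<inter> (\<sigma> ` t_letters p \<union> \<sigma> ` inv_letter ` t_letters p) = {}"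
    using x_letters_not_t[of g p] inj_on_image_Int[OF inj sub(2), of "t_letters p \<union> inv_letter ` t_letters p"]
    by (simp add: letters_eq image_Un)
  then have "\<sigma> ` x_letters g \<inter> (t_letters p \<union> inv_letter ` t_letters p) = {}"
    by (simp only: t_eq ti_eq)
  moreover have "\<sigma> ` x_letters g \<subseteq> t_letters p \<union> inv_letter ` t_letters p \<union> x_letters g"
    using closed sub(2) unfolding letters_eq by blast
  ultimately have x: "\<sigma> ` x_letters g \<subseteq> x_letters g"
    by blast
  have x_eq: "\<sigma> ` x_letters g = x_letters g"
    using x inj_on_subset[OF inj sub(2)] fin by (metis card_image card_subset_eq)
  have L_eq: "\<sigma> ` ?L = ?L"
    by (simp add: letters_eq image_Un t_eq ti_eq x_eq)
  define \<tau> where "\<tau> = inv_into ?L \<sigma>"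
  have \<tau>\<sigma>: "\<tau> (\<sigma> l) = l" if "l \<in> ?L" for l
    using that inj by (simp add: \<tau>_def)
  have \<sigma>\<tau>: "\<sigma> (\<tau> l) = l" "\<tau> l \<in> ?L" if "l \<in> ?L" for l
    using that L_eq by (auto simp: \<tau>_def f_inv_into_f inv_into_into)
  have \<tau>_inv: "\<tau> (inv_letter l) = inv_letter (\<tau> l)" if "l \<in> ?L" for l
    using \<tau>\<sigma>[of "inv_letter (\<tau> l)"] inv[OF \<sigma>\<tau>(2)[OF that]] \<sigma>\<tau>[OF that] by simp
  have \<sigma>_closed: "\<sigma> l \<in> ?L" if "l \<in> ?L" for l
    using that closed by blast
  have set_V: "set V = t_letters p \<union> x_letters g" and dist: "distinct V"
    using V by (auto simp: ranked_word_def)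
  obtain f where f: "ranking p V f"
    using V by (auto simp: ranked_word_def)
  have "ranking p (map \<sigma> V) (\<lambda>l. f (\<tau> l))"
    unfolding ranking_def
  proof (intro conjI ballI)
    have "successively (\<lambda>l m. f (\<tau> (\<sigma> l)) < f (\<tau> (inv_letter (\<sigma> m)))) V \<longleftrightarrow>
        successively (\<lambda>l m. f l < f (inv_letter m)) V"
    proof (intro successively_cong refl)
      fix l m assume "l \<in> set V" "m \<in> set V"
      then have "l \<in> ?L" "m \<in> ?L"
        using set_V sub by auto
      then show "f (\<tau> (\<sigma> l)) < f (\<tau> (inv_letter (\<sigma> m))) \<longleftrightarrow> f l < f (inv_letter m)"
        using \<tau>\<sigma>[of "inv_letter m"] by (simp add: \<tau>\<sigma> inv)
    qed
    then show "successively (\<lambda>l m. f (\<tau> l) < f (\<tau> (inv_letter m))) (map \<sigma> V)"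
      using f by (simp add: successively_map ranking_def)
    fix j assume j: "j \<in> {1..p}"
    then have "(Tgen j, True) \<in> \<sigma> ` t_letters p"
      by (simp add: t_eq) (simp add: t_letters_def)
    then obtain i where i: "i \<in> {1..p}" "\<sigma> (Tgen i, True) = (Tgen j, True)"
      by (auto simp: t_letters_def)
    have L: "(Tgen i, True) \<in> ?L" "(Tgen j, True) \<in> ?L"
      using i(1) j by (auto simp: letters_iff gens_def)
    have \<tau>j: "\<tau> (Tgen j, True) = (Tgen i, True)"
      using \<tau>\<sigma>[OF L(1)] i by simp
    moreover have "\<tau> (Tgen j, False) = (Tgen i, False)"
      using \<tau>_inv[OF L(2)] \<tau>j by (simp add: inv_letter_def)
    ultimately show "f (\<tau> (Tgen j, False)) < f (\<tau> (Tgen j, True))"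
      using f i by (auto simp: ranking_def)
  qed
  moreover have "distinct (map \<sigma> V)"
    using dist inj_on_subset[OF inj] sub by (simp add: distinct_map set_V)
  moreover have "set (map \<sigma> V) = t_letters p \<union> x_letters g"
    by (simp add: set_V image_Un t_eq x_eq)
  ultimately show W: "ranked_word g p (map \<sigma> V)"
    unfolding ranked_word_def by blast
  let ?h = "letter_hom (\<lambda>l. [\<sigma> l])" and ?k = "letter_hom (\<lambda>l. [\<tau> l])"
  have h: "?h \<in> hom (Fgp g p) (Fgp g p)"
    by (rule letter_hom_in_hom_Fgp) (auto simp: inv \<sigma>_closed)
  have k: "?k \<in> hom (Fgp g p) (Fgp g p)"
    by (rule letter_hom_in_hom_Fgp) (auto simp: \<tau>_inv \<sigma>\<tau>)
  have id: "id \<in> hom (Fgp g p) (Fgp g p)"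
    by (auto simp: hom_def)
  have hk: "?h (?k v) = v" if "v \<in> carrier (Fgp g p)" for v
  proof -
    have "(?h \<circ> ?k) v = id v"
      using hom_compose[OF k h]
      by (intro hom_Fgp_eq[OF _ id group_Fgp _ that]) (auto simp: o_def \<sigma>\<tau> reduce_reduced)
    then show ?thesis
      by simp
  qed
  have kh: "?k (?h v) = v" if "v \<in> carrier (Fgp g p)" for v
  proof -
    have "(?k \<circ> ?h) v = id v"
      using hom_compose[OF h k]
      by (intro hom_Fgp_eq[OF _ id group_Fgp _ that]) (auto simp: o_def \<tau>\<sigma> reduce_reduced)
    then show ?thesis
      by simp
  qed
  have \<mu>: "\<mu> \<in> auto (Fgp g p)"
    unfolding \<mu>_def by (rule mutually_inverse_auto(1)[OF group_Fgp h k hk kh])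
  have \<mu>_letter: "\<mu> [l] = [\<sigma> l]" if "l \<in> ?L" for l
    using that by (simp add: \<mu>_def letter_in_Fgp reduce_reduced)
  have "concat (map (\<lambda>l. [\<sigma> l]) V) = map \<sigma> V"
    by (induction V) auto
  then have \<mu>V: "\<mu> V = map \<sigma> V"
    using ranked_word_carrier[OF V] ranked_word_reduced[OF W]
    by (simp add: \<mu>_def letter_hom_def reduce_reduced)
  have "\<exists>i. \<sigma> (Tgen j, True) = (Tgen i, True)" if "j \<in> {1..p}" for j
  proof -
    have "(Tgen j, True) \<in> t_letters p"
      using that by (simp add: t_letters_def)
    then have "\<sigma> (Tgen j, True) \<in> t_letters p"
      using t by blast
    then show ?thesis
      by (auto simp: t_letters_def)
  qed
  then obtain s where s: "\<And>j. j \<in> {1..p} \<Longrightarrow> \<sigma> (Tgen j, True) = (Tgen (s j), True)"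
    by metis
  have "bij_betw (\<lambda>C. \<mu> ` C) (t_classes g p) (t_classes g p)"
  proof (rule t_classes_bij[OF \<mu>, of s])
    have T: "t_letters p = (\<lambda>j. (Tgen j, True)) ` {1..p}"
      by (auto simp: t_letters_def)
    have "(\<lambda>j. (Tgen j, True)) ` {1..p} = \<sigma> ` (\<lambda>j. (Tgen j, True)) ` {1..p}"
      using t_eq unfolding T by (rule sym)
    also have "\<dots> = (\<lambda>j. (Tgen (s j), True)) ` {1..p}"
      unfolding image_image using s by (rule image_cong[OF refl])
    also have "\<dots> = (\<lambda>j. (Tgen j, True)) ` s ` {1..p}"
      by (simp only: image_image)
    finally have "(\<lambda>j. (Tgen j, True)) ` {1..p} = (\<lambda>j. (Tgen j, True)) ` s ` {1..p}" .
    then show "s ` {1..p} = {1..p}"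
      by (subst (asm) inj_image_eq_iff) (auto simp: inj_on_def)
    fix j assume j: "j \<in> {1..p}"
    then have "(Tgen j, True) \<in> ?L"
      by (auto simp: letters_iff gens_def)
    then show "\<mu> [(Tgen j, True)] \<in> conj_class (Fgp g p) [(Tgen (s j), True)]"
      unfolding conj_class_def
      by (intro CollectI exI[of _ "[]"])
        (simp add: \<mu>_letter s[OF j] Fgp_def inv_free_group carrier_free_group reduce_reduced)
  qed
  with V W \<mu> \<mu>V have edge: "(V, map \<sigma> V, \<mu>) \<in> zieschang_edges g p"
    by (simp add: zieschang_edges_def zieschang_elements_iff)
  have bij: "bij_betw \<mu> ((\<lambda>l. [l]) ` S) ((\<lambda>l. [l]) ` S)" if "S \<subseteq> ?L" "\<sigma> ` S = S" for S
  proof -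
    have "inj_on \<mu> ((\<lambda>l. [l]) ` S)"
    proof (rule inj_onI)
      fix x y assume xy: "x \<in> (\<lambda>l. [l]) ` S" "y \<in> (\<lambda>l. [l]) ` S" and eq: "\<mu> x = \<mu> y"
      obtain l where x: "x = [l]" "l \<in> S"
        using xy(1) by (rule imageE)
      obtain m where y: "y = [m]" "m \<in> S"
        using xy(2) by (rule imageE)
      have lm: "x = [l]" "y = [m]" "l \<in> ?L" "m \<in> ?L"
        using x y subsetD[OF that(1)] by simp_all
      have "\<sigma> l = \<sigma> m"
        using eq \<mu>_letter[OF lm(3)] \<mu>_letter[OF lm(4)] by (simp add: lm(1,2))
      then show "x = y"
        using inj_onD[OF inj _ lm(3,4)] by (simp add: lm(1,2))
    qed
    moreover have "\<mu> ` (\<lambda>l. [l]) ` S = (\<lambda>l. [l]) ` \<sigma> ` S"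
      unfolding image_image using that(1) \<mu>_letter by (intro image_cong[OF refl]) auto
    ultimately show ?thesis
      by (simp add: bij_betw_def that(2))
  qed
  have "nielsen1 g p \<mu>"
    using bij[OF sub(1) t_eq] bij[OF sub(2) x_eq] by (simp add: nielsen1_def)
  moreover have "\<exists>v. zieschang_enum g p v V"
    using ranked_word_imp_zieschang_enum[OF V] by blast
  ultimately show "(V, map \<sigma> V, \<mu>) \<in> nielsen_edges g p"
    using edge unfolding nielsen_edges_def by blast
qed

section \<open>Cancellation in products of words\<close>

definition cancellation :: "'a letter list \<Rightarrow> 'a letter list \<Rightarrow> nat" where
  "cancellation x y = length (longest_common_prefix (word_inv x) y)"

lemma cancellation_split:
  obtains \<alpha> \<gamma> \<delta> where "x = \<alpha> @ \<gamma>" "y = word_inv \<gamma> @ \<delta>" "length \<gamma> = cancellation x y"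
    "\<alpha> = [] \<or> \<delta> = [] \<or> hd \<delta> \<noteq> inv_letter (last \<alpha>)"
proof -
  define q where "q = longest_common_prefix (word_inv x) y"
  obtain \<eta> where \<eta>: "word_inv x = q @ \<eta>"
    using longest_common_prefix_prefix1[of "word_inv x" y] by (auto simp: q_def elim: prefixE)
  obtain \<delta> where \<delta>: "y = q @ \<delta>"
    using longest_common_prefix_prefix2[of "word_inv x" y] by (auto simp: q_def elim: prefixE)
  have x: "x = word_inv \<eta> @ word_inv q"
    using \<eta> by (metis word_inv_simps(3,4))
  have "\<eta> = [] \<or> \<delta> = [] \<or> hd \<delta> \<noteq> hd \<eta>"
  proof (rule ccontr)
    assume "\<not> ?thesis"
    then obtain d \<eta>' \<delta>' where "\<eta> = d # \<eta>'" "\<delta> = d # \<delta>'"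
      by (metis list.collapse)
    then have "prefix (q @ [d]) (word_inv x)" "prefix (q @ [d]) y"
      using \<eta> \<delta> by auto
    then have "prefix (q @ [d]) q"
      unfolding q_def by (rule longest_common_prefix_max_prefix)
    then show False
      by (auto dest: prefix_length_le)
  qed
  moreover have "last (word_inv \<eta>) = inv_letter (hd \<eta>)" if "\<eta> \<noteq> []"
    using that by (cases \<eta>) auto
  ultimately have "word_inv \<eta> = [] \<or> \<delta> = [] \<or> hd \<delta> \<noteq> inv_letter (last (word_inv \<eta>))"
    by auto
  moreover have "y = word_inv (word_inv q) @ \<delta>"
    using \<delta> by (simp only: word_inv_simps)
  moreover have "length (word_inv q) = cancellation x y"
    by (simp add: cancellation_def q_def)
  ultimately show ?thesis
    using that x by blast
qed

definition left_cancel :: "nat \<Rightarrow> 'a letter list list \<Rightarrow> nat \<Rightarrow> nat" where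
  "left_cancel c ws k = (if k = 0 then c else cancellation (ws ! (k - 1)) (ws ! k))"

definition right_cancel :: "'a letter list list \<Rightarrow> nat \<Rightarrow> nat" where
  "right_cancel ws k =
    (if Suc k < length ws then cancellation (ws ! k) (ws ! Suc k) else 0)"

lemma left_cancel_Cons: "left_cancel c (x # y # ws) (Suc k) = left_cancel (cancellation x y) (y # ws) k"
  by (cases k) (auto simp: left_cancel_def)

lemma right_cancel_Cons: "right_cancel (x # ws) (Suc k) = right_cancel ws k"
  by (auto simp: right_cancel_def)

text \<open>
  Induction from the right. The statement has to record that the product of the factors still begins
  with more than the \<open>c\<close> letters of its first factor that the next factor to the left may consume:
  then the letter behind them stops the cancellation.
\<close>

lemma product_length_aux:
  assumes "ws \<noteq> []" "\<And>x. x \<in> set ws \<Longrightarrow> reduced x"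
    and "\<And>k. k < length ws \<Longrightarrow> left_cancel c ws k + right_cancel ws k < length (ws ! k)"
  shows "length (reduce (concat ws)) =
      c + (\<Sum>k<length ws. length (ws ! k) - left_cancel c ws k - right_cancel ws k)
    \<and> prefix (take (Suc c) (hd ws)) (reduce (concat ws))"
  using assms
proof (induction ws arbitrary: c)
  case (Cons x ws)
  have x: "reduced x"
    using Cons.prems by simp
  show ?case
  proof (cases ws)
    case Nil
    have "c < length x"
      using Cons.prems(3)[of 0] by (simp add: Nil left_cancel_def right_cancel_def)
    then show ?thesis
      using x by (simp add: Nil left_cancel_def right_cancel_def reduce_reduced take_is_prefix)
  next
    case (Cons y ws')
    define c' where "c' = cancellation x y"
    define Q where "Q = reduce (concat ws)"
    have lc: "left_cancel c (x # ws) (Suc k) = left_cancel c' ws k" for k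
      by (simp add: Cons c'_def left_cancel_Cons)
    have IH: "length Q = c' + (\<Sum>k<length ws. length (ws ! k) - left_cancel c' ws k - right_cancel ws k)
      \<and> prefix (take (Suc c') (hd ws)) Q"
      unfolding Q_def
    proof (rule Cons.IH)
      fix k assume "k < length ws"
      then show "left_cancel c' ws k + right_cancel ws k < length (ws ! k)"
        using Cons.prems(3)[of "Suc k"] by (simp add: lc right_cancel_Cons)
    qed (use Cons.prems Cons in auto)
    have c: "c + c' < length x"
      using Cons.prems(3)[of 0] by (simp add: Cons left_cancel_def right_cancel_def c'_def)
    have "c' < length y"
      using Cons.prems(3)[of 1] by (simp add: Cons left_cancel_def c'_def)
    obtain \<alpha> \<gamma> \<delta> where x_split: "x = \<alpha> @ \<gamma>" and y_split: "y = word_inv \<gamma> @ \<delta>"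
      and \<gamma>: "length \<gamma> = c'" and no_cancel: "\<alpha> = [] \<or> \<delta> = [] \<or> hd \<delta> \<noteq> inv_letter (last \<alpha>)"
      unfolding c'_def by (rule cancellation_split)
    then obtain d \<delta>' where d: "\<delta> = d # \<delta>'"
      using \<open>c' < length y\<close> by (cases \<delta>) auto
    have "take (Suc c') (hd ws) = word_inv \<gamma> @ [d]"
      using \<gamma> by (simp add: Cons y_split d)
    then obtain S where Q: "Q = word_inv \<gamma> @ d # S"
      using IH by (auto elim: prefixE)
    have "reduced Q"
      by (simp add: Q_def)
    then have "reduced (\<alpha> @ d # S)"
      using x no_cancel by (auto simp: Q x_split d reduced_append)
    moreover have "reduce (concat (x # ws)) = reduce (x @ Q)"
      by (simp add: Q_def)
    moreover have "reduce (x @ Q) = reduce (\<alpha> @ d # S)"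
      using reduce_cong[OF refl, of "\<gamma> @ word_inv \<gamma> @ d # S" "d # S" \<alpha>]
      by (simp add: Q x_split)
    ultimately have red: "reduce (concat (x # ws)) = \<alpha> @ d # S"
      by (simp add: reduce_reduced)
    have len_\<alpha>: "length \<alpha> + c' = length x"
      by (simp add: x_split \<gamma>)
    have "length (\<alpha> @ d # S) + 2 * c' = length x + length Q"
      using \<gamma> by (simp add: Q x_split)
    moreover have "(\<Sum>k<length (x # ws). length ((x # ws) ! k) - left_cancel c (x # ws) k
          - right_cancel (x # ws) k) =
        (length x - c - c') + (\<Sum>k<length ws. length (ws ! k) - left_cancel c' ws k - right_cancel ws k)"
      unfolding list.size(4) add_0_right add_Suc_right sum.lessThan_Suc_shift nth_Cons_Suc lc right_cancel_Cons
      by (simp add: Cons left_cancel_def right_cancel_def c'_def)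
    ultimately have "length (\<alpha> @ d # S) = c + (\<Sum>k<length (x # ws). length ((x # ws) ! k)
        - left_cancel c (x # ws) k - right_cancel (x # ws) k)"
      using IH c by linarith
    moreover have "take (Suc c) x = take (Suc c) \<alpha>"
      using c len_\<alpha> by (simp add: x_split)
    then have "prefix (take (Suc c) (hd (x # ws))) (\<alpha> @ d # S)"
      by (simp add: take_is_prefix)
    ultimately show ?thesis
      unfolding red by blast
  qed
qed simp

text \<open>
  If no factor of a product is consumed by the cancellation with its two neighbours, then the
  cancellation stops there.
\<close>

lemma length_reduce_product:
  assumes "\<And>x. x \<in> set ws \<Longrightarrow> reduced x"
    and "\<And>k. k < length ws \<Longrightarrow> left_cancel 0 ws k + right_cancel ws k < length (ws ! k)"
  shows "length (reduce (concat ws)) =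
    (\<Sum>k<length ws. length (ws ! k) - left_cancel 0 ws k - right_cancel ws k)"
  using product_length_aux[of ws 0] assms by (cases "ws = []") auto

definition word_val :: "('a \<Rightarrow> nat) \<Rightarrow> nat \<Rightarrow> 'a list \<Rightarrow> nat" where
  "word_val idx M = foldl (\<lambda>v l. v * M + idx l) 0"

lemma word_val_snoc: "word_val idx M (v @ [l]) = word_val idx M v * M + idx l"
  by (simp add: word_val_def)

lemma word_val_append: "word_val idx M (u @ w) = word_val idx M u * M ^ length w + word_val idx M w"
proof (induction w rule: rev_induct)
  case (snoc l w)
  then show ?case
    using word_val_snoc[of idx M "u @ w"] by (simp add: word_val_snoc algebra_simps)
qed (simp add: word_val_def)

lemma word_val_inj:
  assumes "inj_on idx A" "idx ` A \<subseteq> {..<M}"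
  shows "length u = length w \<Longrightarrow> set u \<subseteq> A \<Longrightarrow> set w \<subseteq> A \<Longrightarrow>
    word_val idx M u = word_val idx M w \<Longrightarrow> u = w"
proof (induction u arbitrary: w rule: rev_induct)
  case (snoc l u)
  then obtain m v where w: "w = v @ [m]"
    by (cases w rule: rev_cases) auto
  have l: "idx l < M" "idx m < M"
    using assms(2) snoc.prems by (auto simp: w)
  have eq: "word_val idx M u * M + idx l = word_val idx M v * M + idx m"
    using snoc.prems by (simp add: w word_val_snoc)
  then have "(word_val idx M u * M + idx l) mod M = (word_val idx M v * M + idx m) mod M"
    by simp
  then have idx: "idx l = idx m"
    using l by simp
  then have "word_val idx M u = word_val idx M v"
    using eq l by simp
  then have "u = v"
    using snoc by (auto simp: w)
  moreover have "l = m"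
    using idx assms(1) snoc.prems by (auto simp: w dest: inj_onD)
  ultimately show ?case
    by (simp add: w)
qed simp

lemma word_val_append_le: "M > 0 \<Longrightarrow>
    word_val idx M (u @ w) \<le> word_val idx M (v @ w) \<longleftrightarrow> word_val idx M u \<le> word_val idx M v"
  by (simp add: word_val_append)

text \<open>
  The first component of the complexity is the total length of the images of all letters, the second
  breaks ties by their first halves: \<open>word_val\<close> reads a word as a number in base \<open>M\<close>, which orders
  words of equal length lexicographically. Both sums run over the letters and their inverses, so the second halves are included.
\<close>

definition half :: "'a list \<Rightarrow> 'a list" where
  "half w = take (length w div 2) w"

definition total_length :: "nat \<Rightarrow> nat \<Rightarrow> (gen letter \<Rightarrow> 'a list) \<Rightarrow> nat" where
  "total_length g p a = (\<Sum>l\<in>letters g p. length (a l))"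

definition total_value ::
  "('a \<Rightarrow> nat) \<Rightarrow> nat \<Rightarrow> nat \<Rightarrow> nat \<Rightarrow> (gen letter \<Rightarrow> 'a list) \<Rightarrow> nat" where
  "total_value idx M g p a = (\<Sum>l\<in>letters g p. word_val idx M (half (a l)))"

definition twisted ::
  "(gen letter \<Rightarrow> 'b letter list) \<Rightarrow> gen letter \<Rightarrow> gen letter \<Rightarrow> gen letter \<Rightarrow> 'b letter list" where
  "twisted a u w l = letter_hom a (twist u w l)"

lemma sum_letters_split:
  fixes F :: "gen letter \<Rightarrow> nat"
  assumes "u \<in> letters g p"
  shows "(\<Sum>l\<in>letters g p. F l) =
    F u + F (inv_letter u) + (\<Sum>l\<in>letters g p - {u, inv_letter u}. F l)"
proof -
  have "letters g p = insert u (insert (inv_letter u) (letters g p - {u, inv_letter u}))"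
    using assms by auto
  then have "(\<Sum>l\<in>letters g p. F l) = (\<Sum>l\<in>insert u (insert (inv_letter u) (letters g p - {u, inv_letter u})). F l)"
    by simp
  also have "\<dots> = F u + F (inv_letter u) + (\<Sum>l\<in>letters g p - {u, inv_letter u}. F l)"
    using finite_letters by (subst sum.insert) (auto simp: sum.insert)
  finally show ?thesis .
qed

section \<open>Images that no Nielsen move simplifies\<close>

text \<open>
  Here \<open>a\<close> gives the images of the letters under a homomorphism to a free group, \<open>A\<close> is a finite
  alphabet in which they are spelled, and no Nielsen move lowers the complexity. The images of
  \<open>t\<close>-letters are conjugates of generators. A twist at a corner changes only one image and its inverse.
\<close>

locale minimal_images =
  fixes g p :: nat and V :: "gen letter list" and a :: "gen letter \<Rightarrow> 'b letter list"
    and idx :: "'b letter \<Rightarrow> nat" and M :: nat and A :: "'b letter set"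
  assumes V: "ranked_word g p V"
    and a_reduced: "\<And>l. l \<in> letters g p \<Longrightarrow> reduced (a l)"
    and a_inv: "\<And>l. l \<in> letters g p \<Longrightarrow> a (inv_letter l) = word_inv (a l)"
    and a_nonempty: "\<And>l. l \<in> letters g p \<Longrightarrow> a l \<noteq> []"
    and a_t: "\<And>j. j \<in> {1..p} \<Longrightarrow> \<exists>\<omega> x. a (Tgen j, True) = word_inv \<omega> @ (x, True) # \<omega>"
    and a_alphabet: "\<And>l. l \<in> letters g p \<Longrightarrow> set (a l) \<subseteq> A"
    and idx: "inj_on idx A" "idx ` A \<subseteq> {..<M}"
    and length_min: "\<And>u w. corner V u w \<Longrightarrow> total_length g p a \<le> total_length g p (twisted a u w)"
    and value_min: "\<And>u w. corner V u w \<Longrightarrow> total_length g p (twisted a u w) = total_length g p a \<Longrightarrow>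
      total_value idx M g p a \<le> total_value idx M g p (twisted a u w)"
begin

abbreviation "val \<equiv> word_val idx M"

lemma t_image:
  assumes "l \<in> letters g p" "is_t l"
  obtains \<omega> s where "a l = word_inv \<omega> @ s # \<omega>" "snd s = snd l"
proof -
  obtain j b where j: "j \<in> {1..p}" and l: "l = (Tgen j, b)"
    using assms by (cases l) (auto simp: letters_iff is_t_def gens_def)
  obtain \<omega> x where \<omega>: "a (Tgen j, True) = word_inv \<omega> @ (x, True) # \<omega>"
    using a_t[OF j] by blast
  show ?thesis
  proof (cases b)
    case True
    then show ?thesis
      using that[of \<omega> "(x, True)"] \<omega> l by simp
  next
    case False
    have "(Tgen j, True) \<in> letters g p"
      using assms(1) by (simp add: l letters_iff)
    then have "a l = word_inv (word_inv \<omega> @ (x, True) # \<omega>)"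
      using a_inv[of "(Tgen j, True)"] False \<omega> by (simp add: l inv_letter_def)
    then show ?thesis
      using that[of \<omega> "(x, False)"] False l by (simp add: inv_letter_def)
  qed
qed

lemma twisted_self:
  assumes "corner V u w"
  shows "twisted a u w u =
    (if is_t u then reduce (a w @ a u @ word_inv (a w)) else reduce (a u @ word_inv (a w)))"
  using a_inv[OF corner_letters(2)[OF V assms]] by (simp add: twisted_def letter_hom_def twist_def)

lemma twisted_inv: "u \<in> letters g p \<Longrightarrow> w \<in> letters g p \<Longrightarrow>
    twisted a u w (inv_letter u) = word_inv (twisted a u w u)"
  by (auto simp: twisted_def letter_hom_def twist_def a_inv reduce_word_inv[symmetric])

lemma twisted_other: "l \<in> letters g p \<Longrightarrow> l \<noteq> u \<Longrightarrow> l \<noteq> inv_letter u \<Longrightarrow> twisted a u w l = a l"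
  by (simp add: twisted_def twist_def reduce_reduced a_reduced)

lemma sum_twisted:
  fixes F :: "'b letter list \<Rightarrow> nat"
  assumes "corner V u w"
  shows "(\<Sum>l\<in>letters g p. F (a l)) + F (twisted a u w u) + F (word_inv (twisted a u w u)) =
    (\<Sum>l\<in>letters g p. F (twisted a u w l)) + F (a u) + F (word_inv (a u))"
proof -
  note uw = corner_letters[OF V assms]
  have "(\<Sum>l\<in>letters g p - {u, inv_letter u}. F (twisted a u w l)) =
      (\<Sum>l\<in>letters g p - {u, inv_letter u}. F (a l))"
    by (intro sum.cong) (auto simp: twisted_other)
  then show ?thesis
    using sum_letters_split[OF uw(1), of "\<lambda>l. F (a l)"]
      sum_letters_split[OF uw(1), of "\<lambda>l. F (twisted a u w l)"]
    by (simp add: twisted_inv[OF uw(1,2)] a_inv[OF uw(1)])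
qed

lemma length_min_letter:
  assumes "corner V u w"
  shows "length (a u) \<le> length (twisted a u w u)"
  using sum_twisted[OF assms, of length] length_min[OF assms] by (simp add: total_length_def)

lemma value_min_letter:
  assumes "corner V u w" and "length (twisted a u w u) = length (a u)"
  shows "val (half (a u)) + val (half (word_inv (a u))) \<le>
    val (half (twisted a u w u)) + val (half (word_inv (twisted a u w u)))"
  using sum_twisted[OF assms(1), of length] sum_twisted[OF assms(1), of "\<lambda>x. val (half x)"]
    value_min[OF assms(1)] assms(2)
  by (simp add: total_length_def total_value_def)

lemma reduce_cancel_middle: "reduce (x @ \<gamma> @ word_inv \<gamma> @ y) = reduce (x @ y)"
  by (rule reduce_cong) simp_all

text \<open>
  The twist replaces the common suffix \<open>\<gamma>\<close> by the inverse of \<open>\<beta>\<close>.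
\<close>

lemma overlap_x:
  assumes "corner V u w" "\<not> is_t u" "a u = \<alpha> @ \<gamma>" "a w = \<beta> @ \<gamma>"
  shows "length \<gamma> \<le> length \<beta>"
proof -
  have "twisted a u w u = reduce (\<alpha> @ word_inv \<beta>)"
    using assms by (simp add: twisted_self reduce_cancel_middle)
  then have "length (a u) \<le> length (\<alpha> @ word_inv \<beta>)"
    using length_min_letter[OF assms(1)] length_reduce order_trans by metis
  then show ?thesis
    using assms by simp
qed

lemma twisted_t:
  assumes "corner V u w" "is_t u" "a u = word_inv (\<omega> @ \<gamma>) @ s # \<omega> @ \<gamma>" "a w = \<beta> @ \<gamma>"
  shows "twisted a u w u = reduce (\<beta> @ word_inv \<omega> @ s # \<omega> @ word_inv \<beta>)"
proof -
  have "twisted a u w u =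
      reduce ((\<beta> @ \<gamma> @ word_inv \<gamma> @ word_inv \<omega> @ s # \<omega>) @ \<gamma> @ word_inv \<gamma> @ word_inv \<beta>)"
    using assms by (simp add: twisted_self)
  also have "\<dots> = reduce (\<beta> @ \<gamma> @ word_inv \<gamma> @ (word_inv \<omega> @ s # \<omega> @ word_inv \<beta>))"
    by (subst reduce_cancel_middle) simp
  also have "\<dots> = reduce (\<beta> @ word_inv \<omega> @ s # \<omega> @ word_inv \<beta>)"
    by (rule reduce_cancel_middle)
  finally show ?thesis .
qed

lemma suffix_split:
  assumes "x @ y = z @ w" "length y \<le> length w"
  obtains v where "w = v @ y"
  using assms by (auto simp: append_eq_append_conv2)

lemma overlap_t:
  assumes "corner V u w" "is_t u" "a u = word_inv \<omega> @ s # \<omega>" "a u = \<alpha> @ \<gamma>" "a w = \<beta> @ \<gamma>"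
    and "length \<gamma> \<le> length \<omega>"
  shows "length \<gamma> \<le> length \<beta>"
proof -
  have "\<alpha> @ \<gamma> = (word_inv \<omega> @ [s]) @ \<omega>"
    using assms by simp
  then obtain \<omega>' where \<omega>: "\<omega> = \<omega>' @ \<gamma>"
    using assms(6) by (rule suffix_split)
  have "twisted a u w u = reduce (\<beta> @ word_inv \<omega>' @ s # \<omega>' @ word_inv \<beta>)"
    using assms \<omega> by (intro twisted_t) simp_all
  then have "length (a u) \<le> length (\<beta> @ word_inv \<omega>' @ s # \<omega>' @ word_inv \<beta>)"
    using length_min_letter[OF assms(1)] length_reduce order_trans by metis
  then show ?thesis
    using assms(3) by (simp add: \<omega>)
qed

text \<open>
  When the common suffix reaches beyond the centre \<open>s\<close> of a conjugate, the twist replaces the conjugator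
  \<open>\<omega>\<close> by the inverse of what precedes \<open>s\<close> in the image of \<open>w\<close>, so this remainder cannot be shorter than \<open>\<omega>\<close>.
\<close>

lemma overlap_t_middle:
  assumes "corner V u w" "is_t u" "a u = word_inv \<omega> @ s # \<omega>" "a u = \<alpha> @ \<gamma>" "a w = \<beta> @ \<gamma>"
    and "length \<gamma> > length \<omega>"
  shows "2 * length \<omega> + 1 \<le> length (a w)" "\<exists>\<delta>. \<gamma> = \<delta> @ s # \<omega>"
proof -
  have "word_inv \<omega> @ s # \<omega> = \<alpha> @ \<gamma>"
    using assms by simp
  then obtain \<delta> where \<gamma>: "\<gamma> = \<delta> @ s # \<omega>"
    using assms(6) by (auto elim!: suffix_split)
  then show "\<exists>\<delta>. \<gamma> = \<delta> @ s # \<omega>" ..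
  define \<theta> where "\<theta> = \<beta> @ \<delta>"
  have w: "a w = \<theta> @ s # \<omega>"
    using assms \<gamma> by (simp add: \<theta>_def)
  have "twisted a u w u =
      reduce ((\<theta> @ [s]) @ \<omega> @ word_inv \<omega> @ (s # \<omega> @ word_inv \<omega> @ inv_letter s # word_inv \<theta>))"
    using assms(1-3) w by (simp add: twisted_self)
  also have "\<dots> = reduce ((\<theta> @ [s, s]) @ \<omega> @ word_inv \<omega> @ (inv_letter s # word_inv \<theta>))"
    by (subst reduce_cancel_middle) simp
  also have "\<dots> = reduce ((\<theta> @ [s]) @ [s] @ word_inv [s] @ word_inv \<theta>)"
    by (subst reduce_cancel_middle) simp
  also have "\<dots> = reduce ((\<theta> @ [s]) @ word_inv \<theta>)"
    by (rule reduce_cancel_middle)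
  finally have "length (a u) \<le> length ((\<theta> @ [s]) @ word_inv \<theta>)"
    using length_min_letter[OF assms(1)] length_reduce order_trans by metis
  then show "2 * length \<omega> + 1 \<le> length (a w)"
    using assms(3) w by simp
qed

text \<open>
  The cases not covered so far have two \<open>t\<close>-letters at the corner. If the common suffix contained the
  centre of one image, it would contain the centres of both and these would agree; but the two ends
  of an edge between \<open>t\<close>-letters have opposite exponents.
\<close>

lemma overlap:
  assumes corner: "corner V u w" and u: "a u = \<alpha> @ \<gamma>" and w: "a w = \<beta> @ \<gamma>"
  shows "length \<gamma> \<le> length \<beta>"
proof (cases "is_t u")
  case False
  show ?thesis
    by (rule overlap_x[OF corner False u w])
next
  case True
  note uw = corner_letters[OF V corner]
  obtain \<omega> s where \<omega>: "a u = word_inv \<omega> @ s # \<omega>" "snd s = snd u"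
    using t_image[OF uw(1) True] .
  show ?thesis
  proof (rule ccontr)
    assume neg: "\<not> ?thesis"
    then have long: "length \<gamma> > length \<omega>"
      using overlap_t[OF corner True \<omega>(1) u w] by linarith
    have \<alpha>: "length \<alpha> < length \<gamma>"
      using long arg_cong[OF \<omega>(1), of length] arg_cong[OF u, of length] by simp
    note corner' = corner_sym[OF corner]
    show False
    proof (cases "is_t w")
      case False
      then show False
        using overlap_x[OF corner' False w u] \<alpha> by simp
    next
      case w_t: True
      obtain \<omega>' s' where \<omega>': "a w = word_inv \<omega>' @ s' # \<omega>'" "snd s' = snd w"
        using t_image[OF uw(2) w_t] .
      have long': "length \<gamma> > length \<omega>'"
        using overlap_t[OF corner' w_t \<omega>'(1) w u] \<alpha> by linarith
      note m = overlap_t_middle[OF corner True \<omega>(1) u w long]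
        overlap_t_middle[OF corner' w_t \<omega>'(1) w u long']
      have "length \<omega> = length \<omega>'"
        using m(1,3) arg_cong[OF \<omega>(1), of length] arg_cong[OF \<omega>'(1), of length] by simp
      then have "s = s'"
        using m(2,4) by auto
      then show False
        using uw(5)[OF True w_t] \<omega>(2) \<omega>'(2) by simp
    qed
  qed
qed

lemma M_pos: "l \<in> letters g p \<Longrightarrow> M > 0"
  using a_nonempty[of l] a_alphabet[of l] idx(2) by (cases "a l") auto

text \<open>
  When the cancelled suffix \<open>\<gamma>\<close> is exactly half of the image of \<open>u\<close>, the twist of \<open>w\<close> keeps all
  lengths and exchanges \<open>\<gamma>\<close> for the inverse of \<open>\<alpha>\<close>. By minimality this is no gain in the
  second component of the complexity.
\<close>

lemma half_overlap_value:
  assumes corner: "corner V u w" and u: "a u = \<alpha> @ \<gamma>" and w: "a w = \<beta> @ \<gamma>"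
    and len: "length \<alpha> = length \<gamma>"
  shows "val (word_inv \<gamma>) \<le> val \<alpha>"
proof -
  note uw = corner_letters[OF V corner]
  note corner' = corner_sym[OF corner]
  have \<beta>: "length \<gamma> \<le> length \<beta>"
    by (rule overlap[OF corner u w])
  show ?thesis
  proof (cases "is_t w")
    case False
    have tw: "twisted a w u w = reduce (\<beta> @ word_inv \<alpha>)"
      using False corner' u w by (simp add: twisted_self reduce_cancel_middle)
    have "reduced (\<beta> @ word_inv \<alpha>)"
    proof (rule ccontr)
      assume "\<not> ?thesis"
      then have "length (twisted a w u w) < length (\<beta> @ word_inv \<alpha>)"
        unfolding tw by (rule length_reduce_less)
      then show False
        using length_min_letter[OF corner'] w len by simp
    qed
    then have tw: "twisted a w u w = \<beta> @ word_inv \<alpha>"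
      by (simp add: tw reduce_reduced)
    define h where "h = (length \<beta> + length \<gamma>) div 2"
    have h: "length \<gamma> \<le> h" "h \<le> length \<beta>"
      using \<beta> by (auto simp: h_def)
    \<comment> \<open>The exchanged suffix is at most half of the image of w, so only the inverse of the image gets a new first half.\<close>
    have "half (twisted a w u w) = half (a w)"
      using h len by (simp add: half_def tw w flip: h_def)
    moreover have "half (word_inv (twisted a w u w)) = \<alpha> @ take (h - length \<gamma>) (word_inv \<beta>)"
      using h len by (simp add: half_def tw add.commute flip: h_def)
    moreover have "half (word_inv (a w)) = word_inv \<gamma> @ take (h - length \<gamma>) (word_inv \<beta>)"
      using h len by (simp add: half_def w add.commute flip: h_def)
    ultimately have "val (word_inv \<gamma> @ take (h - length \<gamma>) (word_inv \<beta>)) \<le>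
        val (\<alpha> @ take (h - length \<gamma>) (word_inv \<beta>))"
      using value_min_letter[OF corner'] by (simp add: tw w len)
    then show ?thesis
      using word_val_append_le[OF M_pos[OF uw(1)]] by blast
  next
    case True
    obtain \<omega> s where \<omega>: "a w = word_inv \<omega> @ s # \<omega>"
      using t_image[OF uw(2) True] .
    have "length \<gamma> \<le> length \<omega>"
      using \<beta> arg_cong[OF \<omega>, of length] arg_cong[OF w, of length] by simp
    moreover have "\<beta> @ \<gamma> = (word_inv \<omega> @ [s]) @ \<omega>"
      using w \<omega> by simp
    ultimately obtain \<omega>' where \<omega>': "\<omega> = \<omega>' @ \<gamma>"
      using suffix_split by blast
    have tw: "twisted a w u w = reduce (\<alpha> @ word_inv \<omega>' @ s # \<omega>' @ word_inv \<alpha>)"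
      using \<omega> \<omega>' u by (intro twisted_t[OF corner' True]) simp_all
    have "reduced (\<alpha> @ word_inv \<omega>' @ s # \<omega>' @ word_inv \<alpha>)"
    proof (rule ccontr)
      assume "\<not> ?thesis"
      then have "length (twisted a w u w) < length (\<alpha> @ word_inv \<omega>' @ s # \<omega>' @ word_inv \<alpha>)"
        unfolding tw by (rule length_reduce_less)
      then show False
        using length_min_letter[OF corner'] \<omega> \<omega>' len by simp
    qed
    then have tw: "twisted a w u w = \<alpha> @ word_inv \<omega>' @ s # \<omega>' @ word_inv \<alpha>"
      by (simp add: tw reduce_reduced)
    have half_odd: "half (x @ c # y) = x" if "length y = length x" for x y :: "'b letter list" and c
      using that by (simp add: half_def)
    have "half (twisted a w u w) = \<alpha> @ word_inv \<omega>'"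
      using half_odd[of "\<omega>' @ word_inv \<alpha>" "\<alpha> @ word_inv \<omega>'" s] by (simp add: tw)
    moreover have "half (word_inv (twisted a w u w)) = \<alpha> @ word_inv \<omega>'"
      using half_odd[of "\<omega>' @ word_inv \<alpha>" "\<alpha> @ word_inv \<omega>'" "inv_letter s"] by (simp add: tw)
    moreover have "half (a w) = word_inv \<gamma> @ word_inv \<omega>'"
      using half_odd[of \<omega> "word_inv \<omega>" s] by (simp add: \<omega> \<omega>')
    moreover have "half (word_inv (a w)) = word_inv \<gamma> @ word_inv \<omega>'"
      using half_odd[of \<omega> "word_inv \<omega>" "inv_letter s"] by (simp add: \<omega> \<omega>')
    moreover have "length (twisted a w u w) = length (a w)"
      by (simp add: tw \<omega> \<omega>' len)
    ultimately have "val (word_inv \<gamma> @ word_inv \<omega>') \<le> val (\<alpha> @ word_inv \<omega>')"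
      using value_min_letter[OF corner'] by simp
    then show ?thesis
      using word_val_append_le[OF M_pos[OF uw(1)]] by blast
  qed
qed

text \<open>
  Otherwise the comparison at both ends of \<open>u\<close> makes the two halves of its image mutually inverse, and
  the image trivial.
\<close>

lemma not_both_halves:
  assumes corner: "corner V u w" "corner V (inv_letter u) w'"
    and u: "a u = \<alpha> @ \<gamma>" "a w = \<beta> @ \<gamma>" and u': "a (inv_letter u) = \<alpha>' @ \<gamma>'" "a w' = \<beta>' @ \<gamma>'"
    and len: "2 * length \<gamma> = length (a u)" "2 * length \<gamma>' = length (a u)"
  shows False
proof -
  note u_letter = corner_letters(1)[OF V corner(1)]
  have l: "length \<alpha> = length \<gamma>" "length \<alpha>' = length \<gamma>'"
    using arg_cong[OF u(1), of length] arg_cong[OF u'(1), of length] a_inv[OF u_letter] len by auto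
  have "word_inv \<gamma> @ word_inv \<alpha> = \<alpha>' @ \<gamma>'"
    using u(1) u'(1) a_inv[OF u_letter] by simp
  moreover have "length (word_inv \<alpha>) = length \<gamma>'"
    using l len by simp
  ultimately have \<gamma>': "\<alpha>' = word_inv \<gamma>" "\<gamma>' = word_inv \<alpha>"
    by simp_all
  have "val (word_inv \<gamma>) \<le> val \<alpha>"
    by (rule half_overlap_value[OF corner(1) u l(1)])
  moreover have "val (word_inv (word_inv \<alpha>)) \<le> val (word_inv \<gamma>)"
    using half_overlap_value[OF corner(2) u' l(2)] by (simp add: \<gamma>')
  ultimately have eq: "val (word_inv \<gamma>) = val \<alpha>"
    by simp
  have "set \<alpha> \<subseteq> A" "set (word_inv \<gamma>) \<subseteq> A"
    using a_alphabet[of u] a_alphabet[of "inv_letter u"] u_letter u u'(1) by (auto simp: \<gamma>')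
  then have "word_inv \<gamma> = \<alpha>"
    using word_val_inj[OF idx, of "word_inv \<gamma>" \<alpha>] eq l by simp
  then have "reduce (a u) = []"
    using u(1) by auto
  then show False
    using a_reduced[OF u_letter] a_nonempty[OF u_letter] by (simp add: reduce_reduced)
qed

abbreviation "Lc k \<equiv> left_cancel 0 (map a V) k"
abbreviation "Rc k \<equiv> right_cancel (map a V) k"

lemma V_letters: "k < length V \<Longrightarrow> V ! k \<in> letters g p"
  using V nth_mem[of k V] by (auto simp: ranked_word_def letters_eq)

lemma corner_nth: "Suc k < length V \<Longrightarrow> corner V (V ! k) (inv_letter (V ! Suc k))"
proof -
  assume k: "Suc k < length V"
  then have "V = take k V @ V ! k # V ! Suc k # drop (Suc (Suc k)) V"
    by (metis Cons_nth_drop_Suc Suc_lessD append_take_drop_id)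
  then show ?thesis
    unfolding corner_def inv_letter_inv_letter by blast
qed

lemma corner_overlap:
  assumes k: "Suc k < length V"
  obtains \<alpha> \<beta> \<gamma> where "a (V ! k) = \<alpha> @ \<gamma>" "a (inv_letter (V ! Suc k)) = \<beta> @ \<gamma>" "length \<gamma> = Rc k"
proof -
  obtain \<alpha> \<gamma> \<delta> where "a (V ! k) = \<alpha> @ \<gamma>" "a (V ! Suc k) = word_inv \<gamma> @ \<delta>"
    "length \<gamma> = cancellation (a (V ! k)) (a (V ! Suc k))"
    using cancellation_split by metis
  then show ?thesis
    using that[of \<alpha> \<gamma> "word_inv \<delta>"] k a_inv[OF V_letters[OF k]] by (simp add: right_cancel_def)
qed

lemma Lc_Suc: "Suc k < length V \<Longrightarrow> Lc (Suc k) = Rc k"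
  by (simp add: left_cancel_def right_cancel_def)

lemma Lc_0: "Lc 0 = 0"
  by (simp add: left_cancel_def)

lemma Rc_half: "k < length V \<Longrightarrow> 2 * Rc k \<le> length (a (V ! k))"
proof (cases "Suc k < length V")
  case True
  obtain \<alpha> \<beta> \<gamma> where "a (V ! k) = \<alpha> @ \<gamma>" "a (inv_letter (V ! Suc k)) = \<beta> @ \<gamma>" "length \<gamma> = Rc k"
    using corner_overlap[OF True] .
  then show ?thesis
    using overlap[OF corner_sym[OF corner_nth[OF True]], of \<beta> \<gamma> \<alpha>] by simp
qed (simp add: right_cancel_def)

lemma Lc_half: "k < length V \<Longrightarrow> 2 * Lc k \<le> length (a (V ! k))"
proof (cases k)
  case (Suc m)
  assume "k < length V"
  then have m: "Suc m < length V"
    by (simp add: Suc)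
  obtain \<alpha> \<beta> \<gamma> where "a (V ! m) = \<alpha> @ \<gamma>" "a (inv_letter (V ! Suc m)) = \<beta> @ \<gamma>" "length \<gamma> = Rc m"
    using corner_overlap[OF m] .
  note split = this
  have "length (a (V ! Suc m)) = length \<beta> + length \<gamma>"
    using arg_cong[OF split(2), of length] a_inv[OF V_letters[OF m]] by simp
  then show ?thesis
    using overlap[OF corner_nth[OF m] split(1,2)] split(3) Lc_Suc[OF m] by (simp add: Suc)
qed (simp add: Lc_0)

text \<open>
  Each side consumes at most half of an image, and not both sides exactly half: at least one letter
  of every factor survives in the product of the images along \<open>V\<close>.
\<close>

lemma survives:
  assumes k: "k < length V"
  shows "Lc k + Rc k < length (a (V ! k))"
proof (rule ccontr)
  assume "\<not> ?thesis"
  then have eq: "2 * Lc k = length (a (V ! k))" "2 * Rc k = length (a (V ! k))"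
    using Lc_half[OF k] Rc_half[OF k] by linarith+
  have "length (a (V ! k)) > 0"
    using a_nonempty[OF V_letters[OF k]] by simp
  then have "Rc k > 0" "Lc k > 0"
    using eq by linarith+
  then have k': "Suc k < length V" and "k \<noteq> 0"
    by (auto simp: right_cancel_def Lc_0 split: if_splits intro!: Nat.gr0I)
  then obtain m where m: "k = Suc m"
    by (cases k) auto
  obtain \<alpha> \<beta> \<gamma> where 1: "a (V ! k) = \<alpha> @ \<gamma>" "a (inv_letter (V ! Suc k)) = \<beta> @ \<gamma>" "length \<gamma> = Rc k"
    using corner_overlap[OF k'] .
  obtain \<alpha>' \<beta>' \<gamma>' where 2: "a (V ! m) = \<alpha>' @ \<gamma>'" "a (inv_letter (V ! k)) = \<beta>' @ \<gamma>'" "length \<gamma>' = Rc m"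
    using corner_overlap[of m] k unfolding m .
  have m': "Suc m < length V"
    using k by (simp add: m)
  have "Rc m = Lc k"
    using Lc_Suc[OF m'] by (simp add: m)
  moreover have "corner V (inv_letter (V ! k)) (V ! m)"
    using corner_sym[OF corner_nth[OF m']] by (simp add: m)
  ultimately show False
    using not_both_halves[OF corner_nth[OF k'] _ 1(1,2) 2(2,1)] 2(3) eq 1(3) by simp
qed

text \<open>
  If the product is not longer than the number of factors, then only one letter of each factor survives.
\<close>

lemma tight:
  assumes short: "length (reduce (concat (map a V))) \<le> length V" and k: "k < length V"
  shows "length (a (V ! k)) = Lc k + Rc k + 1"
proof (rule ccontr)
  assume neq: "length (a (V ! k)) \<noteq> Lc k + Rc k + 1"
  have eq: "length (reduce (concat (map a V))) = (\<Sum>k<length V. length (a (V ! k)) - Lc k - Rc k)"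
  proof -
    have "length (reduce (concat (map a V))) =
      (\<Sum>k<length (map a V). length (map a V ! k) - Lc k - Rc k)"
    proof (rule length_reduce_product)
      show "reduced x" if "x \<in> set (map a V)" for x
      proof -
        obtain l where "l \<in> set V" "x = a l"
          using \<open>x \<in> set (map a V)\<close> by auto
        moreover have "l \<in> letters g p"
          using V_letters \<open>l \<in> set V\<close> by (metis in_set_conv_nth)
        ultimately show ?thesis
          using a_reduced by simp
      qed
    qed (use survives in simp)
    then show ?thesis
      by simp
  qed
  have "(\<Sum>k<length V. 1) < (\<Sum>k<length V. length (a (V ! k)) - Lc k - Rc k)"
  proof (rule sum_strict_mono_ex1)
    show "\<forall>k\<in>{..<length V}. 1 \<le> length (a (V ! k)) - Lc k - Rc k"
    proof
      fix m assume "m \<in> {..<length V}"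
      then show "1 \<le> length (a (V ! m)) - Lc m - Rc m"
        using survives[of m] by auto
    qed
    show "\<exists>k\<in>{..<length V}. 1 < length (a (V ! k)) - Lc k - Rc k"
      using k survives[OF k] neq by (intro bexI[of _ k]) auto
  qed simp
  then show False
    using short eq by simp
qed

text \<open>
  For neighbours in \<open>V\<close>, the same amount cancels at both ends of their edge. If nothing cancels at the end of
  an \<open>x\<close>-letter in one of its two occurrences, then, as one letter of the image survives, at
  most one letter cancels at its start there; \<open>not_both_halves\<close> then excludes cancellation at its end in the
  other occurrence. For a \<open>t\<close>-letter, the image has odd length. As nothing cancels in front of the first
  letter of \<open>V\<close>, induction on the rank shows that nothing cancels at all.
\<close>

lemma no_cancellation:
  assumes short: "length (reduce (concat (map a V))) \<le> length V"
  shows "k < length V \<Longrightarrow> length (a (V ! k)) = 1"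
proof -
  obtain f where f: "ranking p V f" and set_V: "set V = t_letters p \<union> x_letters g"
    using V by (auto simp: ranked_word_def)
  define below where "below u = card {w \<in> letters g p. f w < f u}" for u
  define free_end where "free_end u \<longleftrightarrow>
    (\<forall>k<length V. (V ! k = u \<longrightarrow> Rc k = 0) \<and> (inv_letter (V ! k) = u \<longrightarrow> Lc k = 0))" for u
  have below_less: "below w < below u" if "w \<in> letters g p" "f w < f u" for u w
    unfolding below_def
  proof (rule psubset_card_mono)
    show "finite {w \<in> letters g p. f w < f u}"
      using finite_letters by simp
    show "{v \<in> letters g p. f v < f w} \<subset> {v \<in> letters g p. f v < f u}"
      using that by auto
  qed
  have free: "free_end u" if "u \<in> letters g p" for u
    using that
  proof (induction "below u" arbitrary: u rule: less_induct)
    case less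
    have IH: "free_end w" if "w \<in> letters g p" "f w < f u" for w
      using less.hyps[OF below_less[OF that]] that by blast
    have L: "Lc k = 0" if k: "k < length V" "inv_letter (V ! k) = u" for k
    proof (cases k)
      case (Suc m)
      have "f (V ! m) < f u"
        using f successively_nth[of "\<lambda>l m. f l < f (inv_letter m)" V m] k
        by (simp add: ranking_def Suc)
      then have "free_end (V ! m)"
        using IH V_letters k(1) Suc by simp
      then have "Rc m = 0"
        using k(1) by (simp add: free_end_def Suc)
      then show ?thesis
        using Lc_Suc[of m] k(1) by (simp add: Suc)
    qed (simp add: Lc_0)
    have R: "Rc k = 0" if k: "k < length V" "V ! k = u" for k
    proof (cases "is_t u")
      case True
      have "u \<in> t_letters p"
        using nth_mem[OF k(1)] k(2) set_V True by (auto simp: x_letters_def is_t_def)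
      then have "f (inv_letter u) < f u"
        using f by (auto simp: t_letters_def ranking_def inv_letter_def)
      then have "free_end (inv_letter u)"
        using IH less.prems by simp
      then have "Lc k = 0"
        using k by (simp add: free_end_def)
      then have len: "length (a u) = Rc k + 1" "2 * Rc k \<le> length (a u)"
        using tight[OF short k(1)] Rc_half[OF k(1)] k(2) by auto
      obtain \<omega> s where "a u = word_inv \<omega> @ s # \<omega>"
        using t_image[OF less.prems True] .
      then have "odd (length (a u))"
        by simp
      then show ?thesis
        using len by (cases "Rc k") auto
    next
      case False
      have "inv_letter u \<in> set V"
        using nth_mem[OF k(1)] k(2) set_V v_letter_inv[of u p g] False by simp
      then obtain m where m: "m < length V" "V ! m = inv_letter u"
        by (auto simp: in_set_conv_nth)
      have len_m: "length (a u) = Rc m + 1"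
        using tight[OF short m(1)] L[OF m(1)] m(2) a_inv[OF less.prems] by simp
      have half_m: "2 * Rc m \<le> length (a u)"
        using Rc_half[OF m(1)] m(2) a_inv[OF less.prems] by simp
      have half_k: "2 * Rc k \<le> length (a u)"
        using Rc_half[OF k(1)] k(2) by simp
      show ?thesis
      proof (rule ccontr)
        assume "Rc k \<noteq> 0"
        then have one: "Rc k = 1" "Rc m = 1" "length (a u) = 2"
          using len_m half_m half_k by linarith+
        then have "Suc k < length V" "Suc m < length V"
          by (auto simp: right_cancel_def split: if_splits)
        then show False
          using corner_overlap[of k] corner_overlap[of m]
            not_both_halves[of u "inv_letter (V ! Suc k)" "inv_letter (V ! Suc m)"]
            corner_nth[of k] corner_nth[of m] one k(2) m(2) by (metis mult_2 one_add_one)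
      qed
    qed
    show ?case
      unfolding free_end_def using L R by blast
  qed
  assume k: "k < length V"
  have "Rc k = 0" "Lc k = 0"
    using free[OF V_letters[OF k]] free[of "inv_letter (V ! k)"] V_letters[OF k] k
    by (auto simp: free_end_def)
  then show "length (a (V ! k)) = 1"
    using tight[OF short k] by simp
qed

end

section \<open>Nielsen reduction to letters\<close>

text \<open>
  A reduced conjugator whose first letter is \<open>s\<close> or its inverse can be shortened; otherwise the conjugate is
  already reduced.
\<close>

lemma conjugate_form:
  "\<exists>\<omega>. reduce (word_inv \<eta> @ s # \<eta>) = word_inv \<omega> @ s # \<omega>"
proof (induction "length \<eta>" arbitrary: \<eta> rule: less_induct)
  case less
  show ?case
  proof (cases "reduced \<eta>")
    case False
    then have "\<exists>\<omega>. reduce (word_inv (reduce \<eta>) @ s # reduce \<eta>) = word_inv \<omega> @ s # \<omega>"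
      by (intro less length_reduce_less)
    moreover have "reduce (word_inv (reduce \<eta>) @ s # reduce \<eta>) = reduce (word_inv \<eta> @ s # \<eta>)"
      using reduce_cong[of "word_inv (reduce \<eta>)" "word_inv \<eta>" "s # reduce \<eta>" "s # \<eta>"]
        reduce_append_reduce2[of "[s]" \<eta>]
      by (simp add: reduce_word_inv)
    ultimately show ?thesis
      by simp
  next
    case red: True
    show ?thesis
    proof (cases \<eta>)
      case Nil
      then show ?thesis
        by (intro exI[of _ "[]"]) (simp add: reduce_reduced)
    next
      case (Cons l \<eta>')
      show ?thesis
      proof (cases "l = s \<or> l = inv_letter s")
        case True
        then have "reduce ([inv_letter l, s, l] @ \<eta>') = reduce (s # \<eta>')"
          using reduce_cong[OF refl, of "s # inv_letter s # \<eta>'" \<eta>' "[s]"] by auto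
        then have "reduce (word_inv \<eta> @ s # \<eta>) = reduce (word_inv \<eta>' @ s # \<eta>')"
          using reduce_cong[OF refl, of "[inv_letter l, s, l] @ \<eta>'" "s # \<eta>'" "word_inv \<eta>'"]
          by (simp add: Cons)
        then show ?thesis
          using less[of \<eta>'] by (simp add: Cons)
      next
        case False
        then have "reduced (s # \<eta>)" "hd (s # \<eta>) \<noteq> inv_letter (last (word_inv \<eta>))"
          using red by (auto simp: Cons)
        then have "reduced (word_inv \<eta> @ s # \<eta>)"
          unfolding reduced_append[of "word_inv \<eta>"] reduced_word_inv using red by blast
        then show ?thesis
          by (auto simp: reduce_reduced)
      qed
    qed
  qed
qed

text \<open>
  Some surjective endomorphism of \<open>F\<close> factors through \<open>\<Phi>\<close> as a map of sets. This is the form in which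
  it is used that the image of \<open>F\<close> is isomorphic to \<open>F\<close>; it survives composition with automorphisms
  and shows that \<open>\<Phi>\<close> separates distinct generators up to inversion.
\<close>

definition full_rank :: "nat \<Rightarrow> nat \<Rightarrow> (gen letter list \<Rightarrow> 'b) \<Rightarrow> bool" where
  "full_rank g p \<Phi> \<longleftrightarrow> (\<exists>\<psi> \<in> hom (Fgp g p) (Fgp g p).
     \<psi> ` carrier (Fgp g p) = carrier (Fgp g p) \<and>
     (\<forall>u \<in> carrier (Fgp g p). \<forall>v \<in> carrier (Fgp g p). \<Phi> u = \<Phi> v \<longrightarrow> \<psi> u = \<psi> v))"

lemma full_rank_auto:
  assumes "full_rank g p \<Phi>" and \<alpha>: "\<alpha> \<in> auto (Fgp g p)"
  shows "full_rank g p (\<Phi> \<circ> \<alpha>)"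
proof -
  obtain \<psi> where \<psi>: "\<psi> \<in> hom (Fgp g p) (Fgp g p)" "\<psi> ` carrier (Fgp g p) = carrier (Fgp g p)"
    "\<And>u v. u \<in> carrier (Fgp g p) \<Longrightarrow> v \<in> carrier (Fgp g p) \<Longrightarrow> \<Phi> u = \<Phi> v \<Longrightarrow> \<psi> u = \<psi> v"
    using assms(1) unfolding full_rank_def by blast
  have \<alpha>_img: "\<alpha> ` carrier (Fgp g p) = carrier (Fgp g p)"
    using auto_bij[OF \<alpha>] by (simp add: bij_betw_def)
  have closed: "\<alpha> u \<in> carrier (Fgp g p)" if "u \<in> carrier (Fgp g p)" for u
    using hom_in_carrier[OF auto_hom[OF \<alpha>] that] .
  show ?thesis
    unfolding full_rank_def
  proof (intro bexI[of _ "\<psi> \<circ> \<alpha>"] conjI ballI impI)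
    show "(\<psi> \<circ> \<alpha>) ` carrier (Fgp g p) = carrier (Fgp g p)"
      unfolding image_comp[symmetric] \<alpha>_img \<psi>(2) ..
    show "\<psi> \<circ> \<alpha> \<in> hom (Fgp g p) (Fgp g p)"
      by (rule hom_compose[OF auto_hom[OF \<alpha>] \<psi>(1)])
    show "(\<psi> \<circ> \<alpha>) u = (\<psi> \<circ> \<alpha>) v"
      if "u \<in> carrier (Fgp g p)" "v \<in> carrier (Fgp g p)" "(\<Phi> \<circ> \<alpha>) u = (\<Phi> \<circ> \<alpha>) v" for u v
      using \<psi>(3)[OF closed[OF that(1)] closed[OF that(2)]] that(3) by simp
  qed
qed

lemma finite_gens: "finite (gens g p)"
  by (simp add: gens_def)

lemma full_rank_letters:
  assumes "full_rank g p \<Phi>" and l: "l \<in> letters g p"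
  shows "\<Phi> [l] \<noteq> \<Phi> []" and "m \<in> letters g p \<Longrightarrow> fst l \<noteq> fst m \<Longrightarrow> \<Phi> [l] \<noteq> \<Phi> [m]"
proof -
  obtain \<psi> where \<psi>: "\<psi> \<in> hom (Fgp g p) (Fgp g p)" "\<psi> ` carrier (Fgp g p) = carrier (Fgp g p)"
    "\<And>u v. u \<in> carrier (Fgp g p) \<Longrightarrow> v \<in> carrier (Fgp g p) \<Longrightarrow> \<Phi> u = \<Phi> v \<Longrightarrow> \<psi> u = \<psi> v"
    using assms(1) unfolding full_rank_def by blast
  note indep = surj_endo_basis_independent[OF finite_gens \<psi>(1,2)[unfolded Fgp_def]]
  have l': "fst l \<in> gens g p" "[l] \<in> carrier (Fgp g p)"
    using l by (auto simp: letters_iff letter_in_Fgp)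
  have one: "[] \<in> carrier (Fgp g p)" "\<psi> [] = []"
    using hom_one[OF \<psi>(1) group_Fgp group_Fgp] by (simp_all add: Fgp_def carrier_free_group)
  have "\<psi> [l] \<noteq> []"
    using indep(1)[OF l'(1), of "snd l"] by simp
  then show "\<Phi> [l] \<noteq> \<Phi> []"
    using \<psi>(3)[OF l'(2) one(1)] one(2) by metis
  show "\<Phi> [l] \<noteq> \<Phi> [m]" if m: "m \<in> letters g p" "fst l \<noteq> fst m"
  proof -
    have "\<psi> [l] \<noteq> \<psi> [m]"
      using indep(2)[OF l'(1) _ m(2), of "snd l" "snd m"] m(1) by (simp add: letters_iff)
    moreover have "[m] \<in> carrier (Fgp g p)"
      using m(1) by (simp add: letter_in_Fgp)
    ultimately show ?thesis
      using \<psi>(3)[OF l'(2)] by metis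
  qed
qed

lemma ranked_word_letter:
  assumes "ranked_word g p V" "l \<in> letters g p"
  shows "l \<in> set V \<or> inv_letter l \<in> set V"
proof -
  have "l \<in> t_letters p \<union> x_letters g \<or> l \<in> inv_letter ` t_letters p"
    using assms(2) by (simp add: letters_eq) blast
  moreover have "inv_letter l \<in> t_letters p" if "l \<in> inv_letter ` t_letters p"
    using that by (elim imageE) simp
  ultimately show ?thesis
    using assms(1) unfolding ranked_word_def by blast
qed

text \<open>
  Among all edges of the Nielsen subgroupoid that end in \<open>V\<close>, choose one for which the images of the
  letters have the least complexity. A corner of its source at which a twist lowers the complexity
  would lead to a better edge, so the images are minimal and \<open>no_cancellation\<close> applies. Twists preserve the
  conjugacy class of the image of each \<open>t\<close>-letter.
\<close>

lemma nielsen_reduction: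
  fixes \<Phi> :: "gen letter list \<Rightarrow> 'b letter list"
  assumes V: "ranked_word g p V"
    and \<Phi>: "\<Phi> \<in> hom (Fgp g p) (free_group UNIV)"
    and conj: "\<And>j. j \<in> {1..p} \<Longrightarrow>
      \<exists>\<eta>. \<Phi> [(Tgen j, True)] = reduce (word_inv \<eta> @ (c j, True) # \<eta>)"
    and short: "length (\<Phi> V) \<le> length V"
    and rank: "full_rank g p \<Phi>"
  shows "\<exists>V' \<alpha>. ranked_word g p V' \<and> (V', V, \<alpha>) \<in> nielsen_subgroupoid g p \<and>
    \<alpha> \<in> auto (Fgp g p) \<and> \<alpha> V' = V \<and>
    (\<forall>l \<in> letters g p. length (\<Phi> (\<alpha> [l])) = 1) \<and>
    (\<forall>j \<in> {1..p}. \<Phi> (\<alpha> [(Tgen j, True)]) = [(c j, True)])"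
proof -
  let ?F = "Fgp g p" and ?L = "letters g p"
  \<comment> \<open>All images that occur are spelled in the finite alphabet A, whose letters are numbered by idx.\<close>
  define A where "A = (\<Union>l\<in>?L. set (\<Phi> [l]))"
  have "finite A"
    using finite_letters by (simp add: A_def)
  from finite_imp_inj_to_nat_seg[OF this] obtain idx :: "'b letter \<Rightarrow> nat" and M
    where "idx ` A = {i. i < M}" and idx: "inj_on idx A"
    by (elim exE conjE) (rule that)
  then have idx_bound: "idx ` A \<subseteq> {..<M}"
    by auto
  define state where "state V' \<alpha> \<longleftrightarrow> ranked_word g p V' \<and> (V', V, \<alpha>) \<in> nielsen_subgroupoid g p \<and>
    \<alpha> \<in> auto ?F \<and> \<alpha> V' = V \<and> (\<forall>l \<in> ?L. set (\<Phi> (\<alpha> [l])) \<subseteq> A) \<and>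
    (\<forall>j \<in> {1..p}. \<exists>\<eta>. \<Phi> (\<alpha> [(Tgen j, True)]) = reduce (word_inv \<eta> @ (c j, True) # \<eta>))" for V' \<alpha>
  define image where "image \<alpha> l = \<Phi> (\<alpha> [l])" for \<alpha> :: "gen letter list \<Rightarrow> gen letter list" and l
  define meas where "meas = (\<lambda>(V' :: gen letter list, \<alpha>).
    (total_length g p (image \<alpha>), total_value idx M g p (image \<alpha>)))"
  have t_letter: "(Tgen j, True) \<in> ?L" if "j \<in> {1..p}" for j
    using t_letter_in_Fgp[OF that] by (simp add: letter_in_Fgp)
  have image_hom: "\<Phi> \<circ> \<alpha> \<in> hom ?F (free_group UNIV)" if "\<alpha> \<in> auto ?F" for \<alpha>
    by (rule hom_compose[OF auto_hom[OF that] \<Phi>])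
  have image_inv: "image \<alpha> (inv_letter l) = word_inv (image \<alpha> l)"
    and image_reduced: "reduced (image \<alpha> l)" if "\<alpha> \<in> auto ?F" "l \<in> ?L" for \<alpha> l
  proof -
    have l: "[l] \<in> carrier (free_group (gens g p))"
      using that(2) by (simp add: letter_in_free_group letters_iff)
    note h = image_hom[OF that(1), unfolded Fgp_def]
    show "image \<alpha> (inv_letter l) = word_inv (image \<alpha> l)"
      using hom_free_group_inv[OF h l] by (simp add: image_def)
    show "reduced (image \<alpha> l)"
      using hom_in_carrier[OF h l] by (simp add: image_def carrier_free_group)
  qed
  have image_word: "\<Phi> (\<alpha> w) = letter_hom (image \<alpha>) w"
    if "\<alpha> \<in> auto ?F" "w \<in> carrier ?F" for \<alpha> w
    using hom_free_group_letter_hom[OF image_hom[OF that(1), unfolded Fgp_def] that(2)[unfolded Fgp_def]]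
    by (simp add: image_def[abs_def])
  have "state V \<one>\<^bsub>AutoGroup ?F\<^esub>"
    unfolding state_def
  proof (intro conjI ballI)
    have one: "\<one>\<^bsub>AutoGroup ?F\<^esub> w = w" if "w \<in> carrier ?F" for w
      using that by (simp add: AutoGroup_one)
    show "(V, V, \<one>\<^bsub>AutoGroup ?F\<^esub>) \<in> nielsen_subgroupoid g p"
      using V by (intro nielsen_subgroupoid.ident) (simp add: zieschang_elements_iff)
    show "\<one>\<^bsub>AutoGroup ?F\<^esub> \<in> auto ?F"
      using group.id_in_auto[OF group_Fgp] by (simp add: AutoGroup_one)
    show "\<one>\<^bsub>AutoGroup ?F\<^esub> V = V"
      by (rule one[OF ranked_word_carrier[OF V]])
    show "set (\<Phi> (\<one>\<^bsub>AutoGroup ?F\<^esub> [l])) \<subseteq> A" if "l \<in> ?L" for l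
      using that by (auto simp: one letter_in_Fgp A_def)
    show "\<exists>\<eta>. \<Phi> (\<one>\<^bsub>AutoGroup ?F\<^esub> [(Tgen j, True)]) = reduce (word_inv \<eta> @ (c j, True) # \<eta>)"
      if "j \<in> {1..p}" for j
      using conj[OF that] by (simp add: one t_letter_in_Fgp[OF that])
  qed (rule V)
  then have start: "(V, \<one>\<^bsub>AutoGroup ?F\<^esub>) \<in> {s. state (fst s) (snd s)}"
    by simp
  obtain s where s: "s \<in> {s. state (fst s) (snd s)}"
    and s_min: "\<And>s'. (s', s) \<in> inv_image (less_than <*lex*> less_than) meas \<Longrightarrow>
      s' \<notin> {s. state (fst s) (snd s)}"
    by (rule wfE_min[OF wf_inv_image[OF wf_lex_prod[OF wf_less_than wf_less_than]] start]) (rule that)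
  obtain V' \<alpha> where s_eq: "s = (V', \<alpha>)"
    by (cases s)
  have st: "state V' \<alpha>"
    using s by (simp add: s_eq)
  have min: "total_length g p (image \<alpha>) \<le> total_length g p (image \<alpha>')"
    "total_length g p (image \<alpha>') = total_length g p (image \<alpha>) \<Longrightarrow>
      total_value idx M g p (image \<alpha>) \<le> total_value idx M g p (image \<alpha>')"
    if "state V'' \<alpha>'" for V'' \<alpha>'
  proof -
    have "\<not> (total_length g p (image \<alpha>') < total_length g p (image \<alpha>) \<or>
        total_length g p (image \<alpha>') = total_length g p (image \<alpha>) \<and>
        total_value idx M g p (image \<alpha>') < total_value idx M g p (image \<alpha>))"
      using s_min[of "(V'', \<alpha>')"] that by (auto simp: s_eq meas_def)
    then show "total_length g p (image \<alpha>) \<le> total_length g p (image \<alpha>')"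
      "total_length g p (image \<alpha>') = total_length g p (image \<alpha>) \<Longrightarrow>
        total_value idx M g p (image \<alpha>) \<le> total_value idx M g p (image \<alpha>')"
      by linarith+
  qed
  have V': "ranked_word g p V'" and \<alpha>_edge: "(V', V, \<alpha>) \<in> nielsen_subgroupoid g p"
    and \<alpha>: "\<alpha> \<in> auto ?F" and \<alpha>V: "\<alpha> V' = V"
    and alphabet: "\<And>l. l \<in> ?L \<Longrightarrow> set (image \<alpha> l) \<subseteq> A"
    and t_conj: "\<And>j. j \<in> {1..p} \<Longrightarrow>
      \<exists>\<eta>. image \<alpha> (Tgen j, True) = reduce (word_inv \<eta> @ (c j, True) # \<eta>)"
    using st by (auto simp: state_def image_def)
  have move: "\<exists>V'' \<alpha>'. state V'' \<alpha>' \<and> (\<forall>l \<in> ?L. image \<alpha>' l = twisted (image \<alpha>) u w l)"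
    if corner: "corner V' u w" for u w
  proof -
    note uw = corner_letters[OF V' corner]
    define \<nu> where "\<nu> = restrict (letter_hom (twist u w)) (carrier ?F)"
    have \<nu>: "\<nu> \<in> auto ?F"
      unfolding \<nu>_def by (rule twist_auto(1)[OF uw(1-4)])
    obtain V'' where V'': "ranked_word g p V''" "letter_hom (twist u w) V'' = V'"
      "(V'', V', \<nu>) \<in> nielsen_subgroupoid g p"
      using twist_subgroupoid[OF V' corner] unfolding \<nu>_def by blast
    define \<alpha>' where "\<alpha>' = \<alpha> \<otimes>\<^bsub>AutoGroup ?F\<^esub> \<nu>"
    have \<alpha>'_eq: "\<alpha>' v = \<alpha> (\<nu> v)" if "v \<in> carrier ?F" for v
      using that by (simp add: \<alpha>'_def AutoGroup_mult[OF \<alpha> \<nu>] compose_def)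
    have img: "image \<alpha>' l = twisted (image \<alpha>) u w l" if l: "l \<in> ?L" for l
    proof -
      have tw_letters: "set (twist u w l) \<subseteq> ?L"
        using l uw by (auto simp: twist_def)
      have "\<nu> [l] = reduce (twist u w l)"
        using l by (simp add: \<nu>_def letter_in_Fgp)
      moreover have "reduce (twist u w l) \<in> carrier ?F"
        using set_reduce[of "twist u w l"] tw_letters by (simp add: carrier_Fgp subset_trans)
      ultimately have "image \<alpha>' l = letter_hom (image \<alpha>) (reduce (twist u w l))"
        using l image_word[OF \<alpha>] by (simp add: image_def \<alpha>'_eq letter_in_Fgp)
      also have "\<dots> = letter_hom (image \<alpha>) (twist u w l)"
      proof (rule letter_hom_reduce)
        fix m assume "m \<in> set (twist u w l)"
        then have "m \<in> ?L"
          using tw_letters by blast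
        then show "reduce (image \<alpha> m @ image \<alpha> (inv_letter m)) = []"
          by (simp add: image_inv[OF \<alpha>])
      qed
      finally show ?thesis
        by (simp add: twisted_def)
    qed
    have "state V'' \<alpha>'"
      unfolding state_def
    proof (intro conjI ballI)
      show "(V'', V, \<alpha>') \<in> nielsen_subgroupoid g p"
        unfolding \<alpha>'_def by (rule nielsen_subgroupoid.comp[OF V''(3) \<alpha>_edge])
      show "\<alpha>' \<in> auto ?F"
        using monoid.m_closed[OF group.is_monoid[OF group.AutoGroup[OF group_Fgp]]] \<alpha> \<nu>
        unfolding \<alpha>'_def by simp
      show "\<alpha>' V'' = V"
        using ranked_word_carrier[OF V''(1)] V''(2) by (simp add: \<alpha>'_eq \<nu>_def \<alpha>V)
      show "set (\<Phi> (\<alpha>' [l])) \<subseteq> A" if l: "l \<in> ?L" for l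
      proof -
        have "set (twisted (image \<alpha>) u w l) \<subseteq> set (concat (map (image \<alpha>) (twist u w l)))"
          unfolding twisted_def letter_hom_def by (rule set_reduce)
        also have "\<dots> \<subseteq> A"
        proof -
          have "set (twist u w l) \<subseteq> ?L"
            using l uw by (auto simp: twist_def)
          then show ?thesis
            using alphabet by fastforce
        qed
        finally show ?thesis
          using img[OF l] by (simp add: image_def)
      qed
      show "\<exists>\<eta>. \<Phi> (\<alpha>' [(Tgen j, True)]) = reduce (word_inv \<eta> @ (c j, True) # \<eta>)"
        if j: "j \<in> {1..p}" for j
      proof -
        let ?t = "(Tgen j, True)"
        obtain \<eta> where \<eta>: "image \<alpha> ?t = reduce (word_inv \<eta> @ (c j, True) # \<eta>)"
          using t_conj[OF j] by blast
        show ?thesis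
        proof (cases "?t = u \<or> ?t = inv_letter u")
          case True
          moreover have "is_t ?t"
            by (simp add: is_t_def)
          ultimately have "is_t u"
            by (metis is_t_inv_letter)
          with True have "twist u w ?t = [w, ?t, inv_letter w]"
            by (auto simp: twist_def)
          then have "image \<alpha>' ?t = reduce (image \<alpha> w @ image \<alpha> ?t @ word_inv (image \<alpha> w))"
            using img[OF t_letter[OF j]] image_inv[OF \<alpha> uw(2)]
            by (simp add: twisted_def letter_hom_def)
          also have "\<dots> = reduce (image \<alpha> w @ (word_inv \<eta> @ (c j, True) # \<eta>) @ word_inv (image \<alpha> w))"
            unfolding \<eta> by (intro reduce_cong refl) simp
          also have "\<dots> = reduce (word_inv (\<eta> @ word_inv (image \<alpha> w)) @ (c j, True) # (\<eta> @ word_inv (image \<alpha> w)))"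
            by simp
          finally show ?thesis
            unfolding image_def by blast
        next
          case False
          then have "twist u w ?t = [?t]"
            by (auto simp: twist_def)
          then have "image \<alpha>' ?t = image \<alpha> ?t"
            using img[OF t_letter[OF j]] image_reduced[OF \<alpha> t_letter[OF j]]
            by (simp add: twisted_def reduce_reduced)
          then show ?thesis
            using \<eta> unfolding image_def by metis
        qed
      qed
    qed (rule V''(1))
    with img show ?thesis
      by blast
  qed
  have rank': "full_rank g p (\<Phi> \<circ> \<alpha>)"
    by (rule full_rank_auto[OF rank \<alpha>])
  have empty: "\<Phi> (\<alpha> []) = []"
    using hom_one[OF image_hom[OF \<alpha>] group_Fgp group_free_group] by (simp add: Fgp_def)
  have t_form: "\<exists>\<omega>. image \<alpha> (Tgen j, True) = word_inv \<omega> @ (c j, True) # \<omega>" if j: "j \<in> {1..p}" for j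
    using t_conj[OF j] conjugate_form by metis
  interpret minimal_images g p V' "image \<alpha>" idx M A
  proof
    show "image \<alpha> l \<noteq> []" if "l \<in> ?L" for l
      using full_rank_letters(1)[OF rank' that] empty by (simp add: image_def)
    show "\<exists>\<omega> x. image \<alpha> (Tgen j, True) = word_inv \<omega> @ (x, True) # \<omega>" if "j \<in> {1..p}" for j
      using t_form[OF that] by blast
    fix u w assume "corner V' u w"
    then obtain V'' \<alpha>' where st': "state V'' \<alpha>'"
      and eq: "\<And>l. l \<in> ?L \<Longrightarrow> image \<alpha>' l = twisted (image \<alpha>) u w l"
      using move by blast
    have eqs: "total_length g p (image \<alpha>') = total_length g p (twisted (image \<alpha>) u w)"
      "total_value idx M g p (image \<alpha>') = total_value idx M g p (twisted (image \<alpha>) u w)"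
      unfolding total_length_def total_value_def by (intro sum.cong refl, simp add: eq)+
    show "total_length g p (image \<alpha>) \<le> total_length g p (twisted (image \<alpha>) u w)"
      using min(1)[OF st'] eqs by simp
    show "total_value idx M g p (image \<alpha>) \<le> total_value idx M g p (twisted (image \<alpha>) u w)"
      if "total_length g p (twisted (image \<alpha>) u w) = total_length g p (image \<alpha>)"
      using min(2)[OF st'] eqs that by simp
  qed (use V' image_reduced[OF \<alpha>] image_inv[OF \<alpha>] alphabet idx idx_bound in auto)
  have "reduce (concat (map (image \<alpha>) V')) = \<Phi> V"
    using image_word[OF \<alpha> ranked_word_carrier[OF V']] \<alpha>V by (simp add: letter_hom_def)
  then have "length (reduce (concat (map (image \<alpha>) V'))) \<le> length V'"
    using short length_ranked_word[OF assms(1)] length_ranked_word[OF V'] by simp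
  note one = no_cancellation[OF this]
  have len: "length (image \<alpha> l) = 1" if l: "l \<in> ?L" for l
  proof -
    have "l \<in> set V' \<or> inv_letter l \<in> set V'"
      by (rule ranked_word_letter[OF V' l])
    then show ?thesis
    proof
      assume "l \<in> set V'"
      then show ?thesis
        using one by (metis in_set_conv_nth)
    next
      assume "inv_letter l \<in> set V'"
      then have "length (image \<alpha> (inv_letter l)) = 1"
        using one by (metis in_set_conv_nth)
      then show ?thesis
        by (simp add: image_inv[OF \<alpha> l])
    qed
  qed
  have "image \<alpha> (Tgen j, True) = [(c j, True)]" if j: "j \<in> {1..p}" for j
  proof -
    obtain \<omega> where \<omega>: "image \<alpha> (Tgen j, True) = word_inv \<omega> @ (c j, True) # \<omega>"
      using t_form[OF j] by blast
    then have "\<omega> = []"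
      using len[OF t_letter[OF j]] by simp
    then show ?thesis
      using \<omega> by simp
  qed
  then show ?thesis
    using V' \<alpha>_edge \<alpha> \<alpha>V len unfolding image_def by blast
qed

section \<open>Endomorphisms that send a Zieschang element to a short element\<close>

theorem theorem2p6:
  fixes g p :: nat
    and H :: "('h, 'm) monoid_scheme"
    and V W :: "gen letter list"
    and \<phi> :: "('h + gen letter list) list \<Rightarrow> ('h + gen letter list) list"
  defines "F \<equiv> Fgp g p"
  defines "P \<equiv> free_product H F"
  defines "\<iota> \<equiv> fp_inr F"
  assumes "V \<in> carrier F" and "W \<in> carrier F"
    and "is_free_group H"
    and "\<phi> \<in> hom P P"
    and a: "V \<in> zieschang_elements g p"
    and b: "length W \<le> 4 * g + p"
    and c: "\<phi> (\<iota> V) = \<iota> W"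
    and d: "\<exists>\<pi>. \<pi> permutes {1..p} \<and>
              (\<forall>j \<in> {1..p}. \<phi> (\<iota> [(Tgen j, True)]) \<in> conj_class P (\<iota> [(Tgen (\<pi> j), True)]))"
    and e: "P\<lparr>carrier := \<phi> ` \<iota> ` carrier F\<rparr> \<cong> F"
  shows "W \<in> zieschang_elements g p \<and>
         (\<exists>\<phi>'. (V, W, \<phi>') \<in> nielsen_subgroupoid g p \<and>
               (\<forall>u \<in> carrier F. \<phi> (\<iota> u) = \<iota> (\<phi>' u)))"
proof -
  let ?L = "letters g p"
  obtain B where H: "group H" and B: "word_value H \<in> iso (free_group B) H"
    using \<open>is_free_group H\<close> by (auto simp: is_free_group_def)
  interpret FF: free_factor H B "gens g p"
    by (rule free_factor.intro[OF H B])
  have F_eq: "F = free_group (gens g p)"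
    by (simp add: F_def Fgp_def)
  have P_eq: "P = free_product H (free_group (gens g p))"
    by (simp add: P_def F_eq)
  have group_P: "group P"
    unfolding P_eq by (rule FF.group_P)
  have group_F: "group F"
    unfolding F_eq by (rule group_free_group)
  have \<iota>: "\<iota> \<in> hom F P"
    unfolding \<iota>_def P_eq F_eq by (rule FF.fp_inr_hom)
  have \<Theta>: "FF.\<Theta> \<in> hom P (free_group UNIV)"
    unfolding P_eq by (rule FF.Theta_hom)
  have \<Theta>_inj: "inj_on FF.\<Theta> (carrier P)"
    unfolding P_eq by (rule FF.Theta_inj_on)
  define emb :: "gen letter \<Rightarrow> ('h + gen) letter" where "emb = map_prod Inr id"
  have \<Theta>\<iota>: "FF.\<Theta> (\<iota> u) = map emb u" for u
    unfolding \<iota>_def F_eq emb_def by (rule FF.Theta_fp_inr)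
  have emb_inj: "emb l = emb m \<longleftrightarrow> l = m" for l m
    by (cases l; cases m) (simp add: emb_def)
  have emb_inv: "emb (inv_letter l) = inv_letter (emb l)" for l
    by (cases l) (simp add: emb_def inv_letter_def)
  define \<Phi> where "\<Phi> u = FF.\<Theta> (\<phi> (\<iota> u))" for u
  have \<phi>\<iota>: "\<phi> \<circ> \<iota> \<in> hom F P"
    by (rule hom_compose[OF \<iota> \<open>\<phi> \<in> hom P P\<close>])
  have \<Phi>: "\<Phi> \<in> hom F (free_group UNIV)"
    using hom_compose[OF \<phi>\<iota> \<Theta>] by (simp add: \<Phi>_def[abs_def] o_def)
  have V: "ranked_word g p V"
    using a by (simp add: zieschang_elements_iff)
  have \<Phi>V: "\<Phi> V = map emb W"
    by (simp add: \<Phi>_def c \<Theta>\<iota>)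
  obtain \<pi> where \<pi>: "\<pi> permutes {1..p}"
    and conj: "\<And>j. j \<in> {1..p} \<Longrightarrow> \<phi> (\<iota> [(Tgen j, True)]) \<in> conj_class P (\<iota> [(Tgen (\<pi> j), True)])"
    using d by blast
  have \<pi>_in: "\<pi> j \<in> {1..p}" if "j \<in> {1..p}" for j
    using permutes_in_image[OF \<pi>] that by blast
  have conj': "\<exists>\<eta>. \<Phi> [(Tgen j, True)] = reduce (word_inv \<eta> @ (Inr (Tgen (\<pi> j)), True) # \<eta>)"
    if j: "j \<in> {1..p}" for j
  proof -
    obtain h where h: "h \<in> carrier P"
      and eq: "\<phi> (\<iota> [(Tgen j, True)]) = inv\<^bsub>P\<^esub> h \<otimes>\<^bsub>P\<^esub> \<iota> [(Tgen (\<pi> j), True)] \<otimes>\<^bsub>P\<^esub> h"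
      using conj[OF j] by (auto simp: conj_class_def)
    interpret Th: group_hom P "free_group UNIV" FF.\<Theta>
      by (intro group_hom.intro group_hom_axioms.intro group_P group_free_group \<Theta>)
    have t: "\<iota> [(Tgen (\<pi> j), True)] \<in> carrier P"
      using hom_in_carrier[OF \<iota>] t_letter_in_Fgp[OF \<pi>_in[OF j], of g] by (simp add: F_def)
    have "\<Phi> [(Tgen j, True)] = reduce (reduce (word_inv (FF.\<Theta> h) @ [(Inr (Tgen (\<pi> j)), True)]) @ FF.\<Theta> h)"
      unfolding \<Phi>_def eq using h t
      by (simp add: inv_free_group hom_in_carrier[OF \<Theta>] \<Theta>\<iota> emb_def)
    then show ?thesis
      by auto
  qed
  have rank: "full_rank g p \<Phi>"
  proof -
    let ?K = "P\<lparr>carrier := \<phi> ` \<iota> ` carrier F\<rparr>"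
    obtain \<theta> where \<theta>: "\<theta> \<in> hom ?K F" "bij_betw \<theta> (carrier ?K) (carrier F)"
      using e by (auto simp: is_iso_def iso_def)
    have "\<phi> \<circ> \<iota> \<in> hom F ?K"
      using \<phi>\<iota> by (auto simp: hom_def)
    then have "\<theta> \<circ> (\<phi> \<circ> \<iota>) \<in> hom F F"
      by (rule hom_compose[OF _ \<theta>(1)])
    moreover have "(\<theta> \<circ> (\<phi> \<circ> \<iota>)) ` carrier F = carrier F"
      using \<theta>(2) by (simp add: bij_betw_def image_comp)
    moreover have "(\<theta> \<circ> (\<phi> \<circ> \<iota>)) u = (\<theta> \<circ> (\<phi> \<circ> \<iota>)) v"
      if "u \<in> carrier F" "v \<in> carrier F" "\<Phi> u = \<Phi> v" for u v
    proof -
      have "\<phi> (\<iota> u) = \<phi> (\<iota> v)"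
        using inj_onD[OF \<Theta>_inj, of "\<phi> (\<iota> u)" "\<phi> (\<iota> v)"] that hom_in_carrier[OF \<phi>\<iota>]
        by (simp add: \<Phi>_def)
      then show ?thesis
        by simp
    qed
    ultimately show ?thesis
      unfolding full_rank_def F_def[symmetric] by blast
  qed
  have short: "length (\<Phi> V) \<le> length V"
    using b length_ranked_word[OF V] by (simp add: \<Phi>V)
  obtain V' \<alpha> where V': "ranked_word g p V'" and \<alpha>_edge: "(V', V, \<alpha>) \<in> nielsen_subgroupoid g p"
    and \<alpha>: "\<alpha> \<in> auto F" and \<alpha>V: "\<alpha> V' = V"
    and len: "\<And>l. l \<in> ?L \<Longrightarrow> length (\<Phi> (\<alpha> [l])) = 1"
    and t: "\<And>j. j \<in> {1..p} \<Longrightarrow> \<Phi> (\<alpha> [(Tgen j, True)]) = [(Inr (Tgen (\<pi> j)), True)]"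
    using nielsen_reduction[OF V \<Phi>[unfolded F_def], where c = "\<lambda>j. Inr (Tgen (\<pi> j))"] conj' short rank
    unfolding F_def by blast
  \<comment> \<open>After composition with alpha the letters are sent to letters, namely s l.\<close>
  define s where "s l = hd (\<Phi> (\<alpha> [l]))" for l
  have s: "\<Phi> (\<alpha> [l]) = [s l]" if "l \<in> ?L" for l
    using len[OF that] by (cases "\<Phi> (\<alpha> [l])") (auto simp: s_def)
  have hom: "\<Phi> \<circ> \<alpha> \<in> hom F (free_group UNIV)"
    by (rule hom_compose[OF auto_hom[OF \<alpha>] \<Phi>])
  have word: "\<Phi> (\<alpha> w) = reduce (map s w)" if w: "w \<in> carrier F" for w
  proof -
    have "\<Phi> (\<alpha> w) = letter_hom (\<lambda>l. \<Phi> (\<alpha> [l])) w"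
      using hom_free_group_letter_hom[OF hom[unfolded F_eq] w[unfolded F_eq]] by simp
    moreover have "set w \<subseteq> ?L"
      using w by (simp add: F_def carrier_Fgp)
    then have "concat (map (\<lambda>l. \<Phi> (\<alpha> [l])) w) = map s w"
      by (induction w) (auto simp: s)
    ultimately show ?thesis
      by (simp add: letter_hom_def)
  qed
  have s_inv: "s (inv_letter l) = inv_letter (s l)" if l: "l \<in> ?L" for l
  proof -
    have "[l] \<in> carrier (free_group (gens g p))"
      using l by (simp add: letter_in_free_group letters_iff)
    then show ?thesis
      using hom_free_group_inv[OF hom[unfolded F_eq], of "[l]"] s[OF l] s[of "inv_letter l"] l by simp
  qed
  have rank': "full_rank g p (\<Phi> \<circ> \<alpha>)"
    using full_rank_auto[OF rank] \<alpha> by (simp add: F_def)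
  have s_inj: "l = m" if l: "l \<in> ?L" and m: "m \<in> ?L" and eq: "s l = s m" for l m
  proof -
    have "fst l = fst m"
      using full_rank_letters(2)[OF rank' l m] s[OF l] s[OF m] eq by auto
    then have "m = l \<or> m = inv_letter l"
      by (cases l; cases m) (auto simp: inv_letter_def)
    then show ?thesis
      using s_inv[OF l] eq by auto
  qed
  have V'_letters: "set V' \<subseteq> ?L"
    using ranked_word_carrier[OF V'] by (simp add: carrier_Fgp)
  have "successively (\<lambda>l m. s m \<noteq> inv_letter (s l)) V' \<longleftrightarrow> successively (\<lambda>l m. m \<noteq> inv_letter l) V'"
  proof (intro successively_cong refl)
    fix l m assume "l \<in> set V'" "m \<in> set V'"
    then have "l \<in> ?L" "m \<in> ?L"
      using V'_letters by auto
    then show "s m \<noteq> inv_letter (s l) \<longleftrightarrow> m \<noteq> inv_letter l"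
      using s_inj[of m "inv_letter l"] s_inv[of l] by auto
  qed
  then have "reduced (map s V')"
    using ranked_word_reduced[OF V'] by (simp add: reduced_def successively_map)
  then have sV': "map s V' = map emb W"
    using word[of V'] ranked_word_carrier[OF V'] by (simp add: F_def \<alpha>V \<Phi>V reduce_reduced)
  have W_letters: "set W \<subseteq> ?L"
    using \<open>W \<in> carrier F\<close> by (simp add: F_def carrier_Fgp)
  have "\<exists>m\<in>?L. s l = emb m" if l: "l \<in> ?L" for l
  proof -
    have *: "\<exists>m\<in>?L. s k = emb m" if "k \<in> set V'" for k
    proof -
      have "s k \<in> set (map emb W)"
        using that unfolding sV'[symmetric] by simp
      then obtain m where "s k = emb m" "m \<in> set W"
        unfolding set_map by (rule imageE)
      then show ?thesis
        using W_letters by (intro bexI[of _ m]) auto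
    qed
    have "l \<in> set V' \<or> inv_letter l \<in> set V'"
      by (rule ranked_word_letter[OF V' l])
    then show ?thesis
    proof
      assume "inv_letter l \<in> set V'"
      then obtain m where m: "m \<in> ?L" "s (inv_letter l) = emb m"
        using * by blast
      then have "s l = emb (inv_letter m)"
        using s_inv[OF l] by (simp add: emb_inv flip: m(2))
      then show ?thesis
        using m(1) by (intro bexI[of _ "inv_letter m"]) simp_all
    qed (rule *)
  qed
  then obtain \<sigma> where \<sigma>: "\<And>l. l \<in> ?L \<Longrightarrow> \<sigma> l \<in> ?L \<and> s l = emb (\<sigma> l)"
    by metis
  have \<sigma>_inv: "\<sigma> (inv_letter l) = inv_letter (\<sigma> l)" if "l \<in> ?L" for l
    using s_inv[OF that] \<sigma>[OF that] \<sigma>[of "inv_letter l"] that by (simp add: emb_inj flip: emb_inv)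
  have \<sigma>_inj: "inj_on \<sigma> ?L"
    using s_inj \<sigma> by (intro inj_onI) metis
  have \<sigma>_t: "\<sigma> ` t_letters p \<subseteq> t_letters p"
  proof
    fix x assume "x \<in> \<sigma> ` t_letters p"
    then obtain j where j: "j \<in> {1..p}" and x: "x = \<sigma> (Tgen j, True)"
      by (auto simp: t_letters_def)
    have jL: "(Tgen j, True) \<in> ?L"
      using t_letter_in_Fgp[OF j] by (simp add: letter_in_Fgp)
    have "emb x = emb (Tgen (\<pi> j), True)"
      using s[OF jL] t[OF j] \<sigma>[OF jL] by (simp add: x emb_def)
    then show "x \<in> t_letters p"
      using \<pi>_in[OF j] by (simp add: emb_inj t_letters_def)
  qed
  define \<mu> where "\<mu> = restrict (letter_hom (\<lambda>l. [\<sigma> l])) (carrier F)"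
  have s_eq: "map s w = map emb (map \<sigma> w)" if "set w \<subseteq> ?L" for w
    using that \<sigma> by auto
  have "map emb (map \<sigma> V') = map emb W"
    using s_eq[OF V'_letters] sV' by simp
  then have \<sigma>V': "map \<sigma> V' = W"
    by (metis emb_inj injI inj_map_eq_map)
  have \<mu>_edge: "ranked_word g p W" "(V', W, \<mu>) \<in> nielsen_edges g p"
    using permutation_nielsen_edge[OF V' \<sigma>_inv \<sigma>_inj _ \<sigma>_t] \<sigma>
    unfolding \<sigma>V' F_def[symmetric] \<mu>_def[symmetric] by blast+
  define \<phi>' where "\<phi>' = \<mu> \<otimes>\<^bsub>AutoGroup F\<^esub> inv\<^bsub>AutoGroup F\<^esub> \<alpha>"
  have edge: "(V, W, \<phi>') \<in> nielsen_subgroupoid g p"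
    unfolding \<phi>'_def F_def
    by (rule nielsen_subgroupoid.comp[OF nielsen_subgroupoid.inverse[OF \<alpha>_edge]
          nielsen_subgroupoid.edge[OF \<mu>_edge(2)]])
  have Aut: "group (AutoGroup F)"
    by (rule group.AutoGroup[OF group_F])
  have \<mu>: "\<mu> \<in> auto F"
    using \<mu>_edge(2) by (auto simp: nielsen_edges_def zieschang_edges_def F_def)
  have inv_\<alpha>: "inv\<^bsub>AutoGroup F\<^esub> \<alpha> \<in> auto F"
    using group.inv_closed[OF Aut] \<alpha> by simp
  have "\<phi> (\<iota> u) = \<iota> (\<phi>' u)" if u: "u \<in> carrier F" for u
  proof -
    define v where "v = (inv\<^bsub>AutoGroup F\<^esub> \<alpha>) u"
    have v: "v \<in> carrier F"
      unfolding v_def by (rule hom_in_carrier[OF auto_hom[OF inv_\<alpha>] u])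
    have "\<alpha> \<otimes>\<^bsub>AutoGroup F\<^esub> inv\<^bsub>AutoGroup F\<^esub> \<alpha> = \<one>\<^bsub>AutoGroup F\<^esub>"
      using group.r_inv[OF Aut] \<alpha> by simp
    from fun_cong[OF this, of u] have "\<alpha> v = u"
      using u by (simp add: AutoGroup_mult[OF \<alpha> inv_\<alpha>] AutoGroup_one compose_def v_def)
    have \<phi>'u: "\<phi>' u = \<mu> v"
      using u by (simp add: \<phi>'_def AutoGroup_mult[OF \<mu> inv_\<alpha>] compose_def v_def)
    have v_letters: "set v \<subseteq> ?L"
      using v by (simp add: F_def carrier_Fgp)
    have concat_single: "concat (map (\<lambda>l. [\<sigma> l]) x) = map \<sigma> x" for x
      by (induction x) auto
    have "\<mu> v = reduce (map \<sigma> v)"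
      using v by (simp add: \<mu>_def letter_hom_def concat_single)
    then have "FF.\<Theta> (\<iota> (\<mu> v)) = reduce (map emb (map \<sigma> v))"
      unfolding \<Theta>\<iota> emb_def by (simp only: reduce_map_letters[OF inj_Inr])
    also have "\<dots> = \<Phi> (\<alpha> v)"
      using word[OF v] s_eq[OF v_letters] by simp
    finally have "FF.\<Theta> (\<iota> (\<phi>' u)) = FF.\<Theta> (\<phi> (\<iota> u))"
      by (simp add: \<open>\<alpha> v = u\<close> \<phi>'u \<Phi>_def)
    moreover have "\<iota> (\<phi>' u) \<in> carrier P"
      unfolding \<phi>'u by (rule hom_in_carrier[OF \<iota> hom_in_carrier[OF auto_hom[OF \<mu>] v]])
    moreover have "\<phi> (\<iota> u) \<in> carrier P"
      using hom_in_carrier[OF \<phi>\<iota> u] by simp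
    ultimately show ?thesis
      using inj_onD[OF \<Theta>_inj] by metis
  qed
  with edge \<mu>_edge(1) show ?thesis
    by (auto simp: zieschang_elements_iff)
qed

end
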